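(* Let $M$ be a complete $C^1$ Finsler manifold modeled on a Banach space $X$ that admits a $C^1$ Lipschitz bump function, and let $H\colon M\times\mathbb{R}\to\mathbb{R}$ be a continuous function satisfying condition (A) (defined in the context). Let $u:M\to\mathbb{R}$ be a viscosity subsolution and $v:M\to\mathbb{R}$ a viscosity supersolution of the Hamilton–Jacobi equation $$u(x)+H(x,\|du(x)\|_x)=0\quad\text{on }M.$$ If $u$ and $v$ are bounded and for every $x\in M$ either $u$ or $v$ is Lipschitz in a neighborhood of $x$, then $$\inf_M(v-u)\ge0.$$
   Context: $C^1$ Finsler manifold (in the sense of Palais): a connected, paracompact $C^1$ Banach manifold $M$ modeled on a Banach space $(X,\|\cdot\|)$, with a continuous map $\|\cdot\|_M:TM\to[0,\infty)$ such that: (P1) for every $x\in M$ the restriction $\|\cdot\|_x$ of $\|\cdot\|_M$ to $T_xM$ is a norm such that for every chart $\varphi:U\to X$ with $x\in U$, the norm $v\in X\mapsto\|d\varphi^{-1}(\varphi(x))(v)\|_x$ is equivalent to $\|\cdot\|$; (P2) for every $x_0\in M$, $\varepsilon>0$ and chart $\varphi:U\to X$ with $x_0\in U$ there is an open neighborhood $W$ of $x_0$ such that for all $x\in W$, $v\in X$, $\frac{1}{1+\varepsilon}\|d\varphi^{-1}(\varphi(x_0))(v)\|_{x_0}\le\|d\varphi^{-1}(\varphi(x))(v)\|_x\le(1+\varepsilon)\|d\varphi^{-1}(\varphi(x_0))(v)\|_{x_0}$. Finsler metric: $d(p,q)$ is the infimum of the lengths $\ell(c)=\int_a^b\|c'(t)\|_{c(t)}\,dt$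 over piecewise $C^1$ paths $c:[a,b]\to M$ connecting $p$ to $q$. $M$ is complete if $(M,d)$ is complete; Lipschitz is with respect to $d$. $C^1$ Lipschitz bump function on $X$: a $C^1$, Lipschitz function $b:X\to\mathbb{R}$ with bounded, non-empty support. Sub/superdifferential: $D^-f(x)$ (resp. $D^+f(x)$) is the set of $dg(x)\in T_xM^*$ where $g:M\to\mathbb{R}$ is $C^1$ and $f-g$ attains a local minimum (resp. local maximum) at $x$. For $\xi\in T_xM^*$, $\|\xi\|_x$ denotes the dual norm $\sup\{|\xi(v)|:v\in T_xM,\ \|v\|_x=1\}$. Viscosity subsolution: $u$ is upper semicontinuous and $u(x)+H(x,\|\Delta\|_x)\le0$ for every $x\in M$, $\Delta\in D^+u(x)$. Viscosity supersolution: $u$ is lower semicontinuous and $u(x)+H(x,\|\Delta\|_x)\ge0$ for every $x\in M$, $\Delta\in D^-u(x)$. Condition (A): there are a constant $C\ge0$ and a continuous function $\omega:\mathbb{R}\times\mathbb{R}\to\mathbb{R}$ with $\omega(0,0)=0$ such that for all $x_1,x_2\in M$ and $t_1,t_2\in\mathbb{R}$, $|H(x_1,t_1)-H(x_2,t_2)|\le\omega(d(x_1,x_2),t_1-t_2)+C\max\{|t_1|,|t_2|\}\,d(x_1,x_2)$. *)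

theory Defs
  imports "HOL-Analysis.Analysis"
begin

section \<open>C1 maps and bump functions on Banach spaces\<close>

text \<open>Continuous differentiability (Frechet, continuous in operator norm) on a set that is open
  in all uses below.\<close>

definition C1_on :: "'a::real_normed_vector set \<Rightarrow> ('a \<Rightarrow> 'b::real_normed_vector) \<Rightarrow> bool" where
  "C1_on S f \<longleftrightarrow> (\<exists>f' :: 'a \<Rightarrow> 'a \<Rightarrow>\<^sub>L 'b.
     (\<forall>x\<in>S. (f has_derivative blinfun_apply (f' x)) (at x)) \<and> continuous_on S f')"

definition C1_Lipschitz_bump :: "('x::real_normed_vector \<Rightarrow> real) \<Rightarrow> bool" where
  "C1_Lipschitz_bump b \<longleftrightarrow> C1_on UNIV b \<and> (\<exists>L. lipschitz_on L UNIV b) \<and>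
     bounded (closure {x. b x \<noteq> 0}) \<and> closure {x. b x \<noteq> 0} \<noteq> {}"


section \<open>C1 Banach manifolds\<close>

text \<open>The points of the manifold form the whole type \<open>'m\<close>, the model space is \<open>'x\<close>.
  A chart is a pair of its domain and a coordinate map; the values of the coordinate map outside
  the domain are irrelevant. A C1 structure is given by an arbitrary C1 atlas \<open>A\<close>;
  "every chart" means every chart of the maximal atlas \<open>charts A\<close>.\<close>

type_synonym ('m, 'x) chart = "'m set \<times> ('m \<Rightarrow> 'x)"

abbreviation chart_dom :: "('m, 'x) chart \<Rightarrow> 'm set" where
  "chart_dom c \<equiv> fst c"

abbreviation chart_map :: "('m, 'x) chart \<Rightarrow> 'm \<Rightarrow> 'x" where
  "chart_map c \<equiv> snd c"

abbreviation chart_inv :: "('m, 'x) chart \<Rightarrow> 'x \<Rightarrow> 'm" where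
  "chart_inv c \<equiv> inv_into (fst c) (snd c)"

definition is_chart :: "('m::topological_space, 'x::real_normed_vector) chart \<Rightarrow> bool" where
  "is_chart c \<longleftrightarrow> open (chart_dom c) \<and> open (chart_map c ` chart_dom c) \<and>
     homeomorphism (chart_dom c) (chart_map c ` chart_dom c) (chart_map c) (chart_inv c)"

definition C1_compatible ::
    "('m::topological_space, 'x::real_normed_vector) chart \<Rightarrow> ('m, 'x) chart \<Rightarrow> bool" where
  "C1_compatible c c' \<longleftrightarrow>
     C1_on (chart_map c ` (chart_dom c \<inter> chart_dom c')) (chart_map c' \<circ> chart_inv c) \<and>
     C1_on (chart_map c' ` (chart_dom c \<inter> chart_dom c')) (chart_map c \<circ> chart_inv c')"

definition C1_atlas :: "('m::topological_space, 'x::real_normed_vector) chart set \<Rightarrow> bool" where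
  "C1_atlas A \<longleftrightarrow> (\<forall>c\<in>A. is_chart c) \<and> (\<Union>c\<in>A. chart_dom c) = UNIV \<and>
     (\<forall>c\<in>A. \<forall>c'\<in>A. C1_compatible c c')"

definition charts ::
    "('m::topological_space, 'x::real_normed_vector) chart set \<Rightarrow> ('m, 'x) chart set" where
  "charts A = {c. is_chart c \<and> (\<forall>c'\<in>A. C1_compatible c c')}"

definition paracompact_space :: "'m::t2_space itself \<Rightarrow> bool" where
  "paracompact_space _ \<longleftrightarrow>
     (\<forall>\<U>::'m set set. (\<forall>U\<in>\<U>. open U) \<and> \<Union>\<U> = UNIV \<longrightarrow>
       (\<exists>\<V>. (\<forall>V\<in>\<V>. open V) \<and> \<Union>\<V> = UNIV \<and> (\<forall>V\<in>\<V>. \<exists>U\<in>\<U>. V \<subseteq> U) \<and>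
            locally_finite_in euclidean \<V>))"

definition C1_fun ::
    "('m::topological_space, 'x::real_normed_vector) chart set \<Rightarrow> ('m \<Rightarrow> real) \<Rightarrow> bool" where
  "C1_fun A g \<longleftrightarrow>
     (\<forall>c\<in>charts A. C1_on (chart_map c ` chart_dom c) (g \<circ> chart_inv c))"


section \<open>Tangent bundle\<close>

text \<open>A tangent vector at \<open>x\<close> is an equivalence class of pairs (chart at \<open>x\<close>, vector of the
  model space), where pairs are identified via the derivatives of the transition maps.
  \<open>tangent_vec A c x v\<close> is the class of \<open>(c, v)\<close>; thus, for a chart \<open>c = (U, \<phi>)\<close> at \<open>x\<close>,
  the map \<open>tangent_vec A c x\<close> is $d\varphi^{-1}(\varphi(x)) : X \to T_xM$, and the linear
  structure of $T_xM$ is the one that makes these maps linear isomorphisms.\<close>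

type_synonym ('m, 'x) tangent = "(('m, 'x) chart \<times> 'x) set"

definition tangent_vec ::
    "('m::topological_space, 'x::real_normed_vector) chart set \<Rightarrow> ('m, 'x) chart \<Rightarrow> 'm \<Rightarrow> 'x
      \<Rightarrow> ('m, 'x) tangent" where
  "tangent_vec A c x v =
     {(c', w). c' \<in> charts A \<and> x \<in> chart_dom c' \<and>
        w = frechet_derivative (chart_map c' \<circ> chart_inv c) (at (chart_map c x)) v}"

definition tangent_space ::
    "('m::topological_space, 'x::real_normed_vector) chart set \<Rightarrow> 'm \<Rightarrow> ('m, 'x) tangent set" where
  "tangent_space A x = {tangent_vec A c x v | c v. c \<in> charts A \<and> x \<in> chart_dom c}"

text \<open>The topology of $TM$: the images of open sets under the local trivializations
  $U \times X \to TM$ form a base.\<close>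

definition tangent_bundle ::
    "('m::topological_space, 'x::real_normed_vector) chart set \<Rightarrow> ('m \<times> ('m, 'x) tangent) topology" where
  "tangent_bundle A = topology_generated_by
     {(\<lambda>(x, v). (x, tangent_vec A c x v)) ` W | c W.
        c \<in> charts A \<and> open W \<and> W \<subseteq> chart_dom c \<times> UNIV}"

text \<open>The differential $dg(x) \in T_xM^*$ of a C1 function, as a function on $T_xM$.\<close>

definition differential ::
    "('m::topological_space, 'x::real_normed_vector) chart set \<Rightarrow> ('m \<Rightarrow> real) \<Rightarrow> 'm
      \<Rightarrow> ('m, 'x) tangent \<Rightarrow> real" where
  "differential A g x = (\<lambda>\<xi>\<in>tangent_space A x.
     THE r. \<forall>(c, w)\<in>\<xi>. r = frechet_derivative (g \<circ> chart_inv c) (at (chart_map c x)) w)"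


section \<open>Finsler manifolds in the sense of Palais\<close>

definition is_norm :: "('x::real_vector \<Rightarrow> real) \<Rightarrow> bool" where
  "is_norm N \<longleftrightarrow> (\<forall>v. 0 \<le> N v) \<and> (\<forall>v. N v = 0 \<longleftrightarrow> v = 0) \<and>
     (\<forall>a v. N (a *\<^sub>R v) = \<bar>a\<bar> * N v) \<and> (\<forall>v w. N (v + w) \<le> N v + N w)"

definition equivalent_to_norm :: "('x::real_normed_vector \<Rightarrow> real) \<Rightarrow> bool" where
  "equivalent_to_norm N \<longleftrightarrow> (\<exists>m>0. \<exists>K>0. \<forall>v. m * norm v \<le> N v \<and> N v \<le> K * norm v)"

text \<open>\<open>F x \<xi>\<close> is $\|\xi\|_x$; only its values for \<open>\<xi> \<in> tangent_space A x\<close> matter. That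
  \<open>F x\<close> is a norm on $T_xM$ is expressed through the linear isomorphisms
  \<open>tangent_vec A c x\<close>. The Hausdorff property, part of the convention for
  paracompactness, is provided by the class \<open>t2_space\<close>.\<close>

definition C1_Finsler_manifold ::
    "('m::t2_space, 'x::banach) chart set \<Rightarrow> ('m \<Rightarrow> ('m, 'x) tangent \<Rightarrow> real) \<Rightarrow> bool" where
  "C1_Finsler_manifold A F \<longleftrightarrow>
     connected (UNIV :: 'm set) \<and> paracompact_space TYPE('m) \<and> C1_atlas A \<and>
     continuous_map (tangent_bundle A) euclideanreal (\<lambda>(x, \<xi>). F x \<xi>) \<and>
     (\<forall>x. \<forall>c\<in>charts A. x \<in> chart_dom c \<longrightarrow>
        is_norm (\<lambda>v. F x (tangent_vec A c x v)) \<and>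
        equivalent_to_norm (\<lambda>v. F x (tangent_vec A c x v))) \<and>
     (\<forall>x\<^sub>0. \<forall>\<epsilon>>0. \<forall>c\<in>charts A. x\<^sub>0 \<in> chart_dom c \<longrightarrow>
        (\<exists>W. open W \<and> x\<^sub>0 \<in> W \<and> W \<subseteq> chart_dom c \<and>
          (\<forall>x\<in>W. \<forall>v.
             1 / (1 + \<epsilon>) * F x\<^sub>0 (tangent_vec A c x\<^sub>0 v) \<le> F x (tangent_vec A c x v) \<and>
             F x (tangent_vec A c x v) \<le> (1 + \<epsilon>) * F x\<^sub>0 (tangent_vec A c x\<^sub>0 v))))"

text \<open>C1 paths on a closed interval have one-sided derivatives at the end points, and the
  derivative is continuous up to the end points; for piecewise C1 paths this applies to the
  closed pieces. (The library's \<open>piecewise_C1_differentiable_on\<close> is weaker: it does not require the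
  derivative to have one-sided limits at the break points.)\<close>

definition C1_path ::
    "('m::topological_space, 'x::real_normed_vector) chart set \<Rightarrow> real \<Rightarrow> real \<Rightarrow> (real \<Rightarrow> 'm) \<Rightarrow> bool" where
  "C1_path A a b \<gamma> \<longleftrightarrow> continuous_on {a..b} \<gamma> \<and>
     (\<forall>c\<in>charts A. \<exists>D.
        (\<forall>t\<in>{t\<in>{a..b}. \<gamma> t \<in> chart_dom c}.
           (chart_map c \<circ> \<gamma> has_vector_derivative D t) (at t within {a..b})) \<and>
        continuous_on {t\<in>{a..b}. \<gamma> t \<in> chart_dom c} D)"

definition piecewise_C1_path ::
    "('m::topological_space, 'x::real_normed_vector) chart set \<Rightarrow> real \<Rightarrow> real \<Rightarrow> (real \<Rightarrow> 'm) \<Rightarrow> bool" where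
  "piecewise_C1_path A a b \<gamma> \<longleftrightarrow> continuous_on {a..b} \<gamma> \<and>
     (\<exists>S. finite S \<and>
        (\<forall>s t. a \<le> s \<and> s < t \<and> t \<le> b \<and> S \<inter> {s<..<t} = {} \<longrightarrow> C1_path A s t \<gamma>))"

text \<open>The value at the finitely many break points of a piecewise C1 path is immaterial, as it does
  not affect the length.\<close>

definition velocity ::
    "('m::topological_space, 'x::real_normed_vector) chart set \<Rightarrow> real \<Rightarrow> real \<Rightarrow> (real \<Rightarrow> 'm) \<Rightarrow> real
      \<Rightarrow> ('m, 'x) tangent" where
  "velocity A a b \<gamma> t =
     {(c, w). c \<in> charts A \<and> \<gamma> t \<in> chart_dom c \<and>
        w = vector_derivative (chart_map c \<circ> \<gamma>) (at t within {a..b})}"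

definition path_len ::
    "('m::topological_space, 'x::real_normed_vector) chart set \<Rightarrow> ('m \<Rightarrow> ('m, 'x) tangent \<Rightarrow> real)
      \<Rightarrow> real \<Rightarrow> real \<Rightarrow> (real \<Rightarrow> 'm) \<Rightarrow> real" where
  "path_len A F a b \<gamma> = integral {a..b} (\<lambda>t. F (\<gamma> t) (velocity A a b \<gamma> t))"

definition Finsler_dist ::
    "('m::topological_space, 'x::real_normed_vector) chart set \<Rightarrow> ('m \<Rightarrow> ('m, 'x) tangent \<Rightarrow> real)
      \<Rightarrow> 'm \<Rightarrow> 'm \<Rightarrow> real" where
  "Finsler_dist A F p q =
     Inf {path_len A F a b \<gamma> | a b \<gamma>.
            a < b \<and> piecewise_C1_path A a b \<gamma> \<and> \<gamma> a = p \<and> \<gamma> b = q}"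

definition Finsler_complete ::
    "('m::topological_space, 'x::real_normed_vector) chart set \<Rightarrow> ('m \<Rightarrow> ('m, 'x) tangent \<Rightarrow> real)
      \<Rightarrow> bool" where
  "Finsler_complete A F \<longleftrightarrow> Metric_space.mcomplete UNIV (Finsler_dist A F)"

definition Lipschitz_near ::
    "('m::topological_space, 'x::real_normed_vector) chart set \<Rightarrow> ('m \<Rightarrow> ('m, 'x) tangent \<Rightarrow> real)
      \<Rightarrow> ('m \<Rightarrow> real) \<Rightarrow> 'm \<Rightarrow> bool" where
  "Lipschitz_near A F f x \<longleftrightarrow> (\<exists>W. open W \<and> x \<in> W \<and>
     (\<exists>L. \<forall>y\<in>W. \<forall>z\<in>W. \<bar>f y - f z\<bar> \<le> L * Finsler_dist A F y z))"


section \<open>Viscosity solutions of Hamilton--Jacobi equations\<close>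

definition subdifferential ::
    "('m::topological_space, 'x::real_normed_vector) chart set \<Rightarrow> ('m \<Rightarrow> real) \<Rightarrow> 'm
      \<Rightarrow> (('m, 'x) tangent \<Rightarrow> real) set" where
  "subdifferential A f x =
     {differential A g x | g. C1_fun A g \<and> (\<forall>\<^sub>F y in nhds x. f x - g x \<le> f y - g y)}"

definition superdifferential ::
    "('m::topological_space, 'x::real_normed_vector) chart set \<Rightarrow> ('m \<Rightarrow> real) \<Rightarrow> 'm
      \<Rightarrow> (('m, 'x) tangent \<Rightarrow> real) set" where
  "superdifferential A f x =
     {differential A g x | g. C1_fun A g \<and> (\<forall>\<^sub>F y in nhds x. f y - g y \<le> f x - g x)}"

text \<open>The supremum is taken in $[0,\infty)$; inserting \<open>0\<close> only matters when the model space is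
  trivial, so that there are no unit vectors.\<close>

definition dual_norm ::
    "('m::topological_space, 'x::real_normed_vector) chart set \<Rightarrow> ('m \<Rightarrow> ('m, 'x) tangent \<Rightarrow> real)
      \<Rightarrow> 'm \<Rightarrow> (('m, 'x) tangent \<Rightarrow> real) \<Rightarrow> real" where
  "dual_norm A F x \<Delta> = Sup (insert 0 {\<bar>\<Delta> \<xi>\<bar> | \<xi>. \<xi> \<in> tangent_space A x \<and> F x \<xi> = 1})"

definition upper_semicontinuous :: "('m::topological_space \<Rightarrow> real) \<Rightarrow> bool" where
  "upper_semicontinuous f \<longleftrightarrow> (\<forall>a. open {x. f x < a})"

definition lower_semicontinuous :: "('m::topological_space \<Rightarrow> real) \<Rightarrow> bool" where
  "lower_semicontinuous f \<longleftrightarrow> (\<forall>a. open {x. a < f x})"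

definition viscosity_subsolution ::
    "('m::topological_space, 'x::real_normed_vector) chart set \<Rightarrow> ('m \<Rightarrow> ('m, 'x) tangent \<Rightarrow> real)
      \<Rightarrow> ('m \<times> real \<Rightarrow> real) \<Rightarrow> ('m \<Rightarrow> real) \<Rightarrow> bool" where
  "viscosity_subsolution A F H u \<longleftrightarrow> upper_semicontinuous u \<and>
     (\<forall>x. \<forall>\<Delta>\<in>superdifferential A u x. u x + H (x, dual_norm A F x \<Delta>) \<le> 0)"

definition viscosity_supersolution ::
    "('m::topological_space, 'x::real_normed_vector) chart set \<Rightarrow> ('m \<Rightarrow> ('m, 'x) tangent \<Rightarrow> real)
      \<Rightarrow> ('m \<times> real \<Rightarrow> real) \<Rightarrow> ('m \<Rightarrow> real) \<Rightarrow> bool" where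
  "viscosity_supersolution A F H u \<longleftrightarrow> lower_semicontinuous u \<and>
     (\<forall>x. \<forall>\<Delta>\<in>subdifferential A u x. u x + H (x, dual_norm A F x \<Delta>) \<ge> 0)"

definition condition_A ::
    "('m::topological_space, 'x::real_normed_vector) chart set \<Rightarrow> ('m \<Rightarrow> ('m, 'x) tangent \<Rightarrow> real)
      \<Rightarrow> ('m \<times> real \<Rightarrow> real) \<Rightarrow> bool" where
  "condition_A A F H \<longleftrightarrow>
     (\<exists>C\<ge>0. \<exists>\<omega> :: real \<times> real \<Rightarrow> real. continuous_on UNIV \<omega> \<and> \<omega> (0, 0) = 0 \<and>
        (\<forall>x\<^sub>1 x\<^sub>2 t\<^sub>1 t\<^sub>2. \<bar>H (x\<^sub>1, t\<^sub>1) - H (x\<^sub>2, t\<^sub>2)\<bar> \<le>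
           \<omega> (Finsler_dist A F x\<^sub>1 x\<^sub>2, t\<^sub>1 - t\<^sub>2)
           + C * max \<bar>t\<^sub>1\<bar> \<bar>t\<^sub>2\<bar> * Finsler_dist A F x\<^sub>1 x\<^sub>2))"

end

theory Submission
  imports Defs
begin

text \<open>
  Suppose \<open>inf (v - u) < 0\<close>. Ekeland's principle in the complete Finsler metric \<open>d\<close> gives a
  point \<open>x0\<close>, almost minimising \<open>v - u\<close>, at which \<open>v - u + e d(\<cdot>, x0)\<close> is minimal. From there on the
  argument takes place in one chart at \<open>x0\<close>, that is, in the Banach space \<open>X\<close>, with \<open>d\<close> bounded above
  by twice the norm \<open>N\<close> at \<open>x0\<close>.

  A fuzzy sum rule for \<open>f1 = v\<close> and \<open>f2 = -u\<close> is obtained by a penalised minimisation of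
  \<open>f1(x) + f2(y) + 2e N(z - a)\<close> with separate variables; the norm needs a variable of its own because it is
  not smooth and hence may not enter a test function. The penalties are rescaled copies of one C1 function
  \<open>\<beta>\<close>, built from the bump, which vanishes at \<open>0\<close> and equals \<open>1\<close> outside the unit ball; a series of
  such functions also serves as the perturbation in the smooth variational principle of Deville, Godefroy and
  Zizler. Local Lipschitz continuity of \<open>u\<close> or \<open>v\<close> bounds the resulting differentials by a constant
  depending on \<open>x0\<close> only; so on a small enough neighbourhood (P2) makes their dual norms
  comparable, and \<open>d(x1, x2)\<close> times these norms is as small as desired. Condition (A) then
  contradicts \<open>inf (v - u) < 0\<close>.
\<close>

section \<open>A variational principle\<close>

text \<open>Two topologies have to be reconciled: semicontinuity and test functions refer to the
  manifold topology, completeness and condition (A) to the metric \<open>d\<close>. The bridge is a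
  lower bound for \<open>d\<close> in a chart, obtained by cutting a path at the time it leaves a
  chart ball. Balls of X need not be compact, so that their images are closed in M is not automatic;
  it comes from the regularity that paracompactness provides. The same closedness allows a test
  function built in a chart to be cut off and extended by 0 to all of M.

  One minimisation principle with abstract gauges \<open>G\<close> covers both variational steps:
  truncated multiples of \<open>d\<close> give Ekeland's principle on M, and copies of \<beta> on
  triples of vectors give the smooth principle in X.

  Passing from u to -u turns sub- and supersolution property alike into statements about local
  minima. A single lemma on pairs of test functions then serves whichever of the two functions is
  Lipschitz.\<close>

lemma ex_near_minimiser:
  fixes h :: "'a \<Rightarrow> real"
  assumes "\<And>x. x \<in> M \<Longrightarrow> m \<le> h x" "y \<in> M" "e > 0"
  shows "\<exists>y'\<in>M. h y' \<le> h y \<and> (\<forall>x\<in>M. h y' \<le> h x + e)"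
proof -
  have bdd: "bdd_below (h ` M)" using assms(1) by (auto intro!: bdd_belowI)
  show ?thesis
  proof (cases "h y \<le> Inf (h ` M) + e")
    case True
    then show ?thesis
      using assms(2) cINF_lower[OF bdd] by (intro bexI[of _ y]) (fastforce intro: order_trans[OF True])+
  next
    case False
    have "Inf (h ` M) < Inf (h ` M) + e" using assms by simp
    then obtain y' where "y' \<in> M" "h y' < Inf (h ` M) + e"
      using cINF_less_iff[OF _ bdd, of "Inf (h ` M) + e"] assms(2) by blast
    moreover have "\<forall>x\<in>M. Inf (h ` M) \<le> h x" using bdd by (auto intro: cINF_lower)
    ultimately show ?thesis using False by (intro bexI[of _ y']) (auto intro: order_trans less_imp_le)
  qed
qed

text \<open>\<open>Y n\<close> is chosen recursively as a minimiser of the partially perturbed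
  function \<open>h n\<close> up to half the weight \<open>\<delta> n\<close> of the next
  perturbation. A point that does no worse than \<open>Y n\<close> once this perturbation is added
  has gauge at most 1/2, hence lies within \<open>r n\<close> of \<open>Y n\<close>. This makes
  \<open>Y\<close> Cauchy, and its limit minimises the full sum. \<open>G\<close> need not be
  symmetric nor satisfy a triangle inequality.\<close>

lemma (in Metric_space) perturbed_minimum:
  fixes f :: "'a \<Rightarrow> real" and G :: "nat \<Rightarrow> 'a \<Rightarrow> 'a \<Rightarrow> real" and \<delta> r :: "nat \<Rightarrow> real"
  assumes complete: mcomplete
    and bdd: "\<And>x. x \<in> M \<Longrightarrow> m \<le> f x"
    and lsc: "\<And>\<sigma> l a. \<lbrakk>range \<sigma> \<subseteq> M; l \<in> M; (\<lambda>n. d (\<sigma> n) l) \<longlonglongrightarrow> 0; \<And>n::nat. f (\<sigma> n) \<le> a\<rbrakk> \<Longrightarrow> f l \<le> a"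
    and G_refl: "\<And>i x. x \<in> M \<Longrightarrow> G i x x = 0"
    and G_bounds: "\<And>i x y. 0 \<le> G i x y \<and> G i x y \<le> B"
    and G_cont: "\<And>i y \<sigma> l. \<lbrakk>range \<sigma> \<subseteq> M; l \<in> M; y \<in> M; (\<lambda>n. d (\<sigma> n) l) \<longlonglongrightarrow> 0\<rbrakk>
                    \<Longrightarrow> (\<lambda>n. G i (\<sigma> n) y) \<longlonglongrightarrow> G i l y"
    and G_small: "\<And>i x y. \<lbrakk>x \<in> M; y \<in> M; G i x y < 1\<rbrakk> \<Longrightarrow> d x y \<le> r i"
    and r: "r \<longlonglongrightarrow> 0" and \<delta>: "\<And>i. \<delta> i > 0" "summable \<delta>"
    and y0: "y0 \<in> M"
  obtains y Y where "y \<in> M" "range Y \<subseteq> M" "f y \<le> f y0"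
    "\<And>z. z \<in> M \<Longrightarrow> f y + (\<Sum>i. \<delta> i * G i y (Y i)) \<le> f z + (\<Sum>i. \<delta> i * G i z (Y i))"
proof -
  define lsc' where "lsc' h \<longleftrightarrow> (\<forall>\<sigma> l a. range \<sigma> \<subseteq> M \<longrightarrow> l \<in> M \<longrightarrow> (\<lambda>n. d (\<sigma> n) l) \<longlonglongrightarrow> 0 \<longrightarrow>
      (\<forall>n::nat. h (\<sigma> n) \<le> a) \<longrightarrow> h l \<le> a)" for h :: "'a \<Rightarrow> real"
  have lsc_add: "lsc' (\<lambda>x. h x + \<delta> i * G i x y)" if "lsc' h" "y \<in> M" for h i y
    unfolding lsc'_def
  proof (intro allI impI)
    fix \<sigma> l a assume \<sigma>: "range \<sigma> \<subseteq> M" "l \<in> M" "(\<lambda>n. d (\<sigma> n) l) \<longlonglongrightarrow> 0"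
      and le: "\<forall>n::nat. h (\<sigma> n) + \<delta> i * G i (\<sigma> n) y \<le> a"
    have lim: "(\<lambda>n. \<delta> i * G i (\<sigma> n) y) \<longlonglongrightarrow> \<delta> i * G i l y"
      using G_cont[OF \<sigma>(1,2) that(2) \<sigma>(3)] by (intro tendsto_intros)
    have "h l \<le> a - \<delta> i * G i l y + e" if "e > 0" for e
    proof -
      have "\<forall>\<^sub>F n in sequentially. \<delta> i * G i (\<sigma> n) y > \<delta> i * G i l y - e"
        using lim \<open>e > 0\<close> by (intro order_tendstoD) auto
      then obtain N where N: "\<And>n. n \<ge> N \<Longrightarrow> \<delta> i * G i (\<sigma> n) y > \<delta> i * G i l y - e"
        by (auto simp: eventually_sequentially)
      have "h (\<sigma> (n + N)) \<le> a - \<delta> i * G i l y + e" for n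
        using N[of "n + N"] le[rule_format, of "n + N"] by simp
      moreover have "(\<lambda>n. d (\<sigma> (n + N)) l) \<longlonglongrightarrow> 0" using \<sigma>(3) by (rule LIMSEQ_ignore_initial_segment)
      ultimately show ?thesis
        using \<open>lsc' h\<close> \<sigma> unfolding lsc'_def by (elim allE[of _ "\<lambda>n. \<sigma> (n + N)"]) auto
    qed
    then show "h l + \<delta> i * G i l y \<le> a" by (metis field_le_epsilon le_diff_eq)
  qed
  have G0: "0 \<le> \<delta> i * G i x y" for i x y using G_bounds \<delta>(1)[of i] by (simp add: less_imp_le)
  \<comment> \<open>The recursion runs over pairs of a perturbed function and a point:
    \<open>P\<close> is the invariant of the n-th pair, \<open>Q\<close> the passage to the next
    one. Both are relations because the point is only known to exist.\<close>
  define P where "P i p \<longleftrightarrow> snd p \<in> M \<and> (\<forall>x\<in>M. m \<le> fst p x) \<and> lsc' (fst p) \<and>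
      (\<forall>x\<in>M. fst p (snd p) \<le> fst p x + \<delta> i / 2)" for i :: nat and p :: "('a \<Rightarrow> real) \<times> 'a"
  define Q where "Q i p p' \<longleftrightarrow> fst p' = (\<lambda>x. fst p x + \<delta> i * G i x (snd p)) \<and> fst p' (snd p') \<le> fst p (snd p)"
    for i :: nat and p p' :: "('a \<Rightarrow> real) \<times> 'a"
  have lscf: "lsc' f" unfolding lsc'_def using lsc by blast
  obtain z0 where z0: "z0 \<in> M" "f z0 \<le> f y0" "\<forall>x\<in>M. f z0 \<le> f x + \<delta> 0 / 2"
    using ex_near_minimiser[of M m f y0 "\<delta> 0 / 2"] bdd y0 \<delta>(1)[of 0] by auto
  have "\<exists>g. (\<forall>n. (P n (g n) \<and> (n = 0 \<longrightarrow> g n = (f, z0))) \<and> Q n (g n) (g (Suc n)))"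
  proof -
    have *: "\<exists>p'. (P (Suc n) p' \<and> (Suc n = 0 \<longrightarrow> p' = (f, z0))) \<and> Q n p p'"
      if "P n p \<and> (n = 0 \<longrightarrow> p = (f, z0))" for p n
    proof -
      define h where "h = (\<lambda>x. fst p x + \<delta> n * G n x (snd p))"
      have p: "snd p \<in> M" "\<And>x. x \<in> M \<Longrightarrow> m \<le> fst p x" "lsc' (fst p)" using that by (auto simp: P_def)
      have h: "m \<le> h x" if "x \<in> M" for x
        using p(2)[OF that] G0[of n x "snd p"] by (simp add: h_def)
      obtain y' where y': "y' \<in> M" "h y' \<le> h (snd p)" "\<forall>x\<in>M. h y' \<le> h x + \<delta> (Suc n) / 2"
        using ex_near_minimiser[of M m h "snd p" "\<delta> (Suc n) / 2"] h p \<delta>(1)[of "Suc n"] by auto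
      \<comment> \<open>As \<open>G\<close> vanishes on the diagonal, the new perturbation costs
        nothing at the old point, so the values at the chosen points never increase.\<close>
      have "h (snd p) = fst p (snd p)" using p G_refl by (simp add: h_def)
      then show ?thesis
        using y' h p lsc_add[OF p(3,1), of n] by (intro exI[of _ "(h, y')"]) (auto simp: P_def Q_def h_def)
    qed
    have base: "P 0 (f, z0) \<and> (0 = (0::nat) \<longrightarrow> (f, z0) = (f, z0))"
      using z0 lscf bdd by (auto simp: P_def)
    show ?thesis
      using dependent_nat_choice[of "\<lambda>n p. P n p \<and> (n = 0 \<longrightarrow> p = (f, z0))" Q] base * by blast
  qed
  then obtain g where gP: "\<And>n. P n (g n)" and g0: "g 0 = (f, z0)" and gQ: "\<And>n. Q n (g n) (g (Suc n))"
    by blast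
  define h where "h n = fst (g n)" for n
  define Y where "Y n = snd (g n)" for n
  have YM: "Y n \<in> M" and hlsc: "lsc' (h n)" and hmin: "x \<in> M \<Longrightarrow> h n (Y n) \<le> h n x + \<delta> n / 2" for n x
    using gP[of n] by (auto simp: P_def h_def Y_def)
  have hSuc: "h (Suc n) x = h n x + \<delta> n * G n x (Y n)" and hdec: "h (Suc n) (Y (Suc n)) \<le> h n (Y n)" for n x
    using gQ[of n] by (auto simp: Q_def h_def Y_def)
  have h_sum: "h n x = f x + (\<Sum>i<n. \<delta> i * G i x (Y i))" for n x
    by (induction n) (auto simp: hSuc, auto simp: h_def g0)
  have hmono: "h i x \<le> h j x" if "i \<le> j" for i j x
    using that by (induction rule: dec_induct) (use hSuc G0 in \<open>auto intro: order_trans\<close>)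
  have hdec': "h j (Y j) \<le> h i (Y i)" if "i \<le> j" for i j
    using that by (induction rule: dec_induct) (use hdec in \<open>auto intro: order_trans\<close>)
  \<comment> \<open>The perturbation at x has to be paid from the near-minimality gap
    \<open>\<delta> i / 2\<close>, which leaves a gauge of at most 1/2, safely below the threshold 1
    of \<open>G_small\<close>.\<close>
  have close: "d x (Y i) \<le> r i" if "x \<in> M" "h (Suc i) x \<le> h i (Y i)" for x i
  proof -
    have "\<delta> i * G i x (Y i) \<le> \<delta> i * (1/2)" using that hmin[OF that(1), of i] hSuc[of i x] by simp
    then have "G i x (Y i) \<le> 1/2" using \<delta>(1)[of i] by (simp only: mult_le_cancel_left_pos)
    then show ?thesis using G_small[OF that(1) YM] by simp
  qed
  \<comment> \<open>All later points satisfy the hypothesis of \<open>close\<close>: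
    \<open>h\<close> grows with its index while the values \<open>h j (Y j)\<close>
    decrease.\<close>
  have inS: "h (Suc i) (Y j) \<le> h i (Y i)" if "i < j" for i j
    using that hmono[of "Suc i" j "Y j"] hdec'[of i j] by simp
  have "MCauchy Y"
    unfolding MCauchy_def
  proof (intro conjI allI impI)
    show "range Y \<subseteq> M" using YM by auto
    fix e :: real assume "e > 0"
    then obtain N where N: "r N < e/2"
      using order_tendstoD(2)[OF r, of "e/2"] by (auto simp: eventually_sequentially)
    have "d (Y n) (Y n') < e" if "N < n" "N < n'" for n n'
    proof -
      have "d (Y n) (Y n') \<le> d (Y n) (Y N) + d (Y n') (Y N)"
        using triangle'[of "Y n" "Y N" "Y n'"] YM by simp
      also have "\<dots> \<le> r N + r N" using that by (intro add_mono close inS YM)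
      finally show ?thesis using N by simp
    qed
    then show "\<exists>N. \<forall>n n'. N \<le> n \<longrightarrow> N \<le> n' \<longrightarrow> d (Y n) (Y n') < e" by (intro exI[of _ "Suc N"]) auto
  qed
  then obtain y where "limitin mtopology Y y sequentially" using complete by (auto simp: mcomplete_def)
  then have yM: "y \<in> M" and ylim: "(\<lambda>n. d (Y n) y) \<longlonglongrightarrow> 0" by (auto simp: limitin_metric_dist_null)
  have yS: "h (Suc i) y \<le> h i (Y i)" for i
  proof -
    have "(\<lambda>n. d (Y (n + Suc i)) y) \<longlonglongrightarrow> 0" using ylim by (rule LIMSEQ_ignore_initial_segment)
    moreover have "h (Suc i) (Y (n + Suc i)) \<le> h i (Y i)" for n by (rule inS) simp
    ultimately show ?thesis
      using hlsc[of "Suc i"] yM YM unfolding lsc'_def by (elim allE[of _ "\<lambda>n. Y (n + Suc i)"]) auto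
  qed
  have summ: "summable (\<lambda>i. \<delta> i * G i x (Y i))" for x
  proof (rule summable_comparison_test')
    show "summable (\<lambda>i. \<delta> i * B)" using \<delta>(2) by (rule summable_mult2)
    show "norm (\<delta> n * G n x (Y n)) \<le> \<delta> n * B" if "n \<ge> 0" for n
      using G_bounds[of n x "Y n"] \<delta>(1)[of n] by (simp add: abs_mult less_imp_le mult_left_mono)
  qed
  have hlim: "(\<lambda>n. h n x) \<longlonglongrightarrow> f x + (\<Sum>i. \<delta> i * G i x (Y i))" for x
    unfolding h_sum by (intro tendsto_intros summable_LIMSEQ summ)
  show ?thesis
  proof
    show "y \<in> M" "range Y \<subseteq> M" using yM YM by auto
    have "f y \<le> h (Suc 0) y" using hmono[of 0 "Suc 0" y] by (simp add: h_def g0)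
    also have "\<dots> \<le> f z0" using yS[of 0] by (simp add: h_def Y_def g0)
    finally show "f y \<le> f y0" using z0 by simp
    fix z assume z: "z \<in> M"
    \<comment> \<open>Limit of the chain
      \<open>h (Suc n) y \<le> h n (Y n) \<le> h n z + \<delta> n / 2\<close>, whose error tends to
      0 by summability.\<close>
    show "f y + (\<Sum>i. \<delta> i * G i y (Y i)) \<le> f z + (\<Sum>i. \<delta> i * G i z (Y i))"
    proof (rule LIMSEQ_le)
      show "(\<lambda>n. h (Suc n) y) \<longlonglongrightarrow> f y + (\<Sum>i. \<delta> i * G i y (Y i))" using hlim by (rule LIMSEQ_Suc)
      have "(\<lambda>n. h n z + \<delta> n / 2) \<longlonglongrightarrow> f z + (\<Sum>i. \<delta> i * G i z (Y i)) + 0 / 2"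
        using summable_LIMSEQ_zero[OF \<delta>(2)] by (intro tendsto_intros hlim) auto
      then show "(\<lambda>n. h n z + \<delta> n / 2) \<longlonglongrightarrow> f z + (\<Sum>i. \<delta> i * G i z (Y i))" by simp
      show "\<exists>N. \<forall>n\<ge>N. h (Suc n) y \<le> h n z + \<delta> n / 2"
        using yS hmin[OF z] by (meson order_trans)
    qed
  qed
qed

text \<open>With gauges \<open>min 1 (2^i * d x y)\<close> and weights
  \<open>e / 2 * (1/4)^i\<close>, moving from y to z changes the i-th term by at most
  \<open>e / 2 * (1/2)^i * d z y\<close>, and these bounds add up to \<open>e * d z y\<close>. The
  truncation at 1 keeps the gauges bounded and leaves them intact below the threshold.\<close>

lemma (in Metric_space) Ekeland:
  fixes f :: "'a \<Rightarrow> real"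
  assumes complete: mcomplete
    and bdd: "\<And>x. x \<in> M \<Longrightarrow> m \<le> f x"
    and lsc: "\<And>\<sigma> l a. \<lbrakk>range \<sigma> \<subseteq> M; l \<in> M; (\<lambda>n. d (\<sigma> n) l) \<longlonglongrightarrow> 0; \<And>n::nat. f (\<sigma> n) \<le> a\<rbrakk> \<Longrightarrow> f l \<le> a"
    and y0: "y0 \<in> M" and e: "e > 0"
  obtains y where "y \<in> M" "f y \<le> f y0" "\<And>z. z \<in> M \<Longrightarrow> f y \<le> f z + e * d z y"
proof -
  define \<delta> :: "nat \<Rightarrow> real" where "\<delta> i = e / 2 * (1/4)^i" for i
  define G where "G i x y = min 1 (2^i * d x y)" for i x y
  have sum2: "(\<lambda>i. e/2 * (1/2)^i) sums (e/2 * (1 / (1 - 1/2)))"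
    by (intro sums_mult geometric_sums) auto
  obtain y Y where Y: "y \<in> M" "range Y \<subseteq> M" "f y \<le> f y0"
    and min: "\<And>z. z \<in> M \<Longrightarrow> f y + (\<Sum>i. \<delta> i * G i y (Y i)) \<le> f z + (\<Sum>i. \<delta> i * G i z (Y i))"
  proof (rule perturbed_minimum[of m f G 1 "\<lambda>i. (1/2)^i" \<delta> y0])
    show "(\<lambda>n. G i (\<sigma> n) y) \<longlonglongrightarrow> G i l y"
      if "range \<sigma> \<subseteq> M" "l \<in> M" "y \<in> M" "(\<lambda>n. d (\<sigma> n) l) \<longlonglongrightarrow> 0" for i y \<sigma> l
    proof -
      have "(\<lambda>n. d (\<sigma> n) y) \<longlonglongrightarrow> d l y"
      proof (rule LIM_zero_cancel, rule Lim_null_comparison)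
        show "\<forall>\<^sub>F n in sequentially. norm (d (\<sigma> n) y - d l y) \<le> d (\<sigma> n) l"
        proof (rule always_eventually, rule allI)
          fix n
          have "\<sigma> n \<in> M" using that by auto
          then show "norm (d (\<sigma> n) y - d l y) \<le> d (\<sigma> n) l"
            using that triangle[of "\<sigma> n" l y] triangle''[of l y "\<sigma> n"] commute[of _ "\<sigma> n"] triangle[of l "\<sigma> n" y] by (auto simp: abs_le_iff)
        qed
      qed (use that in auto)
      then show ?thesis unfolding G_def by (intro tendsto_intros)
    qed
    show "d x y \<le> (1/2)^i" if "G i x y < 1" for i x y
      using that by (auto simp: G_def field_simps power_divide)
    show "summable \<delta>" unfolding \<delta>_def by (intro summable_mult summable_geometric) auto
    show "(\<lambda>i. (1/2)^i :: real) \<longlonglongrightarrow> 0" by (rule LIMSEQ_power_zero) auto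
  qed (use complete bdd lsc y0 e in \<open>auto simp: G_def \<delta>_def\<close>)
  show ?thesis
  proof
    show "y \<in> M" "f y \<le> f y0" by fact+
    fix z assume z: "z \<in> M"
    have summ: "summable (\<lambda>i. \<delta> i * G i x (Y i))" for x
    proof (rule summable_comparison_test')
      show "summable \<delta>" unfolding \<delta>_def by (intro summable_mult summable_geometric) auto
      show "norm (\<delta> n * G n x (Y n)) \<le> \<delta> n" for n using e by (auto simp: G_def \<delta>_def mult_left_le)
    qed
    have "(\<Sum>i. \<delta> i * G i z (Y i)) - (\<Sum>i. \<delta> i * G i y (Y i)) = (\<Sum>i. \<delta> i * G i z (Y i) - \<delta> i * G i y (Y i))"
      by (rule suminf_diff[OF summ summ])
    also have "\<dots> \<le> (\<Sum>i. e/2 * (1/2)^i * d z y)"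
    proof (rule suminf_le)
      show "\<delta> n * G n z (Y n) - \<delta> n * G n y (Y n) \<le> e/2 * (1/2)^n * d z y" for n
      proof -
        have "d z (Y n) \<le> d z y + d y (Y n)" using triangle[of z y "Y n"] z Y by auto
        then have "2^n * d z (Y n) \<le> 2^n * d z y + 2^n * d y (Y n)"
          by (metis distrib_left mult_left_mono zero_le_numeral zero_le_power)
        moreover have "0 \<le> 2^n * d z y" by simp
        ultimately have "G n z (Y n) - G n y (Y n) \<le> 2^n * d z y"
          unfolding G_def by linarith
        then have "\<delta> n * (G n z (Y n) - G n y (Y n)) \<le> \<delta> n * (2^n * d z y)"
          using e by (intro mult_left_mono) (auto simp: \<delta>_def)
        also have "\<dots> = e/2 * (1/2)^n * d z y"
        proof -
          have "(4::real)^n = 2^n * 2^n" by (simp flip: power_mult_distrib)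
          then show ?thesis by (simp add: \<delta>_def power_divide)
        qed
        finally show ?thesis by (simp add: right_diff_distrib)
      qed
      show "summable (\<lambda>i. \<delta> i * G i z (Y i) - \<delta> i * G i y (Y i))" by (intro summable_diff summ)
      show "summable (\<lambda>i. e/2 * (1/2)^i * d z y)" using sum2 by (intro summable_mult2) (rule sums_summable)
    qed
    also have "\<dots> = e * d z y" using sums_mult2[OF sum2, of "d z y"] by (simp add: sums_iff)
    finally show "f y \<le> f z + e * d z y" using min[OF z] by simp
  qed
qed

section \<open>C1 functions and bump functions on Banach spaces\<close>

lemma C1_onE:
  assumes "C1_on S f"
  obtains f' where "\<And>x. x \<in> S \<Longrightarrow> (f has_derivative blinfun_apply (f' x)) (at x)" "continuous_on S f'"
  using assms by (auto simp: C1_on_def)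

lemma C1_on_frechet:
  assumes "C1_on S f" "x \<in> S"
  shows "(f has_derivative frechet_derivative f (at x)) (at x)"
  using assms frechet_derivative_works unfolding C1_on_def differentiable_def by blast

lemma C1_on_const: "C1_on S (\<lambda>x. c)"
  unfolding C1_on_def by (intro exI[of _ "\<lambda>x. 0"]) (auto simp: zero_blinfun.rep_eq)

lemma C1_on_cong:
  assumes "open S" "\<And>x. x \<in> S \<Longrightarrow> f x = g x" "C1_on S f"
  shows "C1_on S g"
  using assms unfolding C1_on_def by (meson has_derivative_transform_within_open)

lemma C1_on_compose:
  assumes "C1_on S f" "C1_on T g" "f ` S \<subseteq> T"
  shows "C1_on S (g \<circ> f)"
proof -
  obtain f' where f': "\<And>x. x \<in> S \<Longrightarrow> (f has_derivative blinfun_apply (f' x)) (at x)" "continuous_on S f'"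
    using assms(1) by (rule C1_onE) blast
  obtain g' where g': "\<And>x. x \<in> T \<Longrightarrow> (g has_derivative blinfun_apply (g' x)) (at x)" "continuous_on T g'"
    using assms(2) by (rule C1_onE) blast
  have f_cont: "continuous_on S f"
    using f'(1) by (meson continuous_at_imp_continuous_on has_derivative_continuous)
  show ?thesis
    unfolding C1_on_def
  proof (intro exI conjI ballI)
    show "(g \<circ> f has_derivative blinfun_apply (g' (f x) o\<^sub>L f' x)) (at x)" if "x \<in> S" for x
    proof -
      have "f x \<in> T" using that assms by auto
      then have "(g \<circ> f has_derivative blinfun_apply (g' (f x)) \<circ> blinfun_apply (f' x)) (at x)"
        using f'(1)[OF that] g'(1) by (intro diff_chain_at)
      then show ?thesis by (simp add: comp_def blinfun_compose.rep_eq)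
    qed
    show "continuous_on S (\<lambda>x. g' (f x) o\<^sub>L f' x)"
      using assms(3) by (intro continuous_intros f'(2) continuous_on_compose2[OF g'(2) f_cont])
  qed
qed

text \<open>Each piece brings its own derivative as a witness. A single \<open>f'\<close> is chosen
  pointwise; uniqueness of the derivative identifies it with every local witness, whence its
  continuity.\<close>

lemma C1_on_open_cover:
  assumes "\<And>x. x \<in> S \<Longrightarrow> \<exists>T. open T \<and> x \<in> T \<and> C1_on T f"
  shows "C1_on S f"
proof -
  define f' where "f' x = (SOME D. (f has_derivative blinfun_apply D) (at x))" for x
  have f': "(f has_derivative blinfun_apply (f' x)) (at x)" if "x \<in> T" "C1_on T f" for x T
    using that unfolding f'_def C1_on_def by (metis (mono_tags, lifting) someI)
  have cont: "continuous_on T f'" if T: "C1_on T f" for T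
  proof -
    obtain h where h: "\<And>x. x \<in> T \<Longrightarrow> (f has_derivative blinfun_apply (h x)) (at x)" "continuous_on T h"
      using T by (rule C1_onE) blast
    have "f' x = h x" if "x \<in> T" for x
      using has_derivative_unique[OF f'[OF that T] h(1)[OF that]] by (simp add: blinfun_apply_inject)
    then show ?thesis using h(2) by (simp cong: continuous_on_cong)
  qed
  show ?thesis
    unfolding C1_on_def
  proof (intro exI conjI ballI)
    show "(f has_derivative blinfun_apply (f' x)) (at x)" if "x \<in> S" for x
      using assms[OF that] f' by blast
    show "continuous_on S f'"
    proof (rule continuous_at_imp_continuous_on, rule ballI)
      fix x assume "x \<in> S"
      then show "isCont f' x" using assms[of x] cont continuous_on_eq_continuous_at by blast
    qed
  qed
qed

lemma C1_on_mult:
  fixes f g :: "'a::real_normed_vector \<Rightarrow> real"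
  assumes "C1_on S f" "C1_on S g"
  shows "C1_on S (\<lambda>x. f x * g x)"
proof -
  obtain f' where f': "\<And>x. x \<in> S \<Longrightarrow> (f has_derivative blinfun_apply (f' x)) (at x)" "continuous_on S f'"
    using assms(1) by (rule C1_onE) blast
  obtain g' where g': "\<And>x. x \<in> S \<Longrightarrow> (g has_derivative blinfun_apply (g' x)) (at x)" "continuous_on S g'"
    using assms(2) by (rule C1_onE) blast
  have "continuous_on S f" "continuous_on S g"
    using f'(1) g'(1) by (meson continuous_at_imp_continuous_on has_derivative_continuous)+
  then show ?thesis
    unfolding C1_on_def
    by (intro exI[of _ "\<lambda>x. f x *\<^sub>R g' x + g x *\<^sub>R f' x"] conjI ballI continuous_intros f' g')
       (auto intro!: derivative_eq_intros f' g' simp: blinfun.add_left blinfun.scaleR_left)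
qed

text \<open>A local minimum yields only a one-sided growth bound, so the derivative is estimated
  through difference quotients along a ray, from the right; these see only the positive homogeneity
  of N.\<close>

lemma has_derivative_le:
  fixes g :: "'a::real_normed_vector \<Rightarrow> real"
  assumes g: "(g has_derivative D) (at x)"
    and le: "\<forall>\<^sub>F y in nhds x. g y - g x \<le> K * N (y - x)"
    and N: "\<And>t v. t > 0 \<Longrightarrow> N (t *\<^sub>R v) = t * N v"
  shows "D v \<le> K * N v"
proof (rule tendsto_upperbound)
  have "(g has_derivative D) (at (x + 0 *\<^sub>R v))" using g by simp
  then have "((\<lambda>t. g (x + t *\<^sub>R v)) has_derivative (\<lambda>t. D (t *\<^sub>R v))) (at 0)"
    by (rule has_derivative_compose[rotated]) (auto intro!: derivative_eq_intros)
  moreover have "D (t *\<^sub>R v) = D v * t" for t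
    using has_derivative_bounded_linear[OF g] by (simp add: linear_simps)
  ultimately have "((\<lambda>t. g (x + t *\<^sub>R v)) has_field_derivative D v) (at 0)"
    by (simp add: has_field_derivative_def)
  then have "((\<lambda>h. (g (x + h *\<^sub>R v) - g x) / h) \<longlongrightarrow> D v) (at 0)"
    by (simp add: DERIV_def)
  then show "((\<lambda>h. (g (x + h *\<^sub>R v) - g x) / h) \<longlongrightarrow> D v) (at_right 0)"
    by (simp add: filterlim_at_split)
  have "((\<lambda>h. x + h *\<^sub>R v) \<longlongrightarrow> x + 0 *\<^sub>R v) (at_right 0)" by (intro tendsto_intros)
  then have "((\<lambda>h. x + h *\<^sub>R v) \<longlongrightarrow> x) (at_right 0)" by simp
  then have "\<forall>\<^sub>F h in at_right 0. g (x + h *\<^sub>R v) - g x \<le> K * N (x + h *\<^sub>R v - x)"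
    using le unfolding filterlim_iff by blast
  then show "\<forall>\<^sub>F h in at_right 0. (g (x + h *\<^sub>R v) - g x) / h \<le> K * N v"
    using eventually_at_right_less[of 0]
    by eventually_elim (simp add: N divide_simps mult.commute mult.left_commute)
qed simp

lemma has_derivative_abs_le:
  fixes g :: "'a::real_normed_vector \<Rightarrow> real"
  assumes g: "(g has_derivative D) (at x)"
    and le: "\<forall>\<^sub>F y in nhds x. g y - g x \<le> K * N (y - x)"
    and N: "\<And>t v. N (t *\<^sub>R v) = \<bar>t\<bar> * N v"
  shows "\<bar>D v\<bar> \<le> K * N v"
proof -
  have "D v \<le> K * N v" "D (- v) \<le> K * N (- v)"
    using N by (intro has_derivative_le[OF g le]; simp)+
  moreover have "N (- v) = N v" using N[of "-1" v] by simp
  moreover have "D (- v) = - D v"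
    using has_derivative_bounded_linear[OF g] by (simp add: linear_simps)
  ultimately show ?thesis by (simp add: abs_le_iff)
qed

text \<open>A smooth replacement for the truncated norm. The value 1 off the unit ball turns
  \<open>\<beta> (s *\<^sub>R x) < 1\<close> into a bound 1/s on the norm of x; the flat part of
  radius \<open>r0\<close> makes 1 - \<beta> a cutoff function; the bounded derivative makes series
  of rescaled copies converge.\<close>

locale C1_gauge =
  fixes \<beta> :: "'x::banach \<Rightarrow> real" and \<beta>' :: "'x \<Rightarrow> 'x \<Rightarrow>\<^sub>L real" and C r0 :: real
  assumes deriv: "\<And>x. (\<beta> has_derivative blinfun_apply (\<beta>' x)) (at x)"
    and cont_deriv: "continuous_on UNIV \<beta>'"
    and deriv_bound: "\<And>x. norm (\<beta>' x) \<le> C"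
    and nonneg: "\<And>x. 0 \<le> \<beta> x" and le_1: "\<And>x. \<beta> x \<le> 1"
    and eq_1: "\<And>x. norm x \<ge> 1 \<Longrightarrow> \<beta> x = 1"
    and r0: "r0 > 0" and eq_0: "\<And>x. norm x < r0 \<Longrightarrow> \<beta> x = 0"

text \<open>Squaring removes the kink of the positive part: at 0 the difference quotient is at most
  the absolute value of h.\<close>

lemma has_derivative_max_0_power2:
  "((\<lambda>t::real. (max 0 t)\<^sup>2) has_derivative (\<lambda>h. 2 * max 0 t * h)) (at t)"
proof -
  consider "t > 0" | "t < 0" | "t = 0" by linarith
  then show ?thesis
  proof cases
    case 1
    have "((\<lambda>t::real. t\<^sup>2) has_derivative (\<lambda>h. 2 * max 0 t * h)) (at t)"
      using 1 by (auto intro!: derivative_eq_intros)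
    then show ?thesis
      by (rule has_derivative_transform_within_open[of _ _ _ _ "{0<..}"]) (use 1 in auto)
  next
    case 2
    have "((\<lambda>t::real. 0) has_derivative (\<lambda>h. 2 * max 0 t * h)) (at t)"
      using 2 by (auto intro!: derivative_eq_intros)
    then show ?thesis
      by (rule has_derivative_transform_within_open[of _ _ _ _ "{..<0}"]) (use 2 in auto)
  next
    case 3
    have "((\<lambda>h::real. (max 0 h)\<^sup>2 / h) \<longlongrightarrow> 0) (at 0)"
    proof (rule Lim_null_comparison)
      show "\<forall>\<^sub>F h in at 0. norm ((max 0 h)\<^sup>2 / h) \<le> \<bar>h::real\<bar>"
        by (intro always_eventually) (auto simp: max_def power2_eq_square)
      show "((\<lambda>h::real. \<bar>h\<bar>) \<longlongrightarrow> 0) (at 0)" by (intro tendsto_eq_intros) auto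
    qed
    then have "((\<lambda>t::real. (max 0 t)\<^sup>2) has_field_derivative 0) (at 0)"
      by (simp add: DERIV_def)
    then show ?thesis using 3 by (simp add: has_field_derivative_def lambda_zero)
  qed
qed

lemma C1_gauge_exists:
  fixes b :: "'x::banach \<Rightarrow> real"
  assumes "C1_Lipschitz_bump b"
  shows "\<exists>(\<beta>::'x \<Rightarrow> real) \<beta>' C r0. C1_gauge \<beta> \<beta>' C r0"
proof -
  obtain L where L: "lipschitz_on L UNIV b" and bdd: "bounded (closure {x. b x \<noteq> 0})"
    and ne: "closure {x. b x \<noteq> 0} \<noteq> {}" and C1: "C1_on UNIV b"
    using assms by (auto simp: C1_Lipschitz_bump_def)
  obtain p where p: "b p \<noteq> 0" using ne by fastforce
  obtain b' where b': "\<And>x. (b has_derivative blinfun_apply (b' x)) (at x)" "continuous_on UNIV b'"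
    using C1 by (rule C1_onE) auto
  have L0: "L \<ge> 0" using L by (rule lipschitz_on_nonneg)
  have nb': "norm (b' x) \<le> L" for x
  proof (rule norm_blinfun_bound[OF L0])
    fix v
    have "\<forall>\<^sub>F y in nhds x. b y - b x \<le> L * norm (y - x)"
      using lipschitz_onD[OF L] by (intro always_eventually) (auto simp: dist_norm abs_le_iff)
    then show "norm (b' x v) \<le> L * norm v"
      using has_derivative_abs_le[OF b'(1)] by fastforce
  qed
  obtain R0 where R0: "\<And>x. b x \<noteq> 0 \<Longrightarrow> norm x \<le> R0"
    using bdd closure_subset[of "{x. b x \<noteq> 0}"] unfolding bounded_iff by blast
  \<comment> \<open>For x of norm at least 1 the vector \<open>p + R *\<^sub>R x\<close> has norm at
    least R - norm p, which exceeds R0, so b vanishes there.\<close>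
  define R where "R = R0 + norm p + 1"
  have "norm p \<le> R0" using R0[OF p] .
  then have R: "R > 0" using norm_ge_zero[of p] unfolding R_def by linarith
  \<comment> \<open>Dividing by \<open>b p\<close> and squaring gives a nonnegative function; the
    factor 2 makes its value at 0 equal to 2, so that it exceeds 1 on a whole ball, where the
    positive part of 1 - b1 is 0.\<close>
  define b1 where "b1 x = 2 * (b (p + R *\<^sub>R x) / b p)\<^sup>2" for x
  define b1' where "b1' x = (4 * R * b (p + R *\<^sub>R x) / (b p)\<^sup>2) *\<^sub>R b' (p + R *\<^sub>R x)" for x
  have b_der: "((\<lambda>x. b (p + R *\<^sub>R x)) has_derivative (\<lambda>h. b' (p + R *\<^sub>R x) (R *\<^sub>R h))) (at x)" for x
    by (rule has_derivative_compose[OF _ b'(1)]) (auto intro!: derivative_eq_intros)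
  have b1_der: "(b1 has_derivative blinfun_apply (b1' x)) (at x)" for x
    unfolding b1_def b1'_def
    by (auto intro!: derivative_eq_intros b_der simp: p blinfun.scaleR_left blinfun.scaleR_right
        divide_simps power2_eq_square)
  have b_cont: "continuous_on UNIV b"
    using b'(1) by (meson continuous_at_imp_continuous_on has_derivative_continuous)
  have b1_cont: "continuous_on UNIV b1"
    using b1_der by (meson continuous_at_imp_continuous_on has_derivative_continuous)
  define \<beta> where "\<beta> x = (max 0 (1 - b1 x))\<^sup>2" for x
  define \<beta>' where "\<beta>' x = (- 2 * max 0 (1 - b1 x)) *\<^sub>R b1' x" for x
  have b1_nonneg: "b1 x \<ge> 0" for x by (simp add: b1_def)
  obtain r0 where r0: "r0 > 0" "\<And>x. norm x < r0 \<Longrightarrow> b1 x > 1"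
  proof -
    have "open {x. b1 x > 1}" using b1_cont by (intro open_Collect_less) auto
    moreover have "0 \<in> {x. b1 x > 1}" using p by (simp add: b1_def)
    ultimately obtain r where "r > 0" "ball 0 r \<subseteq> {x. b1 x > 1}" by (meson openE)
    then show ?thesis using that[of r] by (auto simp: subset_iff)
  qed
  have "C1_gauge \<beta> \<beta>' (8 * R * L / \<bar>b p\<bar>) r0"
  proof
    show "(\<beta> has_derivative blinfun_apply (\<beta>' x)) (at x)" for x
    proof -
      have "((\<lambda>x. 1 - b1 x) has_derivative (\<lambda>h. - b1' x h)) (at x)"
        by (auto intro!: derivative_eq_intros b1_der)
      from has_derivative_compose[OF this has_derivative_max_0_power2] show ?thesis
        by (simp add: \<beta>_def[abs_def] \<beta>'_def scaleR_blinfun.rep_eq uminus_blinfun.rep_eq)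
    qed
    have "continuous_on UNIV b1'"
      unfolding b1'_def using p
      by (intro continuous_intros continuous_on_compose2[OF b_cont] continuous_on_compose2[OF b'(2)]) auto
    then show "continuous_on UNIV \<beta>'"
      unfolding \<beta>'_def by (intro continuous_intros b1_cont)
    \<comment> \<open>Where b1 is at least 1 the factor \<open>max 0 (1 - b1 x)\<close> kills the
      derivative. Elsewhere \<open>b (p + R *\<^sub>R x)\<close> is at most \<open>b p\<close> in
      absolute value, and the bound L on the derivative of b is enough.\<close>
    show "norm (\<beta>' x) \<le> 8 * R * L / \<bar>b p\<bar>" for x
    proof (cases "b1 x \<ge> 1")
      case True
      then show ?thesis using R L0 by (simp add: \<beta>'_def max_def)
    next
      case False
      let ?q = "\<bar>b (p + R *\<^sub>R x)\<bar> / \<bar>b p\<bar>"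
      have "(b (p + R *\<^sub>R x) / b p)\<^sup>2 \<le> 1" using False by (simp add: b1_def)
      then have q: "?q \<le> 1" by (simp add: abs_square_le_1)
      have "norm (\<beta>' x) = (2 * max 0 (1 - b1 x)) * ((4 * R / \<bar>b p\<bar>) * ?q * norm (b' (p + R *\<^sub>R x)))"
        using R by (simp add: \<beta>'_def b1'_def abs_mult power2_eq_square)
      also have "\<dots> \<le> (2 * 1) * ((4 * R / \<bar>b p\<bar>) * 1 * L)"
        using q nb' b1_nonneg[of x] R L0 False by (intro mult_mono) auto
      finally show ?thesis by simp
    qed
    show "0 \<le> \<beta> x" for x by (simp add: \<beta>_def)
    show "\<beta> x \<le> 1" for x using b1_nonneg[of x] by (simp add: \<beta>_def abs_square_le_1)
    show "\<beta> x = 1" if "norm x \<ge> 1" for x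
    proof -
      have "b (p + R *\<^sub>R x) = 0"
      proof (rule ccontr)
        assume "b (p + R *\<^sub>R x) \<noteq> 0"
        then have "norm (p + R *\<^sub>R x) \<le> R0" by (rule R0)
        moreover have "norm (R *\<^sub>R x) \<le> norm (p + R *\<^sub>R x) + norm p"
          using norm_triangle_ineq4[of "p + R *\<^sub>R x" p] by simp
        moreover have "norm (R *\<^sub>R x) \<ge> R" using that R by simp
        ultimately show False by (simp add: R_def)
      qed
      then show ?thesis by (simp add: \<beta>_def b1_def)
    qed
    show "r0 > 0" by fact
    show "\<beta> x = 0" if "norm x < r0" for x using r0(2)[OF that] by (simp add: \<beta>_def)
  qed
  then show ?thesis by blast
qed

section \<open>Rescaled copies of a gauge and series of them\<close>

context C1_gauge
begin

lemma deriv_scaled: "((\<lambda>x. \<beta> (s *\<^sub>R (x - a))) has_derivative blinfun_apply (s *\<^sub>R \<beta>' (s *\<^sub>R (x - a)))) (at x)"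
proof -
  have "((\<lambda>x. s *\<^sub>R (x - a)) has_derivative (\<lambda>h. s *\<^sub>R h)) (at x)"
    by (auto intro!: derivative_eq_intros)
  from has_derivative_compose[OF this deriv] show ?thesis
    by (simp add: scaleR_blinfun.rep_eq blinfun.scaleR_right)
qed

lemma deriv_scaled': "((\<lambda>x. \<beta> (s *\<^sub>R (a - x))) has_derivative blinfun_apply (- s *\<^sub>R \<beta>' (s *\<^sub>R (a - x)))) (at x)"
proof -
  have "((\<lambda>x. s *\<^sub>R (a - x)) has_derivative (\<lambda>h. - s *\<^sub>R h)) (at x)"
    by (auto intro!: derivative_eq_intros)
  from has_derivative_compose[OF this deriv] show ?thesis
    by (simp add: scaleR_blinfun.rep_eq uminus_blinfun.rep_eq blinfun.scaleR_right blinfun.minus_right)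
qed

lemma continuous_\<beta>: "continuous_on UNIV \<beta>"
  using deriv by (meson continuous_at_imp_continuous_on has_derivative_continuous)

lemma cont_deriv_compose: "continuous_on S f \<Longrightarrow> continuous_on S (\<lambda>x. \<beta>' (f x))"
  using continuous_on_compose2[OF cont_deriv] by blast

lemma zero [simp]: "\<beta> 0 = 0"
  using r0 eq_0 by simp

lemma norm_less: "\<beta> (s *\<^sub>R x) < 1 \<Longrightarrow> s > 0 \<Longrightarrow> norm x < 1 / s"
  using eq_1[of "s *\<^sub>R x"] by (cases "norm (s *\<^sub>R x) \<ge> 1") (auto simp: field_simps)

lemma bound_nonneg: "C \<ge> 0"
  using deriv_bound[of 0] norm_ge_zero order_trans by blast

lemma summable_series:
  assumes "\<eta> > 0"
  shows "summable (\<lambda>i. \<eta> * (1/4)^i * \<beta> (2^i *\<^sub>R (x - X i)))"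
proof (rule summable_comparison_test')
  show "summable (\<lambda>i. \<eta> * (1/4)^i)" by (intro summable_mult summable_geometric) auto
  show "norm (\<eta> * (1/4)^i * \<beta> (2^i *\<^sub>R (x - X i))) \<le> \<eta> * (1/4)^i" for i
    using assms nonneg le_1 by (auto simp: abs_mult mult_left_le)
qed

text \<open>Scaling the argument by 2^i against a weight 4^-i bounds the i-th derivative by \<eta> C
  2^-i. The derivatives therefore converge uniformly, and the total 2 \<eta> C can be made small
  through \<eta>.\<close>

lemma series_C1:
  assumes \<eta>: "\<eta> > 0"
  obtains Q' where "continuous_on UNIV Q'"
    "\<And>x. ((\<lambda>x. \<Sum>i. \<eta> * (1/4)^i * \<beta> (2^i *\<^sub>R (x - X i))) has_derivative blinfun_apply (Q' x)) (at x)"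
    "\<And>x. norm (Q' x) \<le> 2 * \<eta> * C"
proof
  define f where "f i x = \<eta> * (1/4)^i * \<beta> (2^i *\<^sub>R (x - X i))" for i x
  define f' where "f' i x = (\<eta> * (1/4)^i) *\<^sub>R 2^i *\<^sub>R \<beta>' (2^i *\<^sub>R (x - X i))" for i x
  define Q' where "Q' x = (\<Sum>i. f' i x)" for x
  have der: "(f i has_derivative blinfun_apply (f' i x)) (at x)" for i x
    unfolding f_def f'_def using has_derivative_mult_right[OF deriv_scaled, of "\<eta> * (1/4)^i" "2^i" "X i" x]
    by (simp add: scaleR_blinfun.rep_eq mult.assoc)
  have sums: "(\<lambda>i. \<eta> * C * (1/2)^i) sums (\<eta> * C * (1 / (1 - 1/2)))"
    by (intro sums_mult geometric_sums) auto
  have bound: "norm (f' i x) \<le> \<eta> * C * (1/2)^i" for i x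
  proof -
    have "norm (f' i x) = \<eta> * ((1/4)^i * 2^i) * norm (\<beta>' (2^i *\<^sub>R (x - X i)))"
      using \<eta> by (simp add: f'_def)
    also have "\<dots> = \<eta> * (1/2)^i * norm (\<beta>' (2^i *\<^sub>R (x - X i)))"
      by (simp flip: power_mult_distrib)
    also have "\<dots> \<le> \<eta> * (1/2)^i * C" using deriv_bound \<eta> by (intro mult_left_mono) auto
    finally show ?thesis by (simp add: mult_ac)
  qed
  have unif: "uniform_limit UNIV (\<lambda>n x. \<Sum>i<n. f' i x) Q' sequentially"
    unfolding Q'_def by (rule Weierstrass_m_test[OF bound sums_summable[OF sums]])
  have "continuous_on UNIV (\<lambda>x. f' i x)" for i
    unfolding f'_def by (intro continuous_intros cont_deriv_compose)
  then show "continuous_on UNIV Q'"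
    by (intro uniform_limit_theorem[OF _ unif]) (auto intro!: always_eventually continuous_intros)
  have "\<exists>g. \<forall>x\<in>UNIV. (\<lambda>n. f n x) sums g x \<and> (g has_derivative blinfun_apply (Q' x)) (at x within UNIV)"
  proof (rule has_derivative_series[where x = 0 and l = "\<Sum>i. f i 0"])
    fix e :: real assume "e > 0"
    then have "\<forall>\<^sub>F n in sequentially. \<forall>x\<in>UNIV. dist (\<Sum>i<n. f' i x) (Q' x) < e"
      using unif by (simp add: uniform_limit_iff)
    then show "\<forall>\<^sub>F n in sequentially. \<forall>x\<in>UNIV. \<forall>h. norm ((\<Sum>i<n. f' i x h) - Q' x h) \<le> e * norm h"
    proof eventually_elim
      case (elim n)
      show ?case
      proof (intro ballI allI)
        fix x h
        have "norm ((\<Sum>i<n. f' i x h) - Q' x h) = norm (((\<Sum>i<n. f' i x) - Q' x) h)"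
          by (simp add: blinfun.diff_left blinfun.sum_left)
        also have "\<dots> \<le> norm ((\<Sum>i<n. f' i x) - Q' x) * norm h" by (rule norm_blinfun)
        also have "\<dots> \<le> e * norm h" using elim by (intro mult_right_mono) (auto simp: dist_norm less_imp_le)
        finally show "norm ((\<Sum>i<n. f' i x h) - Q' x h) \<le> e * norm h" .
      qed
    qed
  next
    show "(\<lambda>i. f i 0) sums (\<Sum>i. f i 0)"
      unfolding f_def by (rule summable_sums[OF summable_series[OF \<eta>]])
  qed (use der in auto)
  then obtain g where g: "\<And>x. (\<lambda>n. f n x) sums g x" "\<And>x. (g has_derivative blinfun_apply (Q' x)) (at x)"
    by auto
  have "g = (\<lambda>x. \<Sum>i. f i x)" using g(1) by (auto simp: sums_iff)
  then show "((\<lambda>x. \<Sum>i. \<eta> * (1/4)^i * \<beta> (2^i *\<^sub>R (x - X i))) has_derivative blinfun_apply (Q' x)) (at x)" for x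
    using g(2) by (simp add: f_def)
  show "norm (Q' x) \<le> 2 * \<eta> * C" for x
  proof -
    have "norm (Q' x) \<le> (\<Sum>i. \<eta> * C * (1/2)^i)"
      unfolding Q'_def by (rule norm_suminf_le[OF bound sums_summable[OF sums]])
    then show ?thesis using sums by (simp add: sums_iff)
  qed
qed

end

section \<open>A fuzzy sum rule\<close>

text \<open>Links completeness as a type class with the carrier-based metric spaces in which the
  minimisation principle is stated.\<close>

lemma mcomplete_closed:
  fixes S :: "'a::complete_space set"
  assumes "closed S"
  shows "Metric_space.mcomplete S dist"
proof -
  interpret S: Metric_space S dist by (rule Met_TC.subspace) auto
  show ?thesis
    unfolding S.mcomplete_def
  proof (intro allI impI)
    fix \<sigma> assume \<sigma>: "S.MCauchy \<sigma>"
    then have "Cauchy \<sigma>" "range \<sigma> \<subseteq> S" by (auto simp: S.MCauchy_def Cauchy_def)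
    then obtain l where l: "\<sigma> \<longlonglongrightarrow> l" using Cauchy_convergent_iff convergent_def by blast
    moreover have "l \<in> S" using assms l \<open>range \<sigma> \<subseteq> S\<close> closed_sequentially by blast
    ultimately show "\<exists>x. limitin S.mtopology \<sigma> x sequentially"
      using \<open>range \<sigma> \<subseteq> S\<close> by (intro exI[of _ l]) (auto simp: S.limitin_metric_dist_null tendsto_dist_iff[symmetric] intro!: always_eventually)
  qed
qed

lemma is_normD:
  assumes "is_norm N"
  shows "0 \<le> N v" "N 0 = 0" "N (a *\<^sub>R v) = \<bar>a\<bar> * N v" "N (v + w) \<le> N v + N w" "N (- v) = N v"
    "N (v - w) \<le> N v + N w" "N (v - w) = N (w - v)"
proof -
  have scale: "N (a *\<^sub>R v) = \<bar>a\<bar> * N v" for a v using assms by (simp add: is_norm_def)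
  have add: "N (v + w) \<le> N v + N w" for v w using assms by (simp add: is_norm_def)
  have minus: "N (- v) = N v" for v using scale[of "-1" v] by simp
  show "0 \<le> N v" "N 0 = 0" using assms by (simp_all add: is_norm_def)
  show "N (a *\<^sub>R v) = \<bar>a\<bar> * N v" "N (v + w) \<le> N v + N w" "N (- v) = N v" by (fact scale add minus)+
  show "N (v - w) \<le> N v + N w" using add[of v "- w"] minus[of w] by simp
  show "N (v - w) = N (w - v)" using minus[of "v - w"] by simp
qed

lemma is_norm_triangle: "is_norm N \<Longrightarrow> N (x - z) \<le> N (x - y) + N (y - z)"
  using is_normD(4)[of N "x - y" "y - z"] by simp

lemma is_norm_continuous:
  fixes N :: "'x::real_normed_vector \<Rightarrow> real"
  assumes N: "is_norm N" and le: "\<And>v. N v \<le> M * norm v"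
  shows "continuous_on UNIV N"
proof (rule continuous_onI)
  fix x :: 'x and e :: real assume "e > 0"
  have M: "M * norm v \<le> (\<bar>M\<bar> + 1) * norm v" for v :: 'x by (intro mult_right_mono) auto
  have "dist (N y) (N x) \<le> e" if "dist y x < e / (\<bar>M\<bar> + 1)" for y
  proof -
    have "\<bar>N y - N x\<bar> \<le> N (y - x)"
      using is_normD(4)[OF N, of "y - x" x] is_normD(4)[OF N, of "x - y" y] is_normD(7)[OF N, of x y] by simp
    also have "\<dots> \<le> (\<bar>M\<bar> + 1) * norm (y - x)" using le M order_trans by blast
    also have "\<dots> \<le> e" using that by (simp add: dist_norm field_simps)
    finally show ?thesis by (simp add: dist_real_def)
  qed
  then show "\<exists>d>0. \<forall>x'\<in>UNIV. dist x' x < d \<longrightarrow> dist (N x') (N x) \<le> e"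
    using \<open>e > 0\<close> by (intro exI[of _ "e / (\<bar>M\<bar> + 1)"]) auto
qed

text \<open>A perturbed minimum over triples (x, y, z) is a minimum in each variable separately. In
  x and y everything except f1 and f2 is smooth and serves as test function. The penalty on x - y
  contributes opposite derivatives to p1 and p2 and cancels. The penalty on x - z is estimated from
  the side of z, where it is balanced by the norm term and a small series alone.\<close>

lemma (in C1_gauge) fuzzy_sum_rule:
  fixes f1 f2 N :: "'x \<Rightarrow> real"
  assumes N: "is_norm N" "equivalent_to_norm N"
    and r: "r > 0" and \<tau>: "\<tau> > 0" and e: "e > 0" and L: "L \<ge> 0"
    and bdd: "\<And>x. x \<in> cball a r \<Longrightarrow> m \<le> f1 x" "\<And>x. x \<in> cball a r \<Longrightarrow> m \<le> f2 x"
    and lip: "\<And>x y. x \<in> cball a r \<Longrightarrow> y \<in> cball a r \<Longrightarrow> \<bar>f1 x - f1 y\<bar> \<le> L * N (x - y)"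
    and lsc: "\<And>\<sigma> l c. \<lbrakk>range \<sigma> \<subseteq> cball a r; \<sigma> \<longlonglongrightarrow> l; \<And>n::nat. f2 (\<sigma> n) \<le> c\<rbrakk> \<Longrightarrow> f2 l \<le> c"
    and min: "\<And>x. x \<in> cball a r \<Longrightarrow> f1 a + f2 a \<le> f1 x + f2 x + e * N (x - a)"
  obtains x y g1 g2 p1 p2 where "x \<in> ball a \<tau>" "y \<in> ball a \<tau>" "C1_on UNIV g1" "C1_on UNIV g2"
    "(g1 has_derivative blinfun_apply p1) (at x)" "(g2 has_derivative blinfun_apply p2) (at y)"
    "\<forall>\<^sub>F z in nhds x. f1 x - g1 x \<le> f1 z - g1 z" "\<forall>\<^sub>F z in nhds y. f2 y - g2 y \<le> f2 z - g2 z"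
    "\<And>v. \<bar>p1 v + p2 v\<bar> \<le> 3 * e * N v" "\<And>v. \<bar>p1 v\<bar> \<le> L * N v" "f1 x + f2 y \<le> f1 a + f2 a"
proof -
  obtain k M where k: "k > 0" and M: "M > 0" and kN: "\<And>v. k * norm v \<le> N v" and NM: "\<And>v. N v \<le> M * norm v"
    using N(2) by (auto simp: equivalent_to_norm_def)
  note N_nonneg = is_normD(1)[OF N(1)]
  have N_cont: "continuous_on UNIV N" by (rule is_norm_continuous[OF N(1) NM])
  define W where "W = cball a r"
  define S where "S = W \<times> W \<times> W"
  have aW: "a \<in> W" using r by (simp add: W_def)
  define F0 where "F0 = f1 a + f2 a"
  \<comment> \<open>F0 is the value of the penalised functional at (a, a, a), and 2 m bounds f1 + f2
    from below. A penalty coefficient larger than F0 - 2 m forces \<beta> < 1 at the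
    minimiser.\<close>
  define K where "K = F0 - 2 * m + 1"
  have K: "K > 0" using bdd[of a] r by (simp add: K_def F0_def)
  \<comment> \<open>The penalties will give norms below 1/s for x - y and x - z. The first summand,
    c - 2, is such that y - a has norm at most (c - 2)/s; the extra 2/s covers x and z, and the
    total c/s is half of \<open>min \<tau> r\<close>.\<close>
  define c where "c = (L + 4 * e) * M / (e * k) + 2"
  define s where "s = 2 * c / min \<tau> r"
  have c: "c \<ge> 1" using L e M k by (simp add: c_def)
  have s: "s > 0" using c \<tau> r by (simp add: s_def)
  \<comment> \<open>C may be 0, so C + 1 serves as divisor. The 6 in \<eta> lets each of the three
    series contribute at most \<open>e * N v / 3\<close> to a derivative.\<close>
  define C1 where "C1 = C + 1"
  have C1: "C1 > 0" "C \<le> C1" using bound_nonneg by (simp_all add: C1_def)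
  define \<eta> where "\<eta> = e * k / (6 * C1)"
  have \<eta>: "\<eta> > 0" using e k C1 by (simp add: \<eta>_def)
  \<comment> \<open>The norm term has weight 2 e, twice that of the hypothesis \<open>min\<close>;
    the surplus is what confines y to a neighbourhood of a.\<close>
  define \<Psi> where "\<Psi> w = f1 (fst w) + f2 (fst (snd w)) + 2 * e * N (snd (snd w) - a)
      + K * \<beta> (s *\<^sub>R (fst w - fst (snd w))) + K * \<beta> (s *\<^sub>R (fst w - snd (snd w)))" for w
  \<comment> \<open>A sum of nonnegative terms below 1 has every term below 1, so a small gauge
    means closeness in all three components.\<close>
  define G where "G i w w' = \<beta> (2^i *\<^sub>R (fst w - fst w')) + \<beta> (2^i *\<^sub>R (fst (snd w) - fst (snd w')))
      + \<beta> (2^i *\<^sub>R (snd (snd w) - snd (snd w')))" for i :: nat and w w' :: "'x \<times> 'x \<times> 'x"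
  define \<delta> where "\<delta> i = \<eta> * (1/4)^i" for i :: nat
  interpret S: Metric_space S dist by (rule Met_TC.subspace) auto
  have \<beta>_cont: "continuous_on T (\<lambda>x. \<beta> (f x))" if "continuous_on T f" for T and f :: "'x \<times> 'x \<times> 'x \<Rightarrow> 'x"
    using continuous_on_compose2[OF continuous_\<beta> that] by blast
  have closedW: "closed W" by (simp add: W_def)
  have dist_le: "dist (x, y, z) (x', y', z') \<le> norm (x - x') + norm (y - y') + norm (z - z')" for x y z x' y' z' :: 'x
    unfolding dist_prod_def dist_norm using sqrt_sum_squares_le_sum_abs[of "norm (x - x')" "sqrt ((norm (y - y'))\<^sup>2 + (norm (z - z'))\<^sup>2)"]
      sqrt_sum_squares_le_sum_abs[of "norm (y - y')" "norm (z - z')"] by simp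
  obtain w Y where w: "w \<in> S" "range Y \<subseteq> S" "\<Psi> w \<le> \<Psi> (a, a, a)"
    and w_min: "\<And>w'. w' \<in> S \<Longrightarrow> \<Psi> w + (\<Sum>i. \<delta> i * G i w (Y i)) \<le> \<Psi> w' + (\<Sum>i. \<delta> i * G i w' (Y i))"
  proof (rule S.perturbed_minimum[of "2 * m" \<Psi> G 3 "\<lambda>i. 3 * (1/2)^i" \<delta> "(a, a, a)"])
    show S.mcomplete
      unfolding S_def by (intro mcomplete_closed closed_Times closedW)
    show "(a, a, a) \<in> S" using aW by (simp add: S_def)
    show "2 * m \<le> \<Psi> w" if "w \<in> S" for w
    proof -
      obtain x y z where w: "w = (x, y, z)" by (cases w) auto
      then have "m \<le> f1 x" "m \<le> f2 y" using bdd that by (auto simp: S_def W_def)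
      moreover have "0 \<le> 2 * e * N (z - a)" using N_nonneg e by simp
      moreover have "0 \<le> K * \<beta> v" for v using nonneg K by simp
      ultimately show ?thesis unfolding w \<Psi>_def by (simp add: add_increasing2)
    qed
    show "(\<lambda>n. G i (\<sigma> n) y) \<longlonglongrightarrow> G i l y"
      if \<sigma>: "range \<sigma> \<subseteq> S" "(\<lambda>n. dist (\<sigma> n) l) \<longlonglongrightarrow> 0" for i y \<sigma> l
    proof -
      have "\<sigma> \<longlonglongrightarrow> l" using \<sigma>(2) by (rule tendsto_dist_iff[THEN iffD2])
      moreover have "continuous_on UNIV (\<lambda>x. G i x y)"
        unfolding G_def
        by (intro continuous_intros \<beta>_cont)
      ultimately show ?thesis
        using continuous_on_tendsto_compose[of UNIV "\<lambda>x. G i x y" \<sigma> l sequentially] by simp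
    qed
    show "dist w w' \<le> 3 * (1/2)^i" if "G i w w' < 1" for i w w'
    proof -
      obtain x y z x' y' z' where w: "w = (x, y, z)" "w' = (x', y', z')" by (cases w, cases w') auto
      have "\<beta> (2^i *\<^sub>R (x - x')) < 1" "\<beta> (2^i *\<^sub>R (y - y')) < 1" "\<beta> (2^i *\<^sub>R (z - z')) < 1"
        using that nonneg[of "2^i *\<^sub>R (x - x')"] nonneg[of "2^i *\<^sub>R (y - y')"] nonneg[of "2^i *\<^sub>R (z - z')"]
        unfolding w G_def by auto
      from this[THEN norm_less] show ?thesis
        using dist_le[of x y z x' y' z'] unfolding w by (simp add: power_divide)
    qed
    show "0 \<le> G i w w' \<and> G i w w' \<le> 3" for i w w'
    proof -
      obtain x y z x' y' z' where w: "w = (x, y, z)" "w' = (x', y', z')" by (cases w, cases w') auto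
      show ?thesis
        using nonneg[of "2^i *\<^sub>R (x - x')"] nonneg[of "2^i *\<^sub>R (y - y')"] nonneg[of "2^i *\<^sub>R (z - z')"]
         le_1[of "2^i *\<^sub>R (x - x')"] le_1[of "2^i *\<^sub>R (y - y')"] le_1[of "2^i *\<^sub>R (z - z')"]
        unfolding w G_def by auto
    qed
    show "G i w w = 0" for i w by (simp add: G_def)
    show "(\<lambda>i. 3 * (1/2)^i :: real) \<longlonglongrightarrow> 0"
      by (intro tendsto_mult_right_zero LIMSEQ_power_zero) auto
    show "0 < \<delta> i" for i using \<eta> by (simp add: \<delta>_def)
    show "summable \<delta>" unfolding \<delta>_def by (intro summable_mult summable_geometric) auto
    \<comment> \<open>All terms other than f2 are continuous on S; semicontinuity of f2, applied to
      a tail of the sequence, passes to \<Psi>.\<close>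
    show "\<Psi> l \<le> c" if \<sigma>: "range \<sigma> \<subseteq> S" "l \<in> S" "(\<lambda>n. dist (\<sigma> n) l) \<longlonglongrightarrow> 0" and le: "\<And>n. \<Psi> (\<sigma> n) \<le> c" for \<sigma> l c
    proof -
      obtain x y z where l: "l = (x, y, z)" by (cases l) auto
      define p where "p w = f1 (fst w) + 2 * e * N (snd (snd w) - a)
          + K * \<beta> (s *\<^sub>R (fst w - fst (snd w))) + K * \<beta> (s *\<^sub>R (fst w - snd (snd w)))" for w
      have lim: "\<sigma> \<longlonglongrightarrow> l" using \<sigma>(3) by (rule tendsto_dist_iff[THEN iffD2])
      have "continuous_on W f1"
      proof (rule continuous_onI)
        fix x :: 'x and d :: real assume x: "x \<in> W" and d: "d > 0"
        have "dist (f1 x') (f1 x) \<le> d" if "x' \<in> W" "dist x' x < d / (L * M + 1)" for x'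
        proof -
          have "\<bar>f1 x' - f1 x\<bar> \<le> L * N (x' - x)" using lip x that by (simp add: W_def)
          also have "\<dots> \<le> L * (M * norm (x' - x))" using NM L by (intro mult_left_mono)
          also have "\<dots> \<le> (L * M + 1) * norm (x' - x)" by (simp add: algebra_simps)
          also have "\<dots> \<le> d"
            using that(2) L M by (simp add: dist_norm pos_less_divide_eq add_nonneg_pos mult.commute less_imp_le)
          finally show ?thesis by (simp add: dist_real_def)
        qed
        then show "\<exists>d'>0. \<forall>x'\<in>W. dist x' x < d' \<longrightarrow> dist (f1 x') (f1 x) \<le> d"
          using d L M by (intro exI[of _ "d / (L * M + 1)"]) (auto simp: add_nonneg_pos)
      qed
      then have "continuous_on S p"
        unfolding p_def
        by (intro continuous_intros \<beta>_cont continuous_on_compose2[OF N_cont, of _ "\<lambda>w. snd (snd w) - a"]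
            continuous_on_compose2[of W f1 S fst]) (auto simp: S_def)
      then have p_lim: "(\<lambda>n. p (\<sigma> n)) \<longlonglongrightarrow> p l"
        by (rule continuous_on_tendsto_compose[OF _ lim \<sigma>(2)]) (use \<sigma>(1) in \<open>auto intro!: always_eventually\<close>)
      have \<Psi>_p: "\<Psi> w = p w + f2 (fst (snd w))" for w by (simp add: \<Psi>_def p_def)
      have "f2 y \<le> c - p l + d" if "d > 0" for d
      proof -
        have "\<forall>\<^sub>F n in sequentially. p (\<sigma> n) > p l - d" using p_lim that by (intro order_tendstoD) auto
        then obtain n0 where n0: "\<And>n. n \<ge> n0 \<Longrightarrow> p (\<sigma> n) > p l - d" by (auto simp: eventually_sequentially)
        show ?thesis
        proof (rule lsc)
          show "range (\<lambda>n. fst (snd (\<sigma> (n + n0)))) \<subseteq> cball a r" using \<sigma>(1) by (simp add: S_def W_def image_subset_iff mem_Times_iff)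
          have "(\<lambda>n. fst (snd (\<sigma> (n + n0)))) \<longlonglongrightarrow> fst (snd l)"
            by (intro tendsto_intros LIMSEQ_ignore_initial_segment[OF lim])
          then show "(\<lambda>n. fst (snd (\<sigma> (n + n0)))) \<longlonglongrightarrow> y" by (simp add: l)
          show "f2 (fst (snd (\<sigma> (n + n0)))) \<le> c - p l + d" for n
            using le[of "n + n0"] n0[of "n + n0"] \<Psi>_p[of "\<sigma> (n + n0)"] by simp
        qed
      qed
      then have "f2 y \<le> c - p l" by (rule field_le_epsilon)
      then show ?thesis by (simp add: \<Psi>_p l)
    qed
  qed auto
  obtain x y z where wxyz: "w = (x, y, z)" by (cases w) auto
  have W: "x \<in> W" "y \<in> W" "z \<in> W" using w(1) by (auto simp: wxyz S_def)
  have \<Psi>_le: "f1 x + f2 y + 2 * e * N (z - a) + K * \<beta> (s *\<^sub>R (x - y)) + K * \<beta> (s *\<^sub>R (x - z)) \<le> F0"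
    using w(3) is_normD(2)[OF N(1)] by (simp add: \<Psi>_def wxyz F0_def)
  have nn: "0 \<le> 2 * e * N (z - a)" "0 \<le> K * \<beta> (s *\<^sub>R (x - y))" "0 \<le> K * \<beta> (s *\<^sub>R (x - z))"
    using nonneg K N_nonneg e by simp_all
  have m2: "2 * m \<le> f1 x + f2 y" using bdd(1)[of x] bdd(2)[of y] W by (simp add: W_def)
  have "K * \<beta> (s *\<^sub>R (x - y)) < K * 1" "K * \<beta> (s *\<^sub>R (x - z)) < K * 1"
    using \<Psi>_le nn m2 K_def by linarith+
  then have "\<beta> (s *\<^sub>R (x - y)) < 1" "\<beta> (s *\<^sub>R (x - z)) < 1"
    using K by (simp_all only: mult_less_cancel_left_pos)
  then have xy: "norm (x - y) < 1 / s" and xz: "norm (x - z) < 1 / s" using norm_less s by blast+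
  \<comment> \<open>Testing \<open>min\<close> at y and comparing with \<open>\<Psi>_le\<close>
    bounds 2 e N(z - a) by e N(y - a) + L N(x - y). Passing from z to y by the triangle inequality
    still leaves one e N(y - a) on the left, to be absorbed by N(x - y) and N(y - z), both of order
    1/s.\<close>
  have ya: "norm (y - a) \<le> (c - 2) / s"
  proof -
    have yz: "norm (y - z) \<le> 2 / s" using norm_triangle_ineq4[of "x - z" "x - y"] xy xz by simp
    have "F0 \<le> f1 y + f2 y + e * N (y - a)" using min[of y] W by (simp add: W_def F0_def)
    moreover have "f1 y - f1 x \<le> L * N (x - y)"
      using lip[of x y] W by (simp add: W_def abs_le_iff)
    moreover have "2 * e * N (y - a) \<le> 2 * e * N (y - z) + 2 * e * N (z - a)"
      using mult_left_mono[OF is_norm_triangle[OF N(1), of y a z], of "2 * e"] e by (simp add: algebra_simps)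
    ultimately have "e * N (y - a) \<le> L * N (x - y) + 2 * e * N (y - z)" using \<Psi>_le nn by linarith
    also have "\<dots> \<le> L * (M * (1 / s)) + 2 * e * (M * (2 / s))"
    proof -
      have "N (x - y) \<le> M * (1 / s)" "N (y - z) \<le> M * (2 / s)"
        using xy yz M by (auto intro!: order_trans[OF NM] mult_left_mono simp del: mult_1_right times_divide_eq_right)
      then show ?thesis using L e by (intro add_mono mult_left_mono) auto
    qed
    finally have "e * (k * norm (y - a)) \<le> L * (M * (1 / s)) + 2 * e * (M * (2 / s))"
      using mult_left_mono[OF kN[of "y - a"], of e] e by linarith
    also have "\<dots> = (L + 4 * e) * M / s" by (simp add: algebra_simps add_divide_distrib)
    finally have "norm (y - a) * (e * k) \<le> (L + 4 * e) * M / s" by (simp add: mult_ac)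
    then have "norm (y - a) \<le> (L + 4 * e) * M / s / (e * k)"
      using pos_le_divide_eq[of "e * k" "norm (y - a)" "(L + 4 * e) * M / s"] e k by simp
    then show ?thesis by (simp add: c_def mult_ac)
  qed
  have cs: "c / s < min \<tau> r" using c s \<tau> r by (simp add: s_def min_def field_simps)
  have near: "norm (v - a) < min \<tau> r" if "norm (v - y) \<le> 2 / s" for v
  proof -
    have "norm (v - a) \<le> norm (v - y) + norm (y - a)" using norm_triangle_ineq[of "v - y" "y - a"] by simp
    also have "\<dots> \<le> 2 / s + (c - 2) / s" using that ya by simp
    also have "\<dots> = c / s" by (simp add: diff_divide_distrib)
    finally show ?thesis using cs by simp
  qed
  have x_near: "norm (x - a) < min \<tau> r" and y_near: "norm (y - a) < min \<tau> r"
    using near[of x] near[of y] xy s divide_right_mono[of 1 2 s] by auto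
  have "norm (z - y) \<le> 2 / s" using norm_triangle_ineq4[of "x - y" "x - z"] xy xz by simp
  then have z_near: "norm (z - a) < min \<tau> r" by (rule near)
  \<comment> \<open>The gauge on triples is a sum over components, so the perturbation splits into
    one series per variable.\<close>
  define R1 where "R1 v = (\<Sum>i. \<eta> * (1/4)^i * \<beta> (2^i *\<^sub>R (v - fst (Y i))))" for v
  define R2 where "R2 v = (\<Sum>i. \<eta> * (1/4)^i * \<beta> (2^i *\<^sub>R (v - fst (snd (Y i)))))" for v
  define R3 where "R3 v = (\<Sum>i. \<eta> * (1/4)^i * \<beta> (2^i *\<^sub>R (v - snd (snd (Y i)))))" for v
  obtain Q1 where Q1: "continuous_on UNIV Q1" "\<And>x. (R1 has_derivative blinfun_apply (Q1 x)) (at x)"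
    "\<And>x. norm (Q1 x) \<le> 2 * \<eta> * C"
    unfolding R1_def by (rule series_C1[OF \<eta>, of "\<lambda>i. fst (Y i)"]) blast
  obtain Q2 where Q2: "continuous_on UNIV Q2" "\<And>x. (R2 has_derivative blinfun_apply (Q2 x)) (at x)"
    "\<And>x. norm (Q2 x) \<le> 2 * \<eta> * C"
    unfolding R2_def by (rule series_C1[OF \<eta>, of "\<lambda>i. fst (snd (Y i))"]) blast
  obtain Q3 where Q3: "continuous_on UNIV Q3" "\<And>x. (R3 has_derivative blinfun_apply (Q3 x)) (at x)"
    "\<And>x. norm (Q3 x) \<le> 2 * \<eta> * C"
    unfolding R3_def by (rule series_C1[OF \<eta>, of "\<lambda>i. snd (snd (Y i))"]) blast
  have R: "(\<Sum>i. \<delta> i * G i w' (Y i)) = R1 (fst w') + R2 (fst (snd w')) + R3 (snd (snd w'))" for w'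
    unfolding R1_def R2_def R3_def G_def \<delta>_def
    by (simp add: suminf_add summable_add summable_series[OF \<eta>] distrib_left)
  have w_min': "f1 x + f2 y + 2 * e * N (z - a) + K * \<beta> (s *\<^sub>R (x - y)) + K * \<beta> (s *\<^sub>R (x - z)) + (R1 x + R2 y + R3 z)
      \<le> f1 x' + f2 y' + 2 * e * N (z' - a) + K * \<beta> (s *\<^sub>R (x' - y')) + K * \<beta> (s *\<^sub>R (x' - z')) + (R1 x' + R2 y' + R3 z')"
    if "x' \<in> W" "y' \<in> W" "z' \<in> W" for x' y' z'
    using w_min[of "(x', y', z')"] that unfolding R by (simp add: S_def \<Psi>_def wxyz)
  have ev: "\<forall>\<^sub>F v' in nhds v. v' \<in> W" if "norm (v - a) < min \<tau> r" for v
    using that eventually_nhds_in_open[of "ball a r" v]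
    by (auto simp: W_def dist_norm norm_minus_commute elim: eventually_mono)
  \<comment> \<open>Up to sign, the smooth terms in one variable with the other two frozen at the
    minimiser. The norm term is kept out of \<open>g3\<close>.\<close>
  define g1 where "g1 v = - (K * \<beta> (s *\<^sub>R (v - y)) + K * \<beta> (s *\<^sub>R (v - z)) + R1 v)" for v
  define g2 where "g2 v = - (K * \<beta> (s *\<^sub>R (x - v)) + R2 v)" for v
  define g3 where "g3 v = - (K * \<beta> (s *\<^sub>R (x - v)) + R3 v)" for v
  define p1 where "p1 v = - (K *\<^sub>R s *\<^sub>R \<beta>' (s *\<^sub>R (v - y)) + K *\<^sub>R s *\<^sub>R \<beta>' (s *\<^sub>R (v - z)) + Q1 v)" for v
  define p2 where "p2 v = - (K *\<^sub>R (- s *\<^sub>R \<beta>' (s *\<^sub>R (x - v))) + Q2 v)" for v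
  define p3 where "p3 v = - (K *\<^sub>R (- s *\<^sub>R \<beta>' (s *\<^sub>R (x - v))) + Q3 v)" for v
  note rep = scaleR_blinfun.rep_eq plus_blinfun.rep_eq uminus_blinfun.rep_eq
  have dl: "((\<lambda>u. K * \<beta> (s *\<^sub>R (u - b))) has_derivative (\<lambda>h. K *\<^sub>R s *\<^sub>R \<beta>' (s *\<^sub>R (v - b)) h)) (at v)" for b v
    using has_derivative_mult_right[OF deriv_scaled[of s b v], of K] by (simp add: rep)
  have dr: "((\<lambda>u. K * \<beta> (s *\<^sub>R (b - u))) has_derivative (\<lambda>h. K *\<^sub>R (- s *\<^sub>R \<beta>' (s *\<^sub>R (b - v)) h))) (at v)" for b v
    using has_derivative_mult_right[OF deriv_scaled'[of s b v], of K] by (simp add: rep)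
  have g1: "(g1 has_derivative blinfun_apply (p1 v)) (at v)" for v
    unfolding g1_def p1_def rep by (intro has_derivative_minus has_derivative_add Q1(2) dl)
  have g2: "(g2 has_derivative blinfun_apply (p2 v)) (at v)" for v
    unfolding g2_def p2_def rep by (intro has_derivative_minus has_derivative_add Q2(2) dr)
  have g3: "(g3 has_derivative blinfun_apply (p3 v)) (at v)" for v
    unfolding g3_def p3_def rep by (intro has_derivative_minus has_derivative_add Q3(2) dr)
  have p_cont: "continuous_on UNIV p1" "continuous_on UNIV p2"
    unfolding p1_def p2_def by (intro continuous_intros cont_deriv_compose Q1 Q2)+
  have min1: "f1 x - g1 x \<le> f1 v - g1 v" if "v \<in> W" for v
    using w_min'[of v y z] that W by (simp add: g1_def)
  have min2: "f2 y - g2 y \<le> f2 v - g2 v" if "v \<in> W" for v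
    using w_min'[of x v z] that W by (simp add: g2_def)
  \<comment> \<open>Minimality in z compares increments of g3 with those of 2 e N( . - a), and the
    triangle inequality replaces the latter by 2 e N(v - z).\<close>
  have min3: "g3 v - g3 z \<le> 2 * e * N (v - z)" if "v \<in> W" for v
  proof -
    have "g3 v - g3 z \<le> 2 * e * (N (v - a) - N (z - a))"
      using w_min'[of x y v] that W by (simp add: g3_def right_diff_distrib)
    also have "\<dots> \<le> 2 * e * N (v - z)"
      using is_norm_triangle[OF N(1), of v a z] e by (intro mult_left_mono) auto
    finally show ?thesis .
  qed
  have p1_le: "\<bar>p1 x v\<bar> \<le> L * N v" for v
  proof (rule has_derivative_abs_le[OF g1 _ is_normD(3)[OF N(1)]])
    show "\<forall>\<^sub>F v in nhds x. g1 v - g1 x \<le> L * N (v - x)"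
      using ev[OF x_near]
    proof eventually_elim
      case (elim v)
      then show ?case using min1[OF elim] lip[of v x] W by (simp add: W_def abs_le_iff)
    qed
  qed
  have p3_le: "\<bar>p3 z v\<bar> \<le> 2 * e * N v" for v
    by (rule has_derivative_abs_le[OF g3 _ is_normD(3)[OF N(1)]])
       (use ev[OF z_near] min3 in \<open>auto elim: eventually_mono\<close>)
  have Q_le: "\<bar>Q v\<bar> \<le> e * N v / 3" if "norm Q \<le> 2 * \<eta> * C" for Q :: "'x \<Rightarrow>\<^sub>L real" and v
  proof -
    have "\<eta> * C \<le> \<eta> * C1" using \<eta> C1 by (intro mult_left_mono) auto
    also have "\<dots> = e * k / 6" using C1 by (simp add: \<eta>_def)
    finally have "2 * \<eta> * C \<le> e * k / 3" by simp
    then have "norm Q * norm v \<le> e * k / 3 * norm v" using that by (intro mult_right_mono) auto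
    also have "\<dots> = e * (k * norm v) / 3" by simp
    also have "\<dots> \<le> e * N v / 3" using kN[of v] e by simp
    finally show ?thesis using norm_blinfun[of Q v] by simp
  qed
  \<comment> \<open>The x - y penalty has cancelled, and the x - z penalty is rewritten as p3 z + Q3
    z. The bounds 2 e for p3 and e/3 for each of the three Q add up to 3 e.\<close>
  have sum: "p1 x v + p2 y v = - (p3 z v + Q3 z v) - Q1 x v - Q2 y v" for v
    unfolding p1_def p2_def p3_def by (simp add: rep minus_blinfun.rep_eq)
  show ?thesis
  proof (rule that[of x y g1 g2 "p1 x" "p2 y"])
    show "x \<in> ball a \<tau>" "y \<in> ball a \<tau>" using x_near y_near by (auto simp: dist_norm norm_minus_commute)
    show "C1_on UNIV g1" "C1_on UNIV g2" using g1 g2 p_cont unfolding C1_on_def by blast+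
    show "\<forall>\<^sub>F z in nhds x. f1 x - g1 x \<le> f1 z - g1 z" using ev[OF x_near] min1 by (auto elim: eventually_mono)
    show "\<forall>\<^sub>F z in nhds y. f2 y - g2 y \<le> f2 z - g2 z" using ev[OF y_near] min2 by (auto elim: eventually_mono)
    show "\<bar>p1 x v + p2 y v\<bar> \<le> 3 * e * N v" for v
      using Q_le[OF Q1(3), of x v] Q_le[OF Q2(3), of y v] Q_le[OF Q3(3), of z v] p3_le[of v] sum[of v]
      by linarith
    show "f1 x + f2 y \<le> f1 a + f2 a" using \<Psi>_le nn by (simp add: F0_def)
  qed (fact g1 g2 p1_le)+
qed

section \<open>Charts and tangent vectors\<close>

lemma paracompact_imp_regular:
  assumes "paracompact_space TYPE('m::t2_space)" and "open U" "(x::'m) \<in> U"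
  obtains V where "open V" "x \<in> V" "closure V \<subseteq> U"
proof -
  define \<U> where "\<U> = insert U {W. open W \<and> x \<notin> closure W}"
  have "\<exists>W\<in>\<U>. y \<in> W" for y
  proof (cases "y = x")
    case False
    then obtain W W' where W: "open W" "open W'" "y \<in> W" "x \<in> W'" "W \<inter> W' = {}"
      using hausdorff[OF False] by blast
    then have "x \<notin> closure W" using open_Int_closure_eq_empty[of W' W] by blast
    then show ?thesis using W unfolding \<U>_def by blast
  next
    case True
    then show ?thesis using assms(3) unfolding \<U>_def by blast
  qed
  then have "(\<forall>W\<in>\<U>. open W) \<and> \<Union>\<U> = UNIV" using assms(2) unfolding \<U>_def by blast
  from assms(1)[unfolded paracompact_space_def, rule_format, OF this]
  obtain \<V> where *: "(\<forall>V\<in>\<V>. open V) \<and> \<Union>\<V> = UNIV \<and> (\<forall>V\<in>\<V>. \<exists>U\<in>\<U>. V \<subseteq> U) \<and>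
    locally_finite_in euclidean \<V>" ..
  then have \<V>: "\<And>V. V \<in> \<V> \<Longrightarrow> open V" "\<Union>\<V> = UNIV" "\<And>V. V \<in> \<V> \<Longrightarrow> \<exists>W\<in>\<U>. V \<subseteq> W"
    and lf: "locally_finite_in euclidean \<V>"
    by blast+
  define \<F> where "\<F> = {V \<in> \<V>. \<not> V \<subseteq> U}"
  have x_notin: "x \<notin> closure V" if "V \<in> \<F>" for V
    using \<V>(3)[of V] that closure_mono unfolding \<F>_def \<U>_def by blast
  obtain O1 where O1: "open O1" "x \<in> O1" "finite {V \<in> \<V>. V \<inter> O1 \<noteq> {}}"
    using lf unfolding locally_finite_in_def by (auto simp: Int_def)
  define V where "V = O1 - (\<Union>V\<in>{V\<in>\<F>. V \<inter> O1 \<noteq> {}}. closure V)"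
  have "finite {V\<in>\<F>. V \<inter> O1 \<noteq> {}}" by (rule finite_subset[OF _ O1(3)]) (auto simp: \<F>_def)
  then have "open V" unfolding V_def by (intro open_Diff O1 closed_UN) auto
  moreover have "x \<in> V" using O1 x_notin by (auto simp: V_def)
  moreover have "closure V \<subseteq> U"
  proof
    fix y assume y: "y \<in> closure V"
    have "y \<in> \<Union>\<V>" using \<V>(2) by simp
    then obtain V' where V': "V' \<in> \<V>" "y \<in> V'" by (rule UnionE)
    have "V' \<inter> V \<noteq> {}" using y V'(2) open_Int_closure_eq_empty[OF \<V>(1)[OF V'(1)], of V] by blast
    moreover have "V' \<inter> V = {}" if "V' \<in> \<F>"
      using that closure_subset[of V'] unfolding V_def by blast
    ultimately show "y \<in> U" using V' by (auto simp: \<F>_def)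
  qed
  ultimately show ?thesis using that by blast
qed

lemma is_chartD:
  assumes "is_chart c"
  shows "open (chart_dom c)" "open (chart_map c ` chart_dom c)"
    "continuous_on (chart_dom c) (chart_map c)"
    "continuous_on (chart_map c ` chart_dom c) (chart_inv c)"
    "\<And>y. y \<in> chart_dom c \<Longrightarrow> chart_inv c (chart_map c y) = y"
    "\<And>z. z \<in> chart_map c ` chart_dom c \<Longrightarrow> chart_map c (chart_inv c z) = z"
    "\<And>z. z \<in> chart_map c ` chart_dom c \<Longrightarrow> chart_inv c z \<in> chart_dom c"
  using assms by (auto simp: is_chart_def homeomorphism_def)

lemma chart_image_eq:
  assumes "is_chart c" "U \<subseteq> chart_dom c"
  shows "chart_map c ` U = {z \<in> chart_map c ` chart_dom c. chart_inv c z \<in> U}"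
proof (intro set_eqI iffI)
  fix z assume "z \<in> chart_map c ` U"
  then show "z \<in> {z \<in> chart_map c ` chart_dom c. chart_inv c z \<in> U}"
    using is_chartD(5)[OF assms(1)] assms(2) by auto
next
  fix z assume "z \<in> {z \<in> chart_map c ` chart_dom c. chart_inv c z \<in> U}"
  then show "z \<in> chart_map c ` U"
    using is_chartD(6)[OF assms(1), of z] by (metis (mono_tags, lifting) image_eqI mem_Collect_eq)
qed

lemma open_chart_image:
  assumes "is_chart c" "open U" "U \<subseteq> chart_dom c"
  shows "open (chart_map c ` U)"
proof -
  have "open (chart_inv c -` U \<inter> chart_map c ` chart_dom c)"
    using continuous_open_preimage[OF is_chartD(4,2)[OF assms(1)] assms(2)] by (simp add: Int_commute)
  then show ?thesis
    unfolding chart_image_eq[OF assms(1,3)] by (simp add: vimage_def Int_def conj_commute)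
qed

lemma tendsto_chart_inv:
  assumes "is_chart c" "x \<in> chart_dom c"
  shows "(chart_inv c \<longlongrightarrow> x) (nhds (chart_map c x))"
proof -
  have "isCont (chart_inv c) (chart_map c x)"
    using is_chartD(2,4)[OF assms(1)] assms(2) continuous_on_eq_continuous_at by blast
  then have "(chart_inv c \<longlongrightarrow> chart_inv c (chart_map c x)) (nhds (chart_map c x))"
    by (simp only: isCont_def tendsto_at_iff_tendsto_nhds)
  then show ?thesis using is_chartD(5)[OF assms] by simp
qed

lemma tendsto_chart_map:
  fixes c :: "('m::t2_space, 'x::real_normed_vector) chart"
  assumes "is_chart c" "x \<in> chart_dom c"
  shows "(chart_map c \<longlongrightarrow> chart_map c x) (nhds x)"
proof -
  have "isCont (chart_map c) x"
    using is_chartD(1,3)[OF assms(1)] assms(2) continuous_on_eq_continuous_at by blast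
  then show ?thesis by (simp only: isCont_def tendsto_at_iff_tendsto_nhds)
qed

section \<open>Tangent vectors, differentials and velocities in charts of the atlas\<close>

locale C1_manifold =
  fixes A :: "('m::t2_space, 'x::banach) chart set"
  assumes atlas: "C1_atlas A"
begin

lemma atlas_charts: "c \<in> A \<Longrightarrow> c \<in> charts A"
  using atlas by (auto simp: C1_atlas_def charts_def)

lemma charts_is_chart: "c \<in> charts A \<Longrightarrow> is_chart c"
  by (simp add: charts_def)

lemma atlas_is_chart: "c \<in> A \<Longrightarrow> is_chart c"
  using charts_is_chart atlas_charts by blast

lemma atlas_cover: obtains c where "c \<in> A" "x \<in> chart_dom c"
  using atlas unfolding C1_atlas_def by blast

text \<open>One of the two charts belongs to \<open>A\<close>, since membership in
  \<open>charts A\<close> asserts compatibility with \<open>A\<close> directly. For this reason the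
  computations below are done in a chart of \<open>A\<close>, from which arbitrary charts are
  reached.\<close>

lemma transition_C1:
  assumes "c \<in> A" "c' \<in> charts A"
  shows "C1_on (chart_map c ` (chart_dom c \<inter> chart_dom c')) (chart_map c' \<circ> chart_inv c)"
    and "C1_on (chart_map c' ` (chart_dom c \<inter> chart_dom c')) (chart_map c \<circ> chart_inv c')"
  using assms by (auto simp: charts_def C1_compatible_def Int_commute)

lemma transition_deriv:
  assumes "c \<in> A" "c' \<in> charts A" "x \<in> chart_dom c" "x \<in> chart_dom c'"
  shows "(chart_map c' \<circ> chart_inv c has_derivative
      frechet_derivative (chart_map c' \<circ> chart_inv c) (at (chart_map c x))) (at (chart_map c x))"
    and "(chart_map c \<circ> chart_inv c' has_derivative
      frechet_derivative (chart_map c \<circ> chart_inv c') (at (chart_map c' x))) (at (chart_map c' x))"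
  by (rule C1_on_frechet[OF transition_C1(1)[OF assms(1,2)]], use assms in blast)
     (rule C1_on_frechet[OF transition_C1(2)[OF assms(1,2)]], use assms in blast)

lemma deriv_change_chart:
  assumes c0: "c0 \<in> A" and c: "c \<in> charts A" and x: "x \<in> chart_dom c0" "x \<in> chart_dom c"
    and g: "(g \<circ> chart_inv c0 has_derivative D) (at (chart_map c0 x))"
  shows "(g \<circ> chart_inv c has_derivative D \<circ> frechet_derivative (chart_map c0 \<circ> chart_inv c) (at (chart_map c x)))
    (at (chart_map c x))"
proof -
  have ch: "is_chart c" "is_chart c0" using c c0 charts_is_chart atlas_is_chart by auto
  have "((g \<circ> chart_inv c0) \<circ> (chart_map c0 \<circ> chart_inv c) has_derivative
      D \<circ> frechet_derivative (chart_map c0 \<circ> chart_inv c) (at (chart_map c x))) (at (chart_map c x))"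
    using transition_deriv(2)[OF c0 c x] g is_chartD(5)[OF ch(1) x(2)]
    by (intro diff_chain_at) auto
  then show ?thesis
  proof (rule has_derivative_transform_within_open)
    show "open (chart_map c ` (chart_dom c0 \<inter> chart_dom c))"
      by (intro open_chart_image open_Int is_chartD(1) ch) auto
    show "chart_map c x \<in> chart_map c ` (chart_dom c0 \<inter> chart_dom c)" using x by auto
    fix z assume "z \<in> chart_map c ` (chart_dom c0 \<inter> chart_dom c)"
    then show "((g \<circ> chart_inv c0) \<circ> (chart_map c0 \<circ> chart_inv c)) z = (g \<circ> chart_inv c) z"
      using is_chartD(5)[OF ch(1)] is_chartD(5)[OF ch(2)] by auto
  qed
qed

lemma deriv_change_chart':
  assumes c0: "c0 \<in> A" and c: "c \<in> charts A" and x: "x \<in> chart_dom c0" "x \<in> chart_dom c"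
    and g: "(g \<circ> chart_inv c has_derivative D) (at (chart_map c x))"
  shows "(g \<circ> chart_inv c0 has_derivative D \<circ> frechet_derivative (chart_map c \<circ> chart_inv c0) (at (chart_map c0 x)))
    (at (chart_map c0 x))"
proof -
  have ch: "is_chart c" "is_chart c0" using c c0 charts_is_chart atlas_is_chart by auto
  have "((g \<circ> chart_inv c) \<circ> (chart_map c \<circ> chart_inv c0) has_derivative
      D \<circ> frechet_derivative (chart_map c \<circ> chart_inv c0) (at (chart_map c0 x))) (at (chart_map c0 x))"
    using transition_deriv(1)[OF c0 c x] g is_chartD(5)[OF ch(2) x(1)]
    by (intro diff_chain_at) auto
  then show ?thesis
  proof (rule has_derivative_transform_within_open)
    show "open (chart_map c0 ` (chart_dom c0 \<inter> chart_dom c))"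
      by (intro open_chart_image open_Int is_chartD(1) ch) auto
    show "chart_map c0 x \<in> chart_map c0 ` (chart_dom c0 \<inter> chart_dom c)" using x by auto
    fix z assume "z \<in> chart_map c0 ` (chart_dom c0 \<inter> chart_dom c)"
    then show "((g \<circ> chart_inv c) \<circ> (chart_map c \<circ> chart_inv c0)) z = (g \<circ> chart_inv c0) z"
      using is_chartD(5)[OF ch(1)] is_chartD(5)[OF ch(2)] by auto
  qed
qed

text \<open>By the chain rule through c0 both classes have the same component in every chart at x; a
  tangent vector can thus be represented in any chosen chart of \<open>A\<close>.\<close>

lemma tangent_vec_change:
  assumes c0: "c0 \<in> A" and c: "c \<in> charts A" and x: "x \<in> chart_dom c0" "x \<in> chart_dom c"
  shows "tangent_vec A c x v =
    tangent_vec A c0 x (frechet_derivative (chart_map c0 \<circ> chart_inv c) (at (chart_map c x)) v)"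
proof -
  have "frechet_derivative (chart_map c' \<circ> chart_inv c) (at (chart_map c x)) v =
      frechet_derivative (chart_map c' \<circ> chart_inv c0) (at (chart_map c0 x))
        (frechet_derivative (chart_map c0 \<circ> chart_inv c) (at (chart_map c x)) v)"
    if "c' \<in> charts A" "x \<in> chart_dom c'" for c'
    using frechet_derivative_at[OF deriv_change_chart[OF c0 c x transition_deriv(1)[OF c0 that(1) x(1) that(2)]]]
    by (simp add: fun_eq_iff)
  then show ?thesis by (auto simp: tangent_vec_def)
qed

lemma tangent_space_eq:
  assumes "c0 \<in> A" "x \<in> chart_dom c0"
  shows "tangent_space A x = range (tangent_vec A c0 x)"
proof
  show "tangent_space A x \<subseteq> range (tangent_vec A c0 x)"
    using tangent_vec_change[OF assms(1) _ assms(2)] unfolding tangent_space_def by blast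
  show "range (tangent_vec A c0 x) \<subseteq> tangent_space A x"
    using assms atlas_charts unfolding tangent_space_def by blast
qed

lemma tangent_vec_self:
  assumes "c \<in> charts A" "x \<in> chart_dom c"
  shows "(c, v) \<in> tangent_vec A c x v"
proof -
  have ch: "is_chart c" using assms charts_is_chart by auto
  have "(id has_derivative id) (at (chart_map c x))" by (simp add: id_def)
  then have "(chart_map c \<circ> chart_inv c has_derivative id) (at (chart_map c x))"
    by (rule has_derivative_transform_within_open[OF _ is_chartD(2)[OF ch]])
       (use assms is_chartD(6)[OF ch] in auto)
  then have "frechet_derivative (chart_map c \<circ> chart_inv c) (at (chart_map c x)) = id"
    by (rule frechet_derivative_at[symmetric])
  then show ?thesis using assms by (simp add: tangent_vec_def)
qed

text \<open>The chain rule gives the same value for all representatives, and (c0, v) is one of them;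
  so the definite description in \<open>differential\<close> denotes this value.\<close>

lemma differential_eq:
  assumes g: "C1_fun A g" and c0: "c0 \<in> A" and x: "x \<in> chart_dom c0"
    and D: "(g \<circ> chart_inv c0 has_derivative D) (at (chart_map c0 x))"
  shows "differential A g x (tangent_vec A c0 x v) = D v"
proof -
  have "frechet_derivative (g \<circ> chart_inv c) (at (chart_map c x)) w = D v"
    if cw: "(c, w) \<in> tangent_vec A c0 x v" for c w
  proof -
    have c: "c \<in> charts A" "x \<in> chart_dom c"
      and w: "w = frechet_derivative (chart_map c \<circ> chart_inv c0) (at (chart_map c0 x)) v"
      using cw by (auto simp: tangent_vec_def)
    have "C1_on (chart_map c ` chart_dom c) (g \<circ> chart_inv c)" using g c by (simp add: C1_fun_def)
    then have "(g \<circ> chart_inv c has_derivative frechet_derivative (g \<circ> chart_inv c) (at (chart_map c x))) (at (chart_map c x))"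
      using c by (intro C1_on_frechet) auto
    from has_derivative_unique[OF deriv_change_chart'[OF c0 c(1) x c(2) this] D] show ?thesis
      unfolding w by (simp add: fun_eq_iff)
  qed
  moreover have "tangent_vec A c0 x v \<in> tangent_space A x"
    using tangent_space_eq[OF c0 x] by auto
  ultimately show ?thesis
    using tangent_vec_self[OF atlas_charts[OF c0] x, of v]
    by (auto simp: differential_def intro!: the_equality)
qed

text \<open>Continuity keeps \<gamma> inside the domain of c0 near t, so that there the curve
  factors through c0 and the chain rule applies in every other chart.\<close>

lemma velocity_eq:
  assumes c0: "c0 \<in> A" and x: "\<gamma> t \<in> chart_dom c0" and cont: "isCont \<gamma> t"
    and D: "(chart_map c0 \<circ> \<gamma> has_vector_derivative D) (at t)"
  shows "{(c, w). c \<in> charts A \<and> \<gamma> t \<in> chart_dom c \<and> w = vector_derivative (chart_map c \<circ> \<gamma>) (at t)}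
    = tangent_vec A c0 (\<gamma> t) D"
proof -
  have "vector_derivative (chart_map c \<circ> \<gamma>) (at t) =
     frechet_derivative (chart_map c \<circ> chart_inv c0) (at (chart_map c0 (\<gamma> t))) D"
    if c: "c \<in> charts A" "\<gamma> t \<in> chart_dom c" for c
  proof (rule vector_derivative_at)
    let ?B = "frechet_derivative (chart_map c \<circ> chart_inv c0) (at (chart_map c0 (\<gamma> t)))"
    have ch0: "is_chart c0" using c0 atlas_is_chart by auto
    have B: "(chart_map c \<circ> chart_inv c0 has_derivative ?B) (at ((chart_map c0 \<circ> \<gamma>) t))"
      using transition_deriv(1)[OF c0 c(1) x c(2)] by simp
    have "((chart_map c \<circ> chart_inv c0) \<circ> (chart_map c0 \<circ> \<gamma>) has_vector_derivative ?B D) (at t)"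
      by (rule vector_derivative_diff_chain_within[OF D]) (use B has_derivative_at_withinI in blast)
    moreover have "\<forall>\<^sub>F s in nhds t. \<gamma> s \<in> chart_dom c0"
      using cont x is_chartD(1)[OF ch0] by (simp add: isCont_def tendsto_at_iff_tendsto_nhds topological_tendstoD)
    then have "\<forall>\<^sub>F s in nhds t. ((chart_map c \<circ> chart_inv c0) \<circ> (chart_map c0 \<circ> \<gamma>)) s = (chart_map c \<circ> \<gamma>) s"
      by eventually_elim (simp add: is_chartD(5)[OF ch0])
    ultimately show "(chart_map c \<circ> \<gamma> has_vector_derivative ?B D) (at t)"
      using is_chartD(5)[OF ch0 x] by (subst has_vector_derivative_cong_ev[symmetric]) auto
  qed
  then show ?thesis by (auto simp: tangent_vec_def)
qed

end

section \<open>Norms on tangent spaces and test functions\<close>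

locale Finsler_manifold =
  fixes A :: "('m::t2_space, 'x::banach) chart set"
    and F :: "'m \<Rightarrow> ('m, 'x) tangent \<Rightarrow> real"
  assumes Finsler: "C1_Finsler_manifold A F"

sublocale Finsler_manifold \<subseteq> C1_manifold A
  using Finsler by unfold_locales (simp add: C1_Finsler_manifold_def)

context Finsler_manifold
begin

text \<open>The norm of the tangent space at x pulled back to the model space, where norms at
  different points can be compared.\<close>

definition chart_norm :: "('m, 'x) chart \<Rightarrow> 'm \<Rightarrow> 'x \<Rightarrow> real" where
  "chart_norm c x v = F x (tangent_vec A c x v)"

lemma chart_norm:
  assumes "c \<in> A" "x \<in> chart_dom c"
  shows "is_norm (chart_norm c x)" "equivalent_to_norm (chart_norm c x)"
  using Finsler[unfolded C1_Finsler_manifold_def, THEN conjunct2, THEN conjunct2, THEN conjunct2, THEN conjunct2,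
      THEN conjunct1, rule_format, OF atlas_charts[OF assms(1)] assms(2)]
  unfolding chart_norm_def by simp_all

lemma chart_norm_close:
  assumes "c \<in> A" "x0 \<in> chart_dom c" "\<epsilon> > 0"
  obtains W where "open W" "x0 \<in> W" "W \<subseteq> chart_dom c"
    "\<And>x v. x \<in> W \<Longrightarrow> chart_norm c x0 v \<le> (1 + \<epsilon>) * chart_norm c x v"
    "\<And>x v. x \<in> W \<Longrightarrow> chart_norm c x v \<le> (1 + \<epsilon>) * chart_norm c x0 v"
proof -
  obtain W where W: "open W" "x0 \<in> W" "W \<subseteq> chart_dom c" and
    *: "\<forall>x\<in>W. \<forall>v. 1 / (1 + \<epsilon>) * F x0 (tangent_vec A c x0 v) \<le> F x (tangent_vec A c x v) \<and>
             F x (tangent_vec A c x v) \<le> (1 + \<epsilon>) * F x0 (tangent_vec A c x0 v)"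
    using Finsler[unfolded C1_Finsler_manifold_def, THEN conjunct2, THEN conjunct2, THEN conjunct2, THEN conjunct2,
        THEN conjunct2, rule_format, OF assms(3) atlas_charts[OF assms(1)] assms(2)] by (elim exE conjE)
  show ?thesis
  proof (rule that[OF W])
    fix x v assume "x \<in> W"
    then show "chart_norm c x0 v \<le> (1 + \<epsilon>) * chart_norm c x v" "chart_norm c x v \<le> (1 + \<epsilon>) * chart_norm c x0 v"
      using * assms(3) by (auto simp: chart_norm_def field_simps)
  qed
qed

text \<open>A priori the preimage of a closed ball is closed in the chart domain only. Regularity
  supplies V whose closure stays in the domain; a ball inside the image of V has a preimage whose
  limit points stay there too, so it is closed in M.\<close>

lemma closed_chart_ball:
  assumes c: "c \<in> A" and x: "x \<in> chart_dom c" and W: "open W" "x \<in> W"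
  obtains r where "r > 0" "cball (chart_map c x) r \<subseteq> chart_map c ` chart_dom c"
    "chart_inv c ` cball (chart_map c x) r \<subseteq> W"
    "\<And>s. s \<le> r \<Longrightarrow> closed (chart_inv c ` cball (chart_map c x) s)"
proof -
  have ch: "is_chart c" using c atlas_is_chart by auto
  obtain V where V: "open V" "x \<in> V" "closure V \<subseteq> W \<inter> chart_dom c"
    using paracompact_imp_regular[of "W \<inter> chart_dom c" x] W x is_chartD(1)[OF ch] Finsler
    unfolding C1_Finsler_manifold_def by blast
  have V_sub: "V \<subseteq> chart_dom c" "V \<subseteq> W" using V(3) closure_subset[of V] by auto
  obtain r where r: "r > 0" "cball (chart_map c x) r \<subseteq> chart_map c ` V"
    using open_chart_image[OF ch V(1) V_sub(1)] V(2) open_contains_cball by (metis image_eqI)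
  have inv: "chart_inv c ` cball (chart_map c x) s = {y \<in> chart_dom c. chart_map c y \<in> cball (chart_map c x) s}"
    and inV: "chart_inv c ` cball (chart_map c x) s \<subseteq> V" if "s \<le> r" for s
  proof -
    have sub: "cball (chart_map c x) s \<subseteq> chart_map c ` V" using r(2) that by auto
    then show "chart_inv c ` cball (chart_map c x) s \<subseteq> V"
      using V_sub(1) is_chartD(5)[OF ch] by fastforce
    show "chart_inv c ` cball (chart_map c x) s = {y \<in> chart_dom c. chart_map c y \<in> cball (chart_map c x) s}" (is "?L = ?R")
    proof
      show "?L \<subseteq> ?R"
      proof
        fix y assume "y \<in> ?L"
        then obtain z where z: "z \<in> cball (chart_map c x) s" "y = chart_inv c z" by blast
        then have "z \<in> chart_map c ` chart_dom c" using sub V_sub(1) by blast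
        then show "y \<in> ?R" using is_chartD(6,7)[OF ch] z by auto
      qed
      show "?R \<subseteq> ?L" using is_chartD(5)[OF ch] by (auto intro!: image_eqI[rotated])
    qed
  qed
  show ?thesis
  proof (rule that[of r])
    show "r > 0" "cball (chart_map c x) r \<subseteq> chart_map c ` chart_dom c" using r V_sub(1) by auto
    show "chart_inv c ` cball (chart_map c x) r \<subseteq> W" using inV[of r] V_sub(2) by auto
    show "closed (chart_inv c ` cball (chart_map c x) s)" if s: "s \<le> r" for s
    proof -
      let ?K = "chart_inv c ` cball (chart_map c x) s"
      have "closedin (top_of_set (chart_dom c)) (chart_dom c \<inter> chart_map c -` cball (chart_map c x) s)"
        by (intro continuous_closedin_preimage is_chartD(3)[OF ch] closed_cball)
      then have "closedin (top_of_set (chart_dom c)) ?K" using inv[OF s] by (simp add: Int_def vimage_def)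
      then obtain T where T: "closed T" "?K = T \<inter> chart_dom c" by (auto simp: closedin_closed)
      have "closure ?K \<subseteq> T" using T by (intro closure_minimal) auto
      moreover have "closure ?K \<subseteq> chart_dom c" using closure_mono[OF inV[OF s]] V(3) by auto
      ultimately have "closure ?K \<subseteq> ?K" using T(2) by auto
      then show "closed ?K" by (metis closure_subset closure_eq subset_antisym)
    qed
  qed
qed

text \<open>Test functions must be C1 on all of M. The cutoff 1 - \<beta>, rescaled to radius r, is
  1 near x and 0 off the chart ball, so the product with h extends by 0. The chart domain and the
  complement of the ball, open because the ball is closed in M, cover M, and on each the extension
  is C1.\<close>

lemma extend_test_function:
  fixes h :: "'x \<Rightarrow> real"
  assumes "\<exists>b :: 'x \<Rightarrow> real. C1_Lipschitz_bump b"
    and c: "c \<in> A" and x: "x \<in> chart_dom c" and h: "C1_on UNIV h"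
  obtains g where "C1_fun A g" "\<forall>\<^sub>F y in nhds x. g y = h (chart_map c y)"
proof -
  have ch: "is_chart c" using c atlas_is_chart by auto
  obtain \<beta> :: "'x \<Rightarrow> real" and \<beta>' C r0 where "C1_gauge \<beta> \<beta>' C r0"
    using assms(1) C1_gauge_exists by blast
  then interpret C1_gauge \<beta> \<beta>' C r0 .
  obtain r where r: "r > 0" "cball (chart_map c x) r \<subseteq> chart_map c ` chart_dom c"
    and closed: "closed (chart_inv c ` cball (chart_map c x) r)"
    using closed_chart_ball[OF c x open_UNIV UNIV_I] by (metis order_refl)
  let ?K = "chart_inv c ` cball (chart_map c x) r"
  define k where "k z = h z * (1 - \<beta> ((1 / r) *\<^sub>R (z - chart_map c x)))" for z
  define g where "g y = (if y \<in> chart_dom c then k (chart_map c y) else 0)" for y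
  have "C1_on UNIV (\<lambda>z. 1 - \<beta> ((1 / r) *\<^sub>R (z - chart_map c x)))"
    unfolding C1_on_def
  proof (intro exI conjI ballI)
    show "((\<lambda>z. 1 - \<beta> ((1 / r) *\<^sub>R (z - chart_map c x))) has_derivative
      blinfun_apply (- ((1/r) *\<^sub>R \<beta>' ((1 / r) *\<^sub>R (z - chart_map c x))))) (at z)" for z
      using has_derivative_diff[OF has_derivative_const deriv_scaled, of 1]
      by (simp add: uminus_blinfun.rep_eq)
    show "continuous_on UNIV (\<lambda>z. - ((1/r) *\<^sub>R \<beta>' ((1 / r) *\<^sub>R (z - chart_map c x))))"
      by (intro continuous_intros cont_deriv_compose)
  qed
  then have k: "C1_on UNIV k" unfolding k_def by (intro C1_on_mult h)
  have k0: "k z = 0" if "z \<notin> cball (chart_map c x) r" for z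
  proof -
    have "norm ((1 / r) *\<^sub>R (z - chart_map c x)) \<ge> 1"
      using that r by (simp add: dist_norm norm_minus_commute)
    from eq_1[OF this] show ?thesis by (simp add: k_def)
  qed
  have g0: "g y = 0" if "y \<notin> ?K" for y
  proof (cases "y \<in> chart_dom c")
    case True
    then have "chart_map c y \<notin> cball (chart_map c x) r"
      using that is_chartD(5)[OF ch True] by (metis image_eqI)
    then show ?thesis using k0 by (simp add: g_def)
  qed (simp add: g_def)
  show ?thesis
  proof
    show "C1_fun A g"
      unfolding C1_fun_def
    proof
      fix c' assume c': "c' \<in> charts A"
      then have ch': "is_chart c'" by (rule charts_is_chart)
      show "C1_on (chart_map c' ` chart_dom c') (g \<circ> chart_inv c')"
      proof (rule C1_on_open_cover)
        fix z assume "z \<in> chart_map c' ` chart_dom c'"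
        then obtain y where y: "y \<in> chart_dom c'" "z = chart_map c' y" by blast
        show "\<exists>T. open T \<and> z \<in> T \<and> C1_on T (g \<circ> chart_inv c')"
        proof (cases "y \<in> chart_dom c")
          case True
          let ?T = "chart_map c' ` (chart_dom c \<inter> chart_dom c')"
          have T: "open ?T" by (intro open_chart_image open_Int is_chartD(1) ch ch') auto
          have "C1_on ?T (k \<circ> (chart_map c \<circ> chart_inv c'))"
            by (rule C1_on_compose[OF transition_C1(2)[OF c c'] k]) auto
          then have "C1_on ?T (g \<circ> chart_inv c')"
            by (rule C1_on_cong[OF T, rotated]) (auto simp: g_def is_chartD(5)[OF ch'])
          then show ?thesis using T True y by blast
        next
          case False
          let ?T = "chart_map c' ` (chart_dom c' - ?K)"
          have T: "open ?T" by (intro open_chart_image open_Diff is_chartD(1) ch' closed) auto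
          have "C1_on ?T (g \<circ> chart_inv c')"
            by (rule C1_on_cong[OF T _ C1_on_const[of _ 0]]) (auto simp: g0 is_chartD(5)[OF ch'])
          moreover have "y \<notin> ?K" using False is_chartD(7)[OF ch] r(2) by blast
          ultimately show ?thesis using T y by blast
        qed
      qed
    qed
    have "\<forall>\<^sub>F z in nhds (chart_map c x). z \<in> ball (chart_map c x) (r * r0)"
      using r r0 by (intro eventually_nhds_in_open) auto
    then have "\<forall>\<^sub>F y in nhds x. chart_map c y \<in> ball (chart_map c x) (r * r0)"
      using tendsto_chart_map[OF ch x] by (rule eventually_compose_filterlim)
    moreover have "\<forall>\<^sub>F y in nhds x. y \<in> chart_dom c" using is_chartD(1)[OF ch] x by (rule eventually_nhds_in_open)
    ultimately show "\<forall>\<^sub>F y in nhds x. g y = h (chart_map c y)"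
    proof eventually_elim
      case (elim y)
      have "norm ((1 / r) *\<^sub>R (chart_map c y - chart_map c x)) < r0"
        using elim(1) r by (simp add: dist_norm norm_minus_commute pos_divide_less_eq mult.commute)
      from eq_0[OF this] show ?case using elim(2) by (simp add: g_def k_def)
    qed
  qed
qed

section \<open>Dual norms computed in a chart\<close>

lemma dual_norm_le:
  assumes "c \<in> A" "x \<in> chart_dom c" "\<And>v. \<Delta> (tangent_vec A c x v) = D v" "K \<ge> 0"
    "\<And>v. \<bar>D v\<bar> \<le> K * chart_norm c x v"
  shows "dual_norm A F x \<Delta> \<le> K"
  unfolding dual_norm_def
proof (rule cSup_least)
  fix s assume "s \<in> insert 0 {\<bar>\<Delta> \<xi>\<bar> |\<xi>. \<xi> \<in> tangent_space A x \<and> F x \<xi> = 1}"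
  then consider "s = 0" | v where "s = \<bar>D v\<bar>" "chart_norm c x v = 1"
    using assms(3) unfolding tangent_space_eq[OF assms(1,2)] chart_norm_def by auto
  then show "s \<le> K" using assms(4) assms(5) by cases (auto, metis mult_1_right)
qed auto

text \<open>The bound K makes the set of values bounded above, so that its supremum is meaningful;
  its size does not enter the conclusion. The estimate is the one for unit vectors,
  rescaled.\<close>

lemma dual_norm_ge:
  assumes c: "c \<in> A" "x \<in> chart_dom c" and \<Delta>: "\<And>v. \<Delta> (tangent_vec A c x v) = D v"
    and D: "bounded_linear D" and K: "\<And>v. \<bar>D v\<bar> \<le> K * chart_norm c x v"
  shows "0 \<le> dual_norm A F x \<Delta>" "\<bar>D v\<bar> \<le> dual_norm A F x \<Delta> * chart_norm c x v"
proof -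
  let ?S = "insert 0 {\<bar>\<Delta> \<xi>\<bar> |\<xi>. \<xi> \<in> tangent_space A x \<and> F x \<xi> = 1}"
  note N = is_normD[OF chart_norm(1)[OF c]]
  have bdd: "bdd_above ?S"
  proof (rule bdd_aboveI)
    fix s assume "s \<in> ?S"
    then consider "s = 0" | v where "s = \<bar>D v\<bar>" "chart_norm c x v = 1"
      using \<Delta> unfolding tangent_space_eq[OF c] chart_norm_def by auto
    then show "s \<le> max K 0" using K by cases (auto, metis mult_1_right max.coboundedI1)
  qed
  then show "0 \<le> dual_norm A F x \<Delta>" unfolding dual_norm_def by (intro cSup_upper) auto
  show "\<bar>D v\<bar> \<le> dual_norm A F x \<Delta> * chart_norm c x v"
  proof (cases "chart_norm c x v = 0")
    case True
    then show ?thesis using K[of v] by simp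
  next
    case False
    define w where "w = (1 / chart_norm c x v) *\<^sub>R v"
    have pos: "chart_norm c x v > 0" using False N(1)[of v] by simp
    have "chart_norm c x w = 1" using False N(1)[of v] by (simp add: w_def N(3))
    then have "\<bar>\<Delta> (tangent_vec A c x w)\<bar> \<in> ?S"
      unfolding chart_norm_def tangent_space_eq[OF c] by auto
    then have "\<bar>D w\<bar> \<le> dual_norm A F x \<Delta>"
      unfolding dual_norm_def \<Delta> using bdd by (intro cSup_upper)
    moreover have "D w = D v / chart_norm c x v"
      using D by (simp add: w_def linear_simps)
    ultimately show ?thesis using pos by (simp add: field_simps)
  qed
qed

end

section \<open>Speed of paths\<close>

lemma C1_path_cong:
  assumes "C1_path A s t \<gamma>" "\<And>\<tau>. \<tau> \<in> {s..t} \<Longrightarrow> \<gamma> \<tau> = \<gamma>' \<tau>"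
  shows "C1_path A s t \<gamma>'"
  unfolding C1_path_def
proof (intro conjI ballI)
  show "continuous_on {s..t} \<gamma>'"
    using assms continuous_on_cong[OF refl, of "{s..t}" \<gamma> \<gamma>'] by (simp add: C1_path_def)
  fix c assume "c \<in> charts A"
  then obtain D where D: "\<And>\<tau>. \<tau> \<in> {s..t} \<Longrightarrow> \<gamma> \<tau> \<in> chart_dom c \<Longrightarrow>
      (chart_map c \<circ> \<gamma> has_vector_derivative D \<tau>) (at \<tau> within {s..t})"
    "continuous_on {\<tau> \<in> {s..t}. \<gamma> \<tau> \<in> chart_dom c} D"
    using assms(1) unfolding C1_path_def by (metis (mono_tags, lifting) mem_Collect_eq)
  have eq: "{\<tau> \<in> {s..t}. \<gamma>' \<tau> \<in> chart_dom c} = {\<tau> \<in> {s..t}. \<gamma> \<tau> \<in> chart_dom c}"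
    using assms(2) by auto
  show "\<exists>D. (\<forall>\<tau>\<in>{\<tau> \<in> {s..t}. \<gamma>' \<tau> \<in> chart_dom c}. (chart_map c \<circ> \<gamma>' has_vector_derivative D \<tau>) (at \<tau> within {s..t})) \<and>
     continuous_on {\<tau> \<in> {s..t}. \<gamma>' \<tau> \<in> chart_dom c} D"
    unfolding eq
  proof (intro exI conjI ballI)
    show "continuous_on {\<tau> \<in> {s..t}. \<gamma> \<tau> \<in> chart_dom c} D" by (fact D)
    fix \<tau> assume \<tau>: "\<tau> \<in> {\<tau> \<in> {s..t}. \<gamma> \<tau> \<in> chart_dom c}"
    have "(chart_map c \<circ> \<gamma> has_vector_derivative D \<tau>) (at \<tau> within {s..t})" using \<tau> D by auto
    then show "(chart_map c \<circ> \<gamma>' has_vector_derivative D \<tau>) (at \<tau> within {s..t})"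
      by (rule has_vector_derivative_transform[rotated 2]) (use \<tau> assms(2) in auto)
  qed
qed

text \<open>The image is required to be exactly \<open>{s..t}\<close>, so that derivatives within
  the closed intervals correspond at the end points as well. A negative m is allowed for the sake of
  reversal.\<close>

lemma C1_path_affine:
  assumes "C1_path A s t \<gamma>" "(\<lambda>\<tau>. m * \<tau> + k) ` {s'..t'} = {s..t}"
  shows "C1_path A s' t' (\<lambda>\<tau>. \<gamma> (m * \<tau> + k))"
  unfolding C1_path_def
proof (intro conjI ballI)
  have mem: "m * \<tau> + k \<in> {s..t}" if "\<tau> \<in> {s'..t'}" for \<tau> using that assms(2) by blast
  show "continuous_on {s'..t'} (\<lambda>\<tau>. \<gamma> (m * \<tau> + k))"
  proof (rule continuous_on_compose2[of "{s..t}" \<gamma>])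
    show "continuous_on {s..t} \<gamma>" using assms(1) by (simp add: C1_path_def)
    show "continuous_on {s'..t'} (\<lambda>\<tau>. m * \<tau> + k)" by (intro continuous_intros)
    show "(\<lambda>\<tau>. m * \<tau> + k) ` {s'..t'} \<subseteq> {s..t}" using assms(2) by blast
  qed
  fix c assume "c \<in> charts A"
  then obtain D where D: "\<And>\<tau>. \<tau> \<in> {s..t} \<Longrightarrow> \<gamma> \<tau> \<in> chart_dom c \<Longrightarrow>
      (chart_map c \<circ> \<gamma> has_vector_derivative D \<tau>) (at \<tau> within {s..t})"
    "continuous_on {\<tau> \<in> {s..t}. \<gamma> \<tau> \<in> chart_dom c} D"
    using assms(1) unfolding C1_path_def by (metis (mono_tags, lifting) mem_Collect_eq)
  let ?S = "{\<tau> \<in> {s'..t'}. \<gamma> (m * \<tau> + k) \<in> chart_dom c}"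
  show "\<exists>D. (\<forall>\<tau>\<in>?S. (chart_map c \<circ> (\<lambda>\<tau>. \<gamma> (m * \<tau> + k)) has_vector_derivative D \<tau>) (at \<tau> within {s'..t'})) \<and>
     continuous_on ?S D"
  proof (intro exI conjI ballI)
    show "continuous_on ?S (\<lambda>\<tau>. m *\<^sub>R D (m * \<tau> + k))"
    proof (intro continuous_on_scaleR continuous_on_const continuous_on_compose2[OF D(2)])
      show "continuous_on ?S (\<lambda>\<tau>. m * \<tau> + k)" by (intro continuous_intros)
      show "(\<lambda>\<tau>. m * \<tau> + k) ` ?S \<subseteq> {\<tau> \<in> {s..t}. \<gamma> \<tau> \<in> chart_dom c}" using mem by blast
    qed
    fix \<tau> assume \<tau>: "\<tau> \<in> ?S"
    have "((\<lambda>\<tau>. m * \<tau> + k) has_vector_derivative m) (at \<tau> within {s'..t'})"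
      by (auto intro!: derivative_eq_intros simp: has_vector_derivative_def)
    moreover have "(chart_map c \<circ> \<gamma> has_vector_derivative D (m * \<tau> + k)) (at (m * \<tau> + k) within (\<lambda>\<tau>. m * \<tau> + k) ` {s'..t'})"
      unfolding assms(2) using \<tau> mem by (intro D) auto
    ultimately have "((chart_map c \<circ> \<gamma>) \<circ> (\<lambda>\<tau>. m * \<tau> + k) has_vector_derivative m *\<^sub>R D (m * \<tau> + k)) (at \<tau> within {s'..t'})"
      by (rule vector_diff_chain_within)
    then show "(chart_map c \<circ> (\<lambda>\<tau>. \<gamma> (m * \<tau> + k)) has_vector_derivative m *\<^sub>R D (m * \<tau> + k)) (at \<tau> within {s'..t'})"
      by (simp add: comp_def)
  qed
qed

context Finsler_manifold
begin

text \<open>By (P2) the norm at a point near p t differs from that at p t by a factor of at most 1 +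
  e/(2 q). Since q exceeds the norms involved, this is an absolute error of at most e/2; continuity
  of the one fixed norm at p t supplies the other half.\<close>

lemma continuous_on_chart_norm:
  fixes p :: "real \<Rightarrow> 'm"
  assumes c: "c \<in> A" and p: "continuous_on T p" "p ` T \<subseteq> chart_dom c" and D: "continuous_on T D"
  shows "continuous_on T (\<lambda>t. chart_norm c (p t) (D t))"
  unfolding continuous_on_def
proof
  fix t assume t: "t \<in> T"
  then have x: "p t \<in> chart_dom c" using p(2) by auto
  let ?N = "chart_norm c (p t)"
  obtain M where M: "\<And>v. ?N v \<le> M * norm v"
    using chart_norm(2)[OF c x] by (auto simp: equivalent_to_norm_def)
  have N_lim: "((\<lambda>s. ?N (D s)) \<longlongrightarrow> ?N (D t)) (at t within T)"
    using continuous_on_compose2[OF is_norm_continuous[OF chart_norm(1)[OF c x] M] D] t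
    by (auto simp: continuous_on_def)
  show "((\<lambda>s. chart_norm c (p s) (D s)) \<longlongrightarrow> ?N (D t)) (at t within T)"
  proof (rule tendstoI)
    fix e :: real assume e: "e > 0"
    define q where "q = ?N (D t) + 1"
    have q: "q > 0" using is_normD(1)[OF chart_norm(1)[OF c x], of "D t"] by (simp add: q_def)
    have \<epsilon>: "e / (2 * q) > 0" using e q by simp
    obtain W where W: "open W" "p t \<in> W"
      "\<And>x v. x \<in> W \<Longrightarrow> ?N v \<le> (1 + e / (2 * q)) * chart_norm c x v"
      "\<And>x v. x \<in> W \<Longrightarrow> chart_norm c x v \<le> (1 + e / (2 * q)) * ?N v"
      by (rule chart_norm_close[OF c x \<epsilon>]) blast
    have "(p \<longlongrightarrow> p t) (at t within T)" using p(1) t by (auto simp: continuous_on_def)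
    then have "\<forall>\<^sub>F s in at t within T. p s \<in> W" using W by (intro topological_tendstoD)
    moreover have "\<forall>\<^sub>F s in at t within T. dist (?N (D s)) (?N (D t)) < min 1 (e/2)"
      using N_lim e by (intro tendstoD) auto
    ultimately show "\<forall>\<^sub>F s in at t within T. dist (chart_norm c (p s) (D s)) (?N (D t)) < e"
    proof eventually_elim
      case (elim s)
      let ?a = "chart_norm c (p s) (D s)" and ?b = "?N (D s)"
      have b: "0 \<le> ?b" "?b < q" using elim(2) is_normD(1)[OF chart_norm(1)[OF c x]] by (auto simp: q_def dist_real_def)
      have eb: "e / (2 * q) * ?b \<le> e / 2"
      proof -
        have "e / (2 * q) * ?b \<le> e / (2 * q) * q" using b \<epsilon> by (intro mult_left_mono) auto
        then show ?thesis using q by simp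
      qed
      have up: "?a \<le> ?b + e / (2 * q) * ?b" using W(4)[OF elim(1), of "D s"] by (simp add: algebra_simps)
      have lo: "?b - ?a \<le> e / (2 * q) * ?b"
      proof (cases "?a \<le> ?b")
        case True
        have "?b \<le> ?a + e / (2 * q) * ?a" using W(3)[OF elim(1), of "D s"] by (simp add: algebra_simps)
        also have "\<dots> \<le> ?a + e / (2 * q) * ?b" using True \<epsilon> by (intro add_left_mono mult_left_mono) auto
        finally show ?thesis by simp
      next
        case False
        have "0 \<le> e / (2 * q) * ?b" by (rule mult_nonneg_nonneg[OF less_imp_le[OF \<epsilon>] b(1)])
        then show ?thesis using False by linarith
      qed
      have "\<bar>?a - ?b\<bar> \<le> e / 2" using up lo eb by linarith
      then show ?case using elim(2) unfolding dist_real_def by linarith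
    qed
  qed
qed

text \<open>With two-sided derivatives the value does not depend on the parameter interval, so
  lengths over subintervals can be added. For a fixed interval it departs from the norm of
  \<open>velocity\<close> at the end points only.\<close>

definition speed :: "(real \<Rightarrow> 'm) \<Rightarrow> real \<Rightarrow> real" where
  "speed \<gamma> t = F (\<gamma> t) {(c, w). c \<in> charts A \<and> \<gamma> t \<in> chart_dom c \<and> w = vector_derivative (chart_map c \<circ> \<gamma>) (at t)}"

lemma path_len_speed: "path_len A F a b \<gamma> = integral {a..b} (speed \<gamma>)"
  unfolding path_len_def
proof (rule integral_spike[of "{a, b}"])
  fix t assume "t \<in> {a..b} - {a, b}"
  then have "at t within {a..b} = at t" by (auto simp: at_within_Icc_at)
  then show "speed \<gamma> t = F (\<gamma> t) (velocity A a b \<gamma> t)"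
    by (simp add: speed_def velocity_def)
qed (simp add: negligible_finite)

lemma speed_cong:
  assumes "open U" "t \<in> U" "\<And>s. s \<in> U \<Longrightarrow> \<gamma> s = \<gamma>' s"
  shows "speed \<gamma> t = speed \<gamma>' t"
proof -
  have "\<forall>\<^sub>F s in nhds t. s \<in> UNIV \<longrightarrow> (chart_map c \<circ> \<gamma>) s = (chart_map c \<circ> \<gamma>') s" for c :: "('m, 'x) chart"
    using eventually_nhds_in_open[OF assms(1,2)] by eventually_elim (simp add: assms(3))
  then have "(chart_map c \<circ> \<gamma> has_vector_derivative D) (at t) \<longleftrightarrow> (chart_map c \<circ> \<gamma>' has_vector_derivative D) (at t)"
    for c :: "('m, 'x) chart" and D
    by (rule has_vector_derivative_cong_ev) (simp add: assms)
  then have "vector_derivative (chart_map c \<circ> \<gamma>) (at t) = vector_derivative (chart_map c \<circ> \<gamma>') (at t)" for c :: "('m, 'x) chart"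
    unfolding vector_derivative_def by (simp only:)
  then show ?thesis using assms by (simp add: speed_def)
qed

lemma speed_eq:
  assumes "c \<in> A" "\<gamma> t \<in> chart_dom c" "isCont \<gamma> t" "(chart_map c \<circ> \<gamma> has_vector_derivative D) (at t)"
  shows "speed \<gamma> t = chart_norm c (\<gamma> t) D"
  unfolding speed_def chart_norm_def velocity_eq[OF assms] ..

lemma C1_path_interior:
  assumes \<gamma>: "C1_path A s t \<gamma>" and \<tau>: "\<tau> \<in> {s<..<t}"
  shows "isCont \<gamma> \<tau>"
    and "\<lbrakk>c \<in> A; \<gamma> \<tau> \<in> chart_dom c\<rbrakk> \<Longrightarrow> \<exists>D. (chart_map c \<circ> \<gamma> has_vector_derivative D) (at \<tau>)"
proof -
  show "isCont \<gamma> \<tau>"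
    using continuous_on_interior[of "{s..t}" \<gamma> \<tau>] \<gamma> \<tau> by (simp add: C1_path_def interior_atLeastAtMost_real)
  assume "c \<in> A" "\<gamma> \<tau> \<in> chart_dom c"
  then have "\<exists>D. (chart_map c \<circ> \<gamma> has_vector_derivative D) (at \<tau> within {s..t})"
    using \<gamma> \<tau> atlas_charts unfolding C1_path_def by fastforce
  then show "\<exists>D. (chart_map c \<circ> \<gamma> has_vector_derivative D) (at \<tau>)"
    using \<tau> by (simp add: at_within_Icc_at)
qed

lemma speed_integrable_chart:
  assumes \<gamma>: "C1_path A s t \<gamma>" and c: "c \<in> A" "\<gamma> ` {s..t} \<subseteq> chart_dom c"
  shows "speed \<gamma> integrable_on {s..t}"
proof -
  obtain D where D: "\<And>\<tau>. \<tau> \<in> {s..t} \<Longrightarrow> \<gamma> \<tau> \<in> chart_dom c \<Longrightarrow>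
      (chart_map c \<circ> \<gamma> has_vector_derivative D \<tau>) (at \<tau> within {s..t})"
    "continuous_on {\<tau> \<in> {s..t}. \<gamma> \<tau> \<in> chart_dom c} D"
    using \<gamma> atlas_charts[OF c(1)] unfolding C1_path_def by (metis (mono_tags, lifting) mem_Collect_eq)
  have "{\<tau> \<in> {s..t}. \<gamma> \<tau> \<in> chart_dom c} = {s..t}" using c(2) by auto
  then have "continuous_on {s..t} D" using D(2) by simp
  then have "continuous_on {s..t} (\<lambda>\<tau>. chart_norm c (\<gamma> \<tau>) (D \<tau>))"
    using \<gamma> by (intro continuous_on_chart_norm c) (auto simp: C1_path_def)
  then have "(\<lambda>\<tau>. chart_norm c (\<gamma> \<tau>) (D \<tau>)) integrable_on {s..t}" by (rule integrable_continuous_real)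
  then show ?thesis
  proof (rule integrable_spike_finite[of "{s, t}", rotated 2])
    fix \<tau> assume \<tau>: "\<tau> \<in> {s..t} - {s, t}"
    have x: "\<gamma> \<tau> \<in> chart_dom c" using \<tau> c by auto
    moreover have "(chart_map c \<circ> \<gamma> has_vector_derivative D \<tau>) (at \<tau>)"
      using D(1)[OF _ x] \<tau> by (auto simp: at_within_Icc_at)
    moreover have "isCont \<gamma> \<tau>" by (rule C1_path_interior(1)[OF \<gamma>]) (use \<tau> in auto)
    ultimately show "speed \<gamma> \<tau> = chart_norm c (\<gamma> \<tau>) (D \<tau>)" by (intro speed_eq c)
  qed simp
qed

text \<open>Integrability is local. Near a parameter x the path stays in one chart domain and has no
  break point except possibly x, so the pieces on both sides of x are C1 within a chart.\<close>

lemma speed_integrable: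
  assumes \<gamma>: "piecewise_C1_path A a b \<gamma>"
  shows "speed \<gamma> integrable_on {a..b}"
proof -
  obtain S where S: "finite S" "\<And>s t. a \<le> s \<Longrightarrow> s < t \<Longrightarrow> t \<le> b \<Longrightarrow> S \<inter> {s<..<t} = {} \<Longrightarrow> C1_path A s t \<gamma>"
    and cont: "continuous_on {a..b} \<gamma>"
    using \<gamma> unfolding piecewise_C1_path_def by blast
  have "\<exists>d>0. \<forall>u v. x \<in> cbox u v \<and> cbox u v \<subseteq> ball x d \<and> cbox u v \<subseteq> cbox a b \<longrightarrow> speed \<gamma> integrable_on cbox u v"
    if x: "x \<in> cbox a b" for x
  proof -
    obtain c where c: "c \<in> A" "\<gamma> x \<in> chart_dom c" by (rule atlas_cover)
    have "open (chart_dom c)" using c atlas_is_chart is_chartD(1) by blast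
    then obtain B where B: "open B" "x \<in> B" "\<And>y. y \<in> {a..b} \<Longrightarrow> y \<in> B \<Longrightarrow> \<gamma> y \<in> chart_dom c"
      using cont x c(2) unfolding continuous_on_topological by (metis cbox_interval)
    have "open (B - (S - {x}))" using B S by (intro open_Diff finite_imp_closed) auto
    moreover have "x \<in> B - (S - {x})" using B by auto
    ultimately obtain d where d: "d > 0" "ball x d \<subseteq> B - (S - {x})" by (meson openE)
    have piece: "speed \<gamma> integrable_on {s..t}" if "s \<le> t" "{s..t} \<subseteq> ball x d" "{s..t} \<subseteq> {a..b}" "x \<notin> {s<..<t}" for s t
    proof (cases "s < t")
      case True
      have "{s<..<t} \<subseteq> {s..t}" by auto
      then have "S \<inter> {s<..<t} = {}" using that d(2) by blast
      then have "C1_path A s t \<gamma>" using True that by (intro S) auto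
      moreover have "\<gamma> ` {s..t} \<subseteq> chart_dom c" using that d(2) B(3) by blast
      ultimately show ?thesis by (rule speed_integrable_chart[OF _ c(1)])
    next
      case False
      then have "s = t" using that(1) by simp
      then show ?thesis using integrable_on_refl[of "speed \<gamma>" t] by simp
    qed
    show ?thesis
    proof (intro exI[of _ d] conjI allI impI d(1))
      fix u v assume uv: "x \<in> cbox u v \<and> cbox u v \<subseteq> ball x d \<and> cbox u v \<subseteq> cbox a b"
      then have uxv: "u \<le> x" "x \<le> v" by auto
      have "{u..x} \<subseteq> {u..v}" "{x..v} \<subseteq> {u..v}" using uxv by auto
      then have "speed \<gamma> integrable_on {u..x}" "speed \<gamma> integrable_on {x..v}"
        using uv uxv by (intro piece; auto)+
      then show "speed \<gamma> integrable_on cbox u v"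
        using Henstock_Kurzweil_Integration.integrable_combine[OF uxv] by simp
    qed
  qed
  then show ?thesis using integrable_on_little_subintervals[of a b "speed \<gamma>"] by simp
qed

text \<open>The speed is adjusted on a finite set, where \<open>speed\<close> may take junk (even negative) values.\<close>

lemma path_speed:
  assumes \<gamma>: "piecewise_C1_path A a b \<gamma>"
  obtains \<sigma> S where "finite S" "\<sigma> integrable_on {a..b}" "\<And>t. \<sigma> t \<ge> 0" "path_len A F a b \<gamma> = integral {a..b} \<sigma>"
    "\<And>t. t \<notin> {a<..<b} - S \<Longrightarrow> \<sigma> t = 0"
    "\<And>t c. \<lbrakk>t \<in> {a<..<b} - S; c \<in> A; \<gamma> t \<in> chart_dom c\<rbrakk> \<Longrightarrow>
      \<exists>D. (chart_map c \<circ> \<gamma> has_vector_derivative D) (at t) \<and> \<sigma> t = chart_norm c (\<gamma> t) D"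
proof -
  obtain S where S: "finite S" "\<And>s t. a \<le> s \<Longrightarrow> s < t \<Longrightarrow> t \<le> b \<Longrightarrow> S \<inter> {s<..<t} = {} \<Longrightarrow> C1_path A s t \<gamma>"
    using \<gamma> unfolding piecewise_C1_path_def by blast
  define \<sigma> where "\<sigma> t = (if t \<in> {a<..<b} - S then speed \<gamma> t else 0)" for t
  have good: "isCont \<gamma> t \<and> (\<forall>c\<in>A. \<gamma> t \<in> chart_dom c \<longrightarrow>
      (\<exists>D. (chart_map c \<circ> \<gamma> has_vector_derivative D) (at t) \<and> speed \<gamma> t = chart_norm c (\<gamma> t) D))"
    if t: "t \<in> {a<..<b} - S" for t
  proof -
    have "open ({a<..<b} - S)" using S by (intro open_Diff finite_imp_closed) auto
    then obtain d where d: "d > 0" "cball t d \<subseteq> {a<..<b} - S" using t open_contains_cball by blast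
    have sub: "{t - d..t + d} \<subseteq> {a<..<b} - S" using d by (simp add: cball_eq_atLeastAtMost)
    have "t - d \<in> {t - d..t + d}" "t + d \<in> {t - d..t + d}" "{t - d<..<t + d} \<subseteq> {t - d..t + d}"
      using d(1) by auto
    then have "t - d \<in> {a<..<b}" "t + d \<in> {a<..<b}" "S \<inter> {t - d<..<t + d} = {}" using sub by blast+
    then have "C1_path A (t - d) (t + d) \<gamma>" using d(1) by (intro S) auto
    note int = C1_path_interior[OF this, of t]
    show ?thesis using int d(1) speed_eq by (auto simp: algebra_simps) blast
  qed
  have pos: "\<sigma> t \<ge> 0" for t
  proof (cases "t \<in> {a<..<b} - S")
    case True
    obtain c where c: "c \<in> A" "\<gamma> t \<in> chart_dom c" by (rule atlas_cover)
    then obtain D where "speed \<gamma> t = chart_norm c (\<gamma> t) D" using good[OF True] by blast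
    then show ?thesis using is_normD(1)[OF chart_norm(1)[OF c], of D] by (simp add: \<sigma>_def)
  next
    case False
    then show ?thesis unfolding \<sigma>_def by (simp only: if_False)
  qed
  have neg: "finite (insert a (insert b S))" using S by simp
  have eq: "\<sigma> t = speed \<gamma> t" if "t \<in> {a..b} - insert a (insert b S)" for t using that by (auto simp: \<sigma>_def)
  show ?thesis
  proof (rule that[of S \<sigma>])
    show "\<sigma> integrable_on {a..b}"
      using integrable_spike_finite[OF neg eq speed_integrable[OF \<gamma>]] .
    show "path_len A F a b \<gamma> = integral {a..b} \<sigma>"
      unfolding path_len_speed by (rule integral_spike[OF negligible_finite[OF neg] eq])
    show "finite S" by (fact S)
    show "\<sigma> t \<ge> 0" for t by (rule pos)
  qed (use good in \<open>auto simp: \<sigma>_def\<close>)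
qed

end

section \<open>Reparametrising and joining paths\<close>

context Finsler_manifold
begin

text \<open>Slopes 1 and -1 cover what the metric needs: translating an interval before joining, and
  reversing. The velocity changes at most by a sign, which the norm does not see.\<close>

lemma piecewise_C1_path_affine:
  assumes \<gamma>: "piecewise_C1_path A a b \<gamma>" and ab: "a < b" and m: "\<bar>m\<bar> = 1"
    and img: "(\<lambda>\<tau>. m * \<tau> + k) ` {a'..b'} = {a..b}"
  shows "piecewise_C1_path A a' b' (\<lambda>\<tau>. \<gamma> (m * \<tau> + k))"
    and "path_len A F a' b' (\<lambda>\<tau>. \<gamma> (m * \<tau> + k)) = path_len A F a b \<gamma>"
proof -
  let ?f = "\<lambda>\<tau>. m * \<tau> + k"
  obtain S where S: "finite S" "\<And>s t. a \<le> s \<Longrightarrow> s < t \<Longrightarrow> t \<le> b \<Longrightarrow> S \<inter> {s<..<t} = {} \<Longrightarrow> C1_path A s t \<gamma>"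
    and cont: "continuous_on {a..b} \<gamma>"
    using \<gamma> unfolding piecewise_C1_path_def by blast
  have m1: "m = 1 \<or> m = -1" using m by linarith
  have mm: "m * (m * z) = z" for z :: real using m1 by auto
  have inj: "inj ?f" using m1 by (auto intro!: injI)
  have mem: "?f \<tau> \<in> {a..b} \<longleftrightarrow> \<tau> \<in> {a'..b'}" for \<tau>
    using img inj by (metis inj_image_mem_iff)
  show pw: "piecewise_C1_path A a' b' (\<lambda>\<tau>. \<gamma> (?f \<tau>))"
    unfolding piecewise_C1_path_def
  proof (intro conjI exI[of _ "?f -` S"] allI impI)
    show "continuous_on {a'..b'} (\<lambda>\<tau>. \<gamma> (?f \<tau>))"
      by (rule continuous_on_compose2[OF cont]) (use img in \<open>auto intro!: continuous_intros\<close>)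
    show "finite (?f -` S)" using S(1) inj by (rule finite_vimageI)
    fix s t assume st: "a' \<le> s \<and> s < t \<and> t \<le> b' \<and> ?f -` S \<inter> {s<..<t} = {}"
    then have ends: "?f s \<in> {a..b}" "?f t \<in> {a..b}" by (simp_all only: mem) auto
    from m1 show "C1_path A s t (\<lambda>\<tau>. \<gamma> (?f \<tau>))"
    proof
      assume [simp]: "m = 1"
      have "C1_path A (s + k) (t + k) \<gamma>"
      proof (rule S(2))
        show "S \<inter> {s + k<..<t + k} = {}"
        proof (rule equals0I)
          fix z assume "z \<in> S \<inter> {s + k<..<t + k}"
          then have "z - k \<in> ?f -` S \<inter> {s<..<t}" by auto
          then show False using st by blast
        qed
      qed (use st ends in auto)
      then show ?thesis by (rule C1_path_affine) auto
    next
      assume [simp]: "m = -1"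
      have "C1_path A (- t + k) (- s + k) \<gamma>"
      proof (rule S(2))
        show "S \<inter> {- t + k<..<- s + k} = {}"
        proof (rule equals0I)
          fix z assume "z \<in> S \<inter> {- t + k<..<- s + k}"
          then have "k - z \<in> ?f -` S \<inter> {s<..<t}" by auto
          then show False using st by blast
        qed
      qed (use st ends in auto)
      moreover have "?f ` {s..t} = {- t + k..- s + k}"
      proof (intro subset_antisym subsetI)
        fix z assume "z \<in> {- t + k..- s + k}"
        then show "z \<in> ?f ` {s..t}" by (intro image_eqI[of _ _ "k - z"]) auto
      qed auto
      ultimately show ?thesis by (rule C1_path_affine)
    qed
  qed
  obtain \<sigma> S1 where S1: "finite S1" and \<sigma>: "\<sigma> integrable_on {a..b}" "path_len A F a b \<gamma> = integral {a..b} \<sigma>"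
    and \<sigma>_eq: "\<And>t c. \<lbrakk>t \<in> {a<..<b} - S1; c \<in> A; \<gamma> t \<in> chart_dom c\<rbrakk> \<Longrightarrow>
      \<exists>D. (chart_map c \<circ> \<gamma> has_vector_derivative D) (at t) \<and> \<sigma> t = chart_norm c (\<gamma> t) D"
    by (rule path_speed[OF \<gamma>]) (rule that; assumption)
  obtain \<sigma>' S2 where S2: "finite S2" and \<sigma>': "\<sigma>' integrable_on {a'..b'}"
      "path_len A F a' b' (\<lambda>\<tau>. \<gamma> (?f \<tau>)) = integral {a'..b'} \<sigma>'"
    and \<sigma>'_eq: "\<And>t c. \<lbrakk>t \<in> {a'<..<b'} - S2; c \<in> A; \<gamma> (?f t) \<in> chart_dom c\<rbrakk> \<Longrightarrow>
      \<exists>D. (chart_map c \<circ> (\<lambda>\<tau>. \<gamma> (?f \<tau>)) has_vector_derivative D) (at t) \<and> \<sigma>' t = chart_norm c (\<gamma> (?f t)) D"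
    by (rule path_speed[OF pw]) (rule that; assumption)
  have "(\<sigma> has_integral integral {a..b} \<sigma>) (cbox a b)" using \<sigma>(1) by (simp add: integrable_integral)
  then have "((\<lambda>\<tau>. \<sigma> (m *\<^sub>R \<tau> + k)) has_integral (1 / \<bar>m\<bar> ^ DIM(real)) *\<^sub>R integral {a..b} \<sigma>)
      ((\<lambda>\<tau>. (1 / m) *\<^sub>R \<tau> + - ((1 / m) *\<^sub>R k)) ` cbox a b)"
    using m1 by (intro has_integral_affinity) auto
  moreover have "(\<lambda>\<tau>. (1 / m) *\<^sub>R \<tau> + - ((1 / m) *\<^sub>R k)) ` cbox a b = {a'..b'}"
  proof -
    have "(1 / m) *\<^sub>R ?f \<tau> + - ((1 / m) *\<^sub>R k) = \<tau>" for \<tau> using m1 by auto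
    then show ?thesis unfolding box_real img[symmetric] image_image by simp
  qed
  ultimately have "((\<lambda>\<tau>. \<sigma> (?f \<tau>)) has_integral integral {a..b} \<sigma>) {a'..b'}" using m by simp
  then have "integral {a'..b'} (\<lambda>\<tau>. \<sigma> (?f \<tau>)) = integral {a..b} \<sigma>" by (rule integral_unique)
  moreover have "integral {a'..b'} (\<lambda>\<tau>. \<sigma> (?f \<tau>)) = integral {a'..b'} \<sigma>'"
  proof (rule integral_spike)
    let ?N = "?f -` (insert a (insert b S1)) \<union> insert a' (insert b' S2)"
    show "negligible ?N"
      using S1 S2 inj by (intro negligible_finite finite_UnI finite_vimageI) auto
    fix t assume t: "t \<in> {a'..b'} - ?N"
    then have t1: "t \<in> {a'<..<b'} - S2" by auto
    have "?f t \<in> {a..b}" using t mem by blast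
    then have t2: "?f t \<in> {a<..<b} - S1" using t by auto
    obtain c where c: "c \<in> A" "\<gamma> (?f t) \<in> chart_dom c" by (rule atlas_cover)
    obtain D where D: "(chart_map c \<circ> \<gamma> has_vector_derivative D) (at (?f t))" "\<sigma> (?f t) = chart_norm c (\<gamma> (?f t)) D"
      using \<sigma>_eq[OF t2 c] by blast
    obtain D' where D': "(chart_map c \<circ> (\<lambda>\<tau>. \<gamma> (?f \<tau>)) has_vector_derivative D') (at t)"
        "\<sigma>' t = chart_norm c (\<gamma> (?f t)) D'"
      using \<sigma>'_eq[OF t1 c] by blast
    have "(?f has_vector_derivative m) (at t)"
      by (auto intro!: derivative_eq_intros simp: has_vector_derivative_def)
    then have "((chart_map c \<circ> \<gamma>) \<circ> ?f has_vector_derivative m *\<^sub>R D) (at t)"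
      using D(1) by (rule vector_diff_chain_at)
    then have "D' = m *\<^sub>R D"
      using D'(1) vector_derivative_unique_at by (fastforce simp: comp_def)
    then show "\<sigma>' t = \<sigma> (?f t)"
      using D(2) D'(2) m is_normD(3)[OF chart_norm(1)[OF c], of m D] by simp
  qed
  ultimately show "path_len A F a' b' (\<lambda>\<tau>. \<gamma> (?f \<tau>)) = path_len A F a b \<gamma>"
    using \<sigma>(2) \<sigma>'(2) by simp
qed

lemma piecewise_C1_path_reverse:
  assumes "piecewise_C1_path A a b \<gamma>" "a < b"
  shows "piecewise_C1_path A (- b) (- a) (\<lambda>\<tau>. \<gamma> (- \<tau>))"
    "path_len A F (- b) (- a) (\<lambda>\<tau>. \<gamma> (- \<tau>)) = path_len A F a b \<gamma>"
proof -
  have "(\<lambda>\<tau>. -1 * \<tau> + 0) ` {- b..- a} = {a..b}" by simp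
  from piecewise_C1_path_affine[OF assms _ this]
  show "piecewise_C1_path A (- b) (- a) (\<lambda>\<tau>. \<gamma> (- \<tau>))"
    "path_len A F (- b) (- a) (\<lambda>\<tau>. \<gamma> (- \<tau>)) = path_len A F a b \<gamma>" by simp_all
qed

lemma piecewise_C1_path_join:
  assumes \<gamma>1: "piecewise_C1_path A a b \<gamma>1" and \<gamma>2: "piecewise_C1_path A b c \<gamma>2"
    and abc: "a < b" "b < c" and eq: "\<gamma>1 b = \<gamma>2 b"
  defines "\<gamma> \<equiv> \<lambda>t. if t \<le> b then \<gamma>1 t else \<gamma>2 t"
  shows "piecewise_C1_path A a c \<gamma>"
    "path_len A F a c \<gamma> = path_len A F a b \<gamma>1 + path_len A F b c \<gamma>2"
proof -
  obtain S1 where S1: "finite S1" "\<And>s t. a \<le> s \<Longrightarrow> s < t \<Longrightarrow> t \<le> b \<Longrightarrow> S1 \<inter> {s<..<t} = {} \<Longrightarrow> C1_path A s t \<gamma>1"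
    and cont1: "continuous_on {a..b} \<gamma>1"
    using \<gamma>1 unfolding piecewise_C1_path_def by blast
  obtain S2 where S2: "finite S2" "\<And>s t. b \<le> s \<Longrightarrow> s < t \<Longrightarrow> t \<le> c \<Longrightarrow> S2 \<inter> {s<..<t} = {} \<Longrightarrow> C1_path A s t \<gamma>2"
    and cont2: "continuous_on {b..c} \<gamma>2"
    using \<gamma>2 unfolding piecewise_C1_path_def by blast
  have g1: "\<gamma>1 t = \<gamma> t" if "t \<le> b" for t using that by (simp add: \<gamma>_def)
  have g2: "\<gamma>2 t = \<gamma> t" if "b \<le> t" for t using that eq by (auto simp: \<gamma>_def)
  have "{a..c} = {a..b} \<union> {b..c}" using abc by auto
  moreover have "continuous_on {a..b} \<gamma>" using cont1 continuous_on_cong[OF refl g1, of "{a..b}"] by simp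
  moreover have "continuous_on {b..c} \<gamma>" using cont2 continuous_on_cong[OF refl g2, of "{b..c}"] by simp
  ultimately have cont: "continuous_on {a..c} \<gamma>" by (simp add: continuous_on_closed_Un)
  show pw: "piecewise_C1_path A a c \<gamma>"
    unfolding piecewise_C1_path_def
  proof (intro conjI cont exI[of _ "insert b (S1 \<union> S2)"] allI impI)
    show "finite (insert b (S1 \<union> S2))" using S1 S2 by simp
    fix s t assume st: "a \<le> s \<and> s < t \<and> t \<le> c \<and> insert b (S1 \<union> S2) \<inter> {s<..<t} = {}"
    then have "b \<notin> {s<..<t}" by blast
    then consider "t \<le> b" | "b \<le> s" by fastforce
    then show "C1_path A s t \<gamma>"
    proof cases
      case 1
      have "C1_path A s t \<gamma>1" by (rule S1(2)) (use st 1 in auto)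
      then show ?thesis by (rule C1_path_cong) (use 1 g1 in auto)
    next
      case 2
      have "C1_path A s t \<gamma>2" by (rule S2(2)) (use st 2 in auto)
      then show ?thesis by (rule C1_path_cong) (use 2 g2 in auto)
    qed
  qed
  have "integral {a..b} (speed \<gamma>) = integral {a..b} (speed \<gamma>1)"
  proof (rule integral_spike)
    show "negligible {a, b}" by (rule negligible_finite) auto
    fix t assume "t \<in> {a..b} - {a, b}"
    then show "speed \<gamma>1 t = speed \<gamma> t" by (intro speed_cong[of "{..<b}"] g1) auto
  qed
  moreover have "integral {b..c} (speed \<gamma>) = integral {b..c} (speed \<gamma>2)"
  proof (rule integral_spike)
    show "negligible {b, c}" by (rule negligible_finite) auto
    fix t assume "t \<in> {b..c} - {b, c}"
    then show "speed \<gamma>2 t = speed \<gamma> t" by (intro speed_cong[of "{b<..}"] g2) auto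
  qed
  moreover have "integral {a..b} (speed \<gamma>) + integral {b..c} (speed \<gamma>) = integral {a..c} (speed \<gamma>)"
    using abc by (intro Henstock_Kurzweil_Integration.integral_combine speed_integrable[OF pw]) auto
  ultimately show "path_len A F a c \<gamma> = path_len A F a b \<gamma>1 + path_len A F b c \<gamma>2"
    by (simp add: path_len_speed)
qed

text \<open>In the chart the path is a straight segment with constant velocity, run through in unit
  time, so a bound for the norm of that one vector along B bounds the length. K is quantified in the
  conclusion so that the path is chosen before the bound.\<close>

lemma segment_path:
  assumes c: "c \<in> A" and y: "y \<in> chart_dom c" and z: "z \<in> chart_dom c"
    and B: "open B" "convex B" "B \<subseteq> chart_map c ` chart_dom c" "chart_map c y \<in> B" "chart_map c z \<in> B"
  obtains \<gamma> where "piecewise_C1_path A 0 1 \<gamma>" "\<gamma> 0 = y" "\<gamma> 1 = z"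
    "\<And>K. \<lbrakk>\<And>w. w \<in> B \<Longrightarrow> chart_norm c (chart_inv c w) (chart_map c z - chart_map c y) \<le> K\<rbrakk> \<Longrightarrow> path_len A F 0 1 \<gamma> \<le> K"
proof -
  have ch: "is_chart c" using c atlas_is_chart by auto
  define e where "e = chart_map c z - chart_map c y"
  define l where "l t = chart_map c y + t *\<^sub>R e" for t
  define \<gamma> where "\<gamma> t = chart_inv c (l t)" for t
  have l_B: "l t \<in> B" if "t \<in> {0..1}" for t
  proof -
    have "l t = (1 - t) *\<^sub>R chart_map c y + t *\<^sub>R chart_map c z" by (simp add: l_def e_def algebra_simps)
    then show ?thesis using convexD_alt[OF B(2,4,5), of t] that by simp
  qed
  have l_deriv: "(l has_vector_derivative e) (at t within T)" for t T
    unfolding l_def by (auto intro!: derivative_eq_intros simp: has_vector_derivative_def)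
  have l_cont: "continuous_on T l" for T unfolding l_def by (intro continuous_intros)
  have C1: "C1_path A s t \<gamma>" if st: "0 \<le> s" "s < t" "t \<le> 1" for s t
    unfolding C1_path_def
  proof (intro conjI ballI)
    have B': "l ` {s..t} \<subseteq> B" using l_B st by auto
    show "continuous_on {s..t} \<gamma>"
      unfolding \<gamma>_def using B' B(3) by (intro continuous_on_compose2[OF is_chartD(4)[OF ch] l_cont]) blast
    fix c' assume c': "c' \<in> charts A"
    let ?V = "chart_map c ` (chart_dom c \<inter> chart_dom c')"
    obtain f' where f': "\<And>w. w \<in> ?V \<Longrightarrow> (chart_map c' \<circ> chart_inv c has_derivative blinfun_apply (f' w)) (at w)"
        "continuous_on ?V f'"
      using transition_C1(1)[OF c c'] by (rule C1_onE) blast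
    let ?T = "{\<tau> \<in> {s..t}. \<gamma> \<tau> \<in> chart_dom c'}"
    have lV: "l \<tau> \<in> ?V" if "\<tau> \<in> ?T" for \<tau>
    proof -
      have l: "l \<tau> \<in> chart_map c ` chart_dom c" using that B' B(3) by blast
      then have "chart_map c (\<gamma> \<tau>) = l \<tau>" "\<gamma> \<tau> \<in> chart_dom c"
        using is_chartD(6,7)[OF ch l] by (auto simp: \<gamma>_def)
      then show ?thesis using that by (metis (mono_tags, lifting) IntI image_eqI mem_Collect_eq)
    qed
    show "\<exists>D. (\<forall>\<tau>\<in>?T. (chart_map c' \<circ> \<gamma> has_vector_derivative D \<tau>) (at \<tau> within {s..t})) \<and> continuous_on ?T D"
    proof (intro exI conjI ballI)
      have "continuous_on ?T (\<lambda>\<tau>. f' (l \<tau>))"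
        using lV by (intro continuous_on_compose2[OF f'(2) l_cont]) blast
      then show "continuous_on ?T (\<lambda>\<tau>. f' (l \<tau>) e)" by (intro continuous_intros)
      fix \<tau> assume \<tau>: "\<tau> \<in> ?T"
      have "((chart_map c' \<circ> chart_inv c) \<circ> l has_vector_derivative f' (l \<tau>) e) (at \<tau> within {s..t})"
        using f'(1)[OF lV[OF \<tau>]] by (intro vector_derivative_diff_chain_within[OF l_deriv]) (rule has_derivative_at_withinI)
      then show "(chart_map c' \<circ> \<gamma> has_vector_derivative f' (l \<tau>) e) (at \<tau> within {s..t})"
        by (simp add: comp_def \<gamma>_def)
    qed
  qed
  have pw: "piecewise_C1_path A 0 1 \<gamma>"
    unfolding piecewise_C1_path_def
  proof (intro conjI exI[of _ "{}"] allI impI)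
    show "continuous_on {0..1} \<gamma>" using C1[of 0 1] by (simp add: C1_path_def)
  qed (use C1 in auto)
  show ?thesis
  proof (rule that[OF pw])
    show "\<gamma> 0 = y" "\<gamma> 1 = z" using is_chartD(5)[OF ch] y z by (simp_all add: \<gamma>_def l_def e_def)
    fix K assume K: "\<And>w. w \<in> B \<Longrightarrow> chart_norm c (chart_inv c w) (chart_map c z - chart_map c y) \<le> K"
    have K0: "K \<ge> 0"
      using order_trans[OF is_normD(1)[OF chart_norm(1)[OF c y]] K[OF B(4), unfolded is_chartD(5)[OF ch y]]] .
    obtain \<sigma> S where \<sigma>: "\<sigma> integrable_on {0..1}" "path_len A F 0 1 \<gamma> = integral {0..1} \<sigma>"
      and \<sigma>0: "\<And>t. t \<notin> {0<..<1} - S \<Longrightarrow> \<sigma> t = 0"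
      and \<sigma>_eq: "\<And>t c. \<lbrakk>t \<in> {0<..<1} - S; c \<in> A; \<gamma> t \<in> chart_dom c\<rbrakk> \<Longrightarrow>
        \<exists>D. (chart_map c \<circ> \<gamma> has_vector_derivative D) (at t) \<and> \<sigma> t = chart_norm c (\<gamma> t) D"
      by (rule path_speed[OF pw]) (rule that; assumption)
    have "\<sigma> t \<le> K" for t
    proof (cases "t \<in> {0<..<1} - S")
      case True
      then have lt: "l t \<in> B" by (intro l_B) auto
      then have dom: "\<gamma> t \<in> chart_dom c" using B(3) is_chartD(7)[OF ch] unfolding \<gamma>_def by blast
      obtain D where D: "(chart_map c \<circ> \<gamma> has_vector_derivative D) (at t)" "\<sigma> t = chart_norm c (\<gamma> t) D"
        using \<sigma>_eq[OF True c dom] by blast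
      have "(chart_map c \<circ> \<gamma> has_vector_derivative e) (at t)"
      proof (rule has_vector_derivative_transform_within_open[OF l_deriv[of t UNIV]])
        show "open {0<..<1::real}" "t \<in> {0<..<1}" using True by auto
        fix s :: real assume "s \<in> {0<..<1}"
        then have "l s \<in> chart_map c ` chart_dom c" using l_B[of s] B(3) by auto
        then show "l s = (chart_map c \<circ> \<gamma>) s" using is_chartD(6)[OF ch] by (simp add: \<gamma>_def)
      qed
      then have "D = e" using D(1) vector_derivative_unique_at by blast
      then show ?thesis using D(2) K[OF lt] by (simp add: e_def \<gamma>_def)
    next
      case False
      then show ?thesis using \<sigma>0 K0 by simp
    qed
    then have "integral {0..1} \<sigma> \<le> integral {0..1} (\<lambda>t::real. K)"
      by (intro integral_le \<sigma>(1)) auto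
    then show "path_len A F 0 1 \<gamma> \<le> K" using \<sigma>(2) by simp
  qed
qed

end

section \<open>The Finsler metric\<close>

context Finsler_manifold
begin

abbreviation d :: "'m \<Rightarrow> 'm \<Rightarrow> real" where
  "d \<equiv> Finsler_dist A F"

definition lens :: "'m \<Rightarrow> 'm \<Rightarrow> real set" where
  "lens p q = {path_len A F a b \<gamma> | a b \<gamma>. a < b \<and> piecewise_C1_path A a b \<gamma> \<and> \<gamma> a = p \<and> \<gamma> b = q}"

lemma d_eq: "d p q = Inf (lens p q)"
  by (simp add: Finsler_dist_def lens_def)

lemma lensE:
  assumes "l \<in> lens p q"
  obtains a b \<gamma> where "a < b" "piecewise_C1_path A a b \<gamma>" "\<gamma> a = p" "\<gamma> b = q" "l = path_len A F a b \<gamma>"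
  using assms unfolding lens_def by blast

lemma lensI:
  "\<lbrakk>a < b; piecewise_C1_path A a b \<gamma>; \<gamma> a = p; \<gamma> b = q\<rbrakk> \<Longrightarrow> path_len A F a b \<gamma> \<in> lens p q"
  unfolding lens_def by blast

lemma lens_nonneg: "l \<in> lens p q \<Longrightarrow> 0 \<le> l"
  by (elim lensE, erule path_speed) (auto intro!: integral_nonneg)

lemma bdd_lens: "bdd_below (lens p q)"
  using lens_nonneg by (auto intro!: bdd_belowI)

lemma lens_reverse:
  assumes "l \<in> lens p q"
  shows "l \<in> lens q p"
proof -
  obtain a b \<gamma> where \<gamma>: "a < b" "piecewise_C1_path A a b \<gamma>" "\<gamma> a = p" "\<gamma> b = q" "l = path_len A F a b \<gamma>"
    using assms by (rule lensE)
  have "path_len A F (- b) (- a) (\<lambda>\<tau>. \<gamma> (- \<tau>)) \<in> lens q p"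
    by (rule lensI[OF _ piecewise_C1_path_reverse(1)]) (use \<gamma> in auto)
  then show ?thesis using piecewise_C1_path_reverse(2)[OF \<gamma>(2,1)] \<gamma>(5) by simp
qed

lemma lens_add:
  assumes "l \<in> lens p q" "l' \<in> lens q s"
  shows "l + l' \<in> lens p s"
proof -
  obtain a b \<gamma> where \<gamma>: "a < b" "piecewise_C1_path A a b \<gamma>" "\<gamma> a = p" "\<gamma> b = q" "l = path_len A F a b \<gamma>"
    using assms(1) by (rule lensE)
  obtain a' b' \<gamma>' where \<gamma>': "a' < b'" "piecewise_C1_path A a' b' \<gamma>'" "\<gamma>' a' = q" "\<gamma>' b' = s" "l' = path_len A F a' b' \<gamma>'"
    using assms(2) by (rule lensE)
  let ?\<gamma>' = "\<lambda>\<tau>. \<gamma>' (1 * \<tau> + (a' - b))" and ?c = "b' + b - a'"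
  have img: "(\<lambda>\<tau>. 1 * \<tau> + (a' - b)) ` {b..?c} = {a'..b'}" by simp
  note sh = piecewise_C1_path_affine[OF \<gamma>'(2,1) abs_one img]
  note j = piecewise_C1_path_join[OF \<gamma>(2) sh(1) \<gamma>(1)]
  have "path_len A F a ?c (\<lambda>t. if t \<le> b then \<gamma> t else ?\<gamma>' t) \<in> lens p s"
    by (rule lensI[OF _ j(1)]) (use \<gamma> \<gamma>' in auto)
  moreover have "path_len A F a ?c (\<lambda>t. if t \<le> b then \<gamma> t else ?\<gamma>' t) = l + l'"
    by (subst j(2)) (use \<gamma> \<gamma>' sh(2) in auto)
  ultimately show ?thesis by simp
qed

lemma lens_chart:
  assumes c: "c \<in> A" and y: "y \<in> chart_dom c" and z: "z \<in> chart_dom c"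
    and B: "open B" "convex B" "B \<subseteq> chart_map c ` chart_dom c" "chart_map c y \<in> B" "chart_map c z \<in> B"
  shows "lens y z \<noteq> {}"
    and "(\<And>w. w \<in> B \<Longrightarrow> chart_norm c (chart_inv c w) (chart_map c z - chart_map c y) \<le> K) \<Longrightarrow> d y z \<le> K"
proof -
  obtain \<gamma> where \<gamma>: "piecewise_C1_path A 0 1 \<gamma>" "\<gamma> 0 = y" "\<gamma> 1 = z"
    "\<And>K. \<lbrakk>\<And>w. w \<in> B \<Longrightarrow> chart_norm c (chart_inv c w) (chart_map c z - chart_map c y) \<le> K\<rbrakk> \<Longrightarrow> path_len A F 0 1 \<gamma> \<le> K"
    by (rule segment_path[OF assms]) blast
  have mem: "path_len A F 0 1 \<gamma> \<in> lens y z" by (rule lensI[OF _ \<gamma>(1-3)]) simp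
  then show "lens y z \<noteq> {}" by auto
  assume "\<And>w. w \<in> B \<Longrightarrow> chart_norm c (chart_inv c w) (chart_map c z - chart_map c y) \<le> K"
  then show "d y z \<le> K"
    unfolding d_eq using cInf_lower[OF mem bdd_lens] \<gamma>(4) order_trans by blast
qed

lemma chart_ball:
  assumes c: "c \<in> A" and x: "x \<in> chart_dom c" and W: "open W" "x \<in> W"
  obtains r where "r > 0" "ball (chart_map c x) r \<subseteq> chart_map c ` chart_dom c"
    "\<And>w. w \<in> ball (chart_map c x) r \<Longrightarrow> chart_inv c w \<in> W"
proof -
  obtain r where "r > 0" "cball (chart_map c x) r \<subseteq> chart_map c ` chart_dom c"
    "chart_inv c ` cball (chart_map c x) r \<subseteq> W"
    by (rule closed_chart_ball[OF assms]) blast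
  then show ?thesis by (intro that[of r]) (auto simp: subset_iff image_subset_iff)
qed

text \<open>Being joined by a path is an equivalence relation, by reversal and concatenation, and
  its classes are neighbourhoods of their points, by segments in charts; connectedness leaves one
  class. Without this \<open>d\<close> could be an infimum of the empty set.\<close>

lemma lens_nonempty: "lens p q \<noteq> {}"
proof -
  have conn: "connected (UNIV :: 'm set)"
    using Finsler[unfolded C1_Finsler_manifold_def] by (rule conjunct1)
  show ?thesis
  proof (rule connected_equivalence_relation[OF conn UNIV_I UNIV_I, where R = "\<lambda>p q. lens p q \<noteq> {}"])
    show "lens y x \<noteq> {}" if "lens x y \<noteq> {}" for x y using that lens_reverse by blast
    show "lens x z \<noteq> {}" if "lens x y \<noteq> {}" "lens y z \<noteq> {}" for x y z
      using that lens_add by blast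
    fix x :: 'm
    obtain c where c: "c \<in> A" "x \<in> chart_dom c" by (rule atlas_cover)
    have ch: "is_chart c" using c atlas_is_chart by auto
    obtain r where r: "r > 0" "ball (chart_map c x) r \<subseteq> chart_map c ` chart_dom c"
      by (rule chart_ball[OF c open_UNIV UNIV_I])
    let ?T = "chart_dom c \<inter> chart_map c -` ball (chart_map c x) r"
    have "open ?T" by (intro continuous_open_preimage is_chartD[OF ch] open_ball)
    moreover have "x \<in> ?T" using c r by simp
    moreover have "lens x y \<noteq> {}" if "y \<in> ?T" for y
      using that r c by (intro lens_chart(1)[OF c(1), of x y "ball (chart_map c x) r"]) auto
    ultimately show "\<exists>T. openin (top_of_set UNIV) T \<and> x \<in> T \<and> (\<forall>y\<in>T. lens x y \<noteq> {})"
      by auto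
  qed
qed

lemma d_nonneg: "0 \<le> d p q"
  unfolding d_eq using lens_nonempty lens_nonneg by (intro cInf_greatest)

lemma d_commute: "d p q = d q p"
proof -
  have "lens p q = lens q p" using lens_reverse by blast
  then show ?thesis by (simp add: d_eq)
qed

lemma d_triangle: "d p s \<le> d p q + d q s"
proof -
  have "d p s - l \<le> d q s" if l: "l \<in> lens p q" for l
    unfolding d_eq[of q s]
  proof (rule cInf_greatest[OF lens_nonempty])
    fix l' assume "l' \<in> lens q s"
    then have "d p s \<le> l + l'" unfolding d_eq by (intro cInf_lower bdd_lens lens_add[OF l])
    then show "d p s - l \<le> l'" by simp
  qed
  then have "d p s - d q s \<le> d p q"
    unfolding d_eq[of p q] by (intro cInf_greatest[OF lens_nonempty]) (simp add: algebra_simps)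
  then show ?thesis by simp
qed

text \<open>A path leaving a chart ball has, up to its exit time, at least the length needed to reach the
  boundary sphere in the chart.\<close>

lemma d_lower_bound:
  assumes c: "c \<in> A" and x: "x \<in> chart_dom c" and r: "r > 0" and m: "m > 0"
    and ball: "cball (chart_map c x) r \<subseteq> chart_map c ` chart_dom c"
    and closed: "closed (chart_inv c ` cball (chart_map c x) r)"
    and le: "\<And>w v. w \<in> cball (chart_map c x) r \<Longrightarrow> m * norm v \<le> chart_norm c (chart_inv c w) v"
    and y: "y \<notin> chart_inv c ` ball (chart_map c x) r"
  shows "m * r \<le> d x y"
  unfolding d_eq
proof (rule cInf_greatest[OF lens_nonempty])
  fix l assume "l \<in> lens x y"
  then obtain a b \<gamma> where ab: "a < b" and pw: "piecewise_C1_path A a b \<gamma>" and ends: "\<gamma> a = x" "\<gamma> b = y"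
    and l: "l = path_len A F a b \<gamma>" by (rule lensE)
  have ch: "is_chart c" using c atlas_is_chart by auto
  let ?\<phi> = "chart_map c"
  define V where "V = chart_dom c \<inter> ?\<phi> -` ball (?\<phi> x) r"
  define K where "K = chart_inv c ` cball (?\<phi> x) r"
  have V_open: "open V" unfolding V_def by (intro continuous_open_preimage is_chartD[OF ch] open_ball)
  have V_K: "V \<subseteq> K"
  proof
    fix y assume "y \<in> V"
    then have "y = chart_inv c (?\<phi> y)" "?\<phi> y \<in> cball (?\<phi> x) r" using is_chartD(5)[OF ch] by (auto simp: V_def)
    then show "y \<in> K" unfolding K_def by blast
  qed
  have K_dom: "y \<in> chart_dom c \<and> ?\<phi> y \<in> cball (?\<phi> x) r" if "y \<in> K" for y
  proof -
    obtain w where w: "w \<in> cball (?\<phi> x) r" "y = chart_inv c w" using \<open>y \<in> K\<close> by (auto simp: K_def)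
    then have "w \<in> ?\<phi> ` chart_dom c" using ball by blast
    then show ?thesis using is_chartD(6,7)[OF ch] w by simp
  qed
  have "x \<in> V" using x r by (simp add: V_def)
  have "y \<notin> V"
  proof
    assume "y \<in> V"
    then have "y = chart_inv c (?\<phi> y)" "?\<phi> y \<in> ball (?\<phi> x) r" using is_chartD(5)[OF ch] by (auto simp: V_def)
    then show False using y by blast
  qed
  have cont: "continuous_on {a..b} \<gamma>" using pw by (simp add: piecewise_C1_path_def)
  \<comment> \<open>The parameters at which the path is outside the open chart ball; the least
    element of this compact set is the exit time.\<close>
  define T where "T = {a..b} \<inter> \<gamma> -` (- V)"
  have compT: "compact T"
    unfolding T_def compact_eq_bounded_closed using V_open
    by (intro conjI continuous_closed_preimage[OF cont] closed_Compl bounded_Int) auto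
  have "b \<in> T" using ab ends \<open>y \<notin> V\<close> by (simp add: T_def)
  then have "T \<noteq> {}" by auto
  from compact_attains_inf[OF compT this] obtain t where t: "t \<in> T" "\<And>s. s \<in> T \<Longrightarrow> t \<le> s" by auto
  have tab: "a < t" "t \<le> b" "\<gamma> t \<notin> V"
  proof -
    show "t \<le> b" "\<gamma> t \<notin> V" using t(1) by (auto simp: T_def)
    then have "t \<noteq> a" using ends \<open>x \<in> V\<close> by auto
    then show "a < t" using t(1) by (auto simp: T_def)
  qed
  have before: "\<gamma> s \<in> V" if "a \<le> s" "s < t" for s
    using t(2)[of s] that tab by (auto simp: T_def)
  \<comment> \<open>Before t the path lies in K. As K is closed in M, the exit point lies in K as
    well, hence in the chart domain, and its image is on the boundary sphere.\<close>
  have "continuous_on {a..t} \<gamma>" by (rule continuous_on_subset[OF cont]) (use tab in auto)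
  moreover have "closure {a..<t} = {a..t}" using tab by simp
  moreover have "\<gamma> ` {a..<t} \<subseteq> K" using before V_K by auto
  ultimately have "\<gamma> ` {a..t} \<subseteq> K"
    using image_closure_subset[of "{a..<t}" \<gamma> K] closed unfolding K_def by simp
  then have inK: "\<gamma> s \<in> K" if "s \<in> {a..t}" for s using that by blast
  have far: "r \<le> norm (?\<phi> (\<gamma> t) - ?\<phi> x)"
    using K_dom[OF inK[of t]] tab by (auto simp: V_def dist_norm norm_minus_commute)
  obtain \<sigma> S where S: "finite S" and \<sigma>: "\<sigma> integrable_on {a..b}" "\<And>t. \<sigma> t \<ge> 0" "path_len A F a b \<gamma> = integral {a..b} \<sigma>"
    and \<sigma>_eq: "\<And>t c. \<lbrakk>t \<in> {a<..<b} - S; c \<in> A; \<gamma> t \<in> chart_dom c\<rbrakk> \<Longrightarrow>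
        \<exists>D. (chart_map c \<circ> \<gamma> has_vector_derivative D) (at t) \<and> \<sigma> t = chart_norm c (\<gamma> t) D"
    by (rule path_speed[OF pw]) (rule that; assumption)
  \<comment> \<open>Set to 0 at the break points; the fundamental theorem admits finitely many
    exceptional points for a continuous function.\<close>
  define f' where "f' s = (if s \<in> {a<..<t} - S then vector_derivative (?\<phi> \<circ> \<gamma>) (at s) else 0)" for s
  have f': "(?\<phi> \<circ> \<gamma> has_vector_derivative f' s) (at s) \<and> m * norm (f' s) \<le> \<sigma> s" if s: "s \<in> {a<..<t} - S" for s
  proof -
    have sab: "s \<in> {a<..<b} - S" using s tab by auto
    have sK: "\<gamma> s \<in> K" using s by (intro inK) auto
    obtain D where D: "(?\<phi> \<circ> \<gamma> has_vector_derivative D) (at s)" "\<sigma> s = chart_norm c (\<gamma> s) D"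
      using \<sigma>_eq[OF sab c] K_dom[OF sK] by blast
    have "f' s = D" using D(1) s by (simp add: f'_def vector_derivative_at)
    moreover have "chart_inv c (?\<phi> (\<gamma> s)) = \<gamma> s" using K_dom[OF sK] is_chartD(5)[OF ch] by blast
    ultimately show ?thesis using D le[of "?\<phi> (\<gamma> s)" D] K_dom[OF sK] by simp
  qed
  have f'_le: "norm (f' s) \<le> \<sigma> s / m" for s
  proof (cases "s \<in> {a<..<t} - S")
    case True
    then show ?thesis using f' m by (simp add: pos_le_divide_eq mult.commute)
  next
    case False
    then show ?thesis using \<sigma>(2)[of s] m by (auto simp: f'_def)
  qed
  have cont_chart: "continuous_on {a..t} (?\<phi> \<circ> \<gamma>)"
    using K_dom inK by (intro continuous_on_compose \<open>continuous_on {a..t} \<gamma>\<close> continuous_on_subset[OF is_chartD(3)[OF ch]]) blast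
  have FTC: "(f' has_integral ((?\<phi> \<circ> \<gamma>) t - (?\<phi> \<circ> \<gamma>) a)) {a..t}"
    by (rule fundamental_theorem_of_calculus_interior_strong[OF S less_imp_le[OF tab(1)] conjunct1[OF f'] cont_chart])
  have \<sigma>t: "\<sigma> integrable_on {a..t}"
    by (rule integrable_on_subinterval[OF \<sigma>(1)]) (use tab in auto)
  have "norm (integral {a..t} f') \<le> integral {a..t} (\<lambda>s. \<sigma> s / m)"
    using FTC \<sigma>t f'_le by (intro Henstock_Kurzweil_Integration.integral_norm_bound_integral) (auto intro: integrable_on_divide)
  then have "r \<le> integral {a..t} \<sigma> / m"
    using far integral_unique[OF FTC] ends by simp
  then have "m * r \<le> integral {a..t} \<sigma>" using m by (simp add: pos_le_divide_eq mult.commute)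
  also have "\<dots> \<le> integral {a..b} \<sigma>"
    by (rule integral_subset_le[OF _ \<sigma>t \<sigma>(1)]) (use tab \<sigma>(2) in auto)
  finally show "m * r \<le> l" using l \<sigma>(3) by simp
qed

text \<open>On a small chart ball (P2) keeps the norms above half of the norm at x, hence above k/2
  times the model norm, so leaving the ball costs length at least k/2 times r. This yields
  definiteness of \<open>d\<close> and lets topological semicontinuity act on sequences converging
  in \<open>d\<close>.\<close>

lemma d_neighbourhood:
  assumes W: "open W" "x \<in> W"
  obtains e where "e > 0" "\<And>y. d x y < e \<Longrightarrow> y \<in> W"
proof -
  obtain c where c: "c \<in> A" "x \<in> chart_dom c" by (rule atlas_cover)
  obtain U where U: "open U" "x \<in> U" "\<And>y v. y \<in> U \<Longrightarrow> chart_norm c x v \<le> (1 + 1) * chart_norm c y v"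
    by (rule chart_norm_close[OF c zero_less_one]) blast
  obtain r where r: "r > 0" "cball (chart_map c x) r \<subseteq> chart_map c ` chart_dom c"
    "chart_inv c ` cball (chart_map c x) r \<subseteq> W \<inter> U"
    "\<And>s. s \<le> r \<Longrightarrow> closed (chart_inv c ` cball (chart_map c x) s)"
    by (rule closed_chart_ball[OF c, of "W \<inter> U"]) (use W U in auto)
  obtain k where k: "k > 0" "\<And>v. k * norm v \<le> chart_norm c x v"
    using chart_norm(2)[OF c] by (auto simp: equivalent_to_norm_def)
  show ?thesis
  proof (rule that[of "k / 2 * r"])
    show "k / 2 * r > 0" using k r by simp
    fix y assume dy: "d x y < k / 2 * r"
    show "y \<in> W"
    proof (rule ccontr)
      assume "y \<notin> W"
      then have y: "y \<notin> chart_inv c ` ball (chart_map c x) r"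
        using r(3) ball_subset_cball by blast
      have "k / 2 * norm v \<le> chart_norm c (chart_inv c w) v" if "w \<in> cball (chart_map c x) r" for w v
        using U(3)[of "chart_inv c w" v] k(2)[of v] r(3) that by fastforce
      from d_lower_bound[OF c r(1) _ r(2) r(4)[OF order_refl] this y] have "k / 2 * r \<le> d x y"
        using k(1) by simp
      then show False using dy by simp
    qed
  qed
qed

lemma d_zero_iff: "d x y = 0 \<longleftrightarrow> x = y"
proof
  assume "d x y = 0"
  show "x = y"
  proof (rule ccontr)
    assume "x \<noteq> y"
    then obtain e where e: "e > 0" "\<And>z. d x z < e \<Longrightarrow> z \<in> - {y}"
      using d_neighbourhood[of "- {y}" x] by auto
    show False using e(2)[of y] e(1) \<open>d x y = 0\<close> by simp
  qed
next
  assume "x = y"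
  obtain c where c: "c \<in> A" "x \<in> chart_dom c" by (rule atlas_cover)
  obtain r where r: "r > 0" "ball (chart_map c x) r \<subseteq> chart_map c ` chart_dom c"
    by (rule chart_ball[OF c open_UNIV UNIV_I])
  have "d x x \<le> 0"
  proof (rule lens_chart(2)[OF c c(2), of "ball (chart_map c x) r"])
    fix w assume "w \<in> ball (chart_map c x) r"
    then have "chart_inv c w \<in> chart_dom c" using r(2) is_chartD(7) atlas_is_chart c by blast
    then show "chart_norm c (chart_inv c w) (chart_map c x - chart_map c x) \<le> 0"
      using is_normD(2)[OF chart_norm(1)[OF c(1)]] by simp
  qed (use r in auto)
  then show "d x y = 0" using d_nonneg[of x x] \<open>x = y\<close> by simp
qed

lemma Metric_space_d: "Metric_space UNIV d"
  by (rule Metric_space.intro, rule d_nonneg, rule d_commute, rule d_zero_iff, rule d_triangle)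

text \<open>Balls of the model space are convex, so the segment from y to z stays where K controls
  the norms.\<close>

lemma d_chart_le:
  assumes c: "c \<in> A" and x: "x \<in> chart_dom c" and B: "ball (chart_map c x) r \<subseteq> chart_map c ` chart_dom c"
    and K: "\<And>w v. w \<in> ball (chart_map c x) r \<Longrightarrow> chart_norm c (chart_inv c w) v \<le> K * chart_norm c x v"
    and yz: "y \<in> ball (chart_map c x) r" "z \<in> ball (chart_map c x) r"
  shows "d (chart_inv c y) (chart_inv c z) \<le> K * chart_norm c x (z - y)"
proof -
  have ch: "is_chart c" using c atlas_is_chart by auto
  have img: "y \<in> chart_map c ` chart_dom c" "z \<in> chart_map c ` chart_dom c" using yz B by auto
  note inv = is_chartD(6,7)[OF ch img(1)] is_chartD(6,7)[OF ch img(2)]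
  show ?thesis
    by (rule lens_chart(2)[OF c inv(2,4), of "ball (chart_map c x) r"]) (use inv B yz K in auto)
qed

end

section \<open>Comparison of viscosity sub- and supersolutions\<close>

context Finsler_manifold
begin

text \<open>Only the germ of h at z matters for a local minimum and for the differential, and
  \<open>extend_test_function\<close> realises this germ by a C1 function on M.\<close>

lemma lift_test_function:
  fixes h :: "'x \<Rightarrow> real"
  assumes bump: "\<exists>b :: 'x \<Rightarrow> real. C1_Lipschitz_bump b"
    and c: "c \<in> A" and z: "z \<in> chart_map c ` chart_dom c"
    and h: "C1_on UNIV h" "(h has_derivative D) (at z)"
    and min: "\<forall>\<^sub>F w in nhds z. f (chart_inv c z) - h z \<le> f (chart_inv c w) - h w"
  obtains g where "C1_fun A g" "\<forall>\<^sub>F y in nhds (chart_inv c z). f (chart_inv c z) - g (chart_inv c z) \<le> f y - g y"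
    "\<And>v. differential A g (chart_inv c z) (tangent_vec A c (chart_inv c z) v) = D v"
proof -
  have ch: "is_chart c" using c atlas_is_chart by auto
  let ?x = "chart_inv c z"
  have x: "?x \<in> chart_dom c" and cx: "chart_map c ?x = z" using is_chartD(6,7)[OF ch z] by auto
  obtain g where g: "C1_fun A g" and gh: "\<forall>\<^sub>F y in nhds ?x. g y = h (chart_map c y)"
    by (rule extend_test_function[OF bump c x h(1)])
  have gx: "g ?x = h z" using eventually_nhds_x_imp_x[OF gh] cx by simp
  show ?thesis
  proof (rule that[OF g])
    have lim: "filterlim (chart_map c) (nhds z) (nhds ?x)" using tendsto_chart_map[OF ch x] cx by simp
    have "\<forall>\<^sub>F y in nhds ?x. y \<in> chart_dom c" using is_chartD(1)[OF ch] x by (rule eventually_nhds_in_open)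
    with eventually_compose_filterlim[OF min lim] gh
    show "\<forall>\<^sub>F y in nhds ?x. f ?x - g ?x \<le> f y - g y"
      by eventually_elim (simp add: gx is_chartD(5)[OF ch])
    have "filterlim (chart_inv c) (nhds ?x) (nhds z)" using tendsto_chart_inv[OF ch x] cx by simp
    from eventually_compose_filterlim[OF gh this] eventually_nhds_in_open[OF is_chartD(2)[OF ch] z]
    have "\<forall>\<^sub>F w in nhds z. h w = (g \<circ> chart_inv c) w"
      by eventually_elim (simp add: is_chartD(6)[OF ch])
    then obtain U where "open U" "z \<in> U" "\<And>w. w \<in> U \<Longrightarrow> h w = (g \<circ> chart_inv c) w"
      by (auto simp: eventually_nhds)
    then have "(g \<circ> chart_inv c has_derivative D) (at (chart_map c ?x))"
      unfolding cx using h(2) by (intro has_derivative_transform_within_open[OF h(2)])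
    then show "differential A g ?x (tangent_vec A c ?x v) = D v" for v
      by (rule differential_eq[OF g c x])
  qed
qed

lemma C1_fun_uminus:
  assumes "C1_fun A g"
  shows "C1_fun A (\<lambda>x. - g x)"
  unfolding C1_fun_def
proof
  fix c assume "c \<in> charts A"
  then have "C1_on (chart_map c ` chart_dom c) (g \<circ> chart_inv c)" using assms by (simp add: C1_fun_def)
  then have "C1_on (chart_map c ` chart_dom c) (\<lambda>x. (-1) * (g \<circ> chart_inv c) x)"
    by (intro C1_on_mult C1_on_const)
  then show "C1_on (chart_map c ` chart_dom c) ((\<lambda>x. - g x) \<circ> chart_inv c)" by (simp add: comp_def)
qed

text \<open>If g touches -u from below, then -g touches u from above. The equation sees
  differentials only through their norm, so u can be treated through minima of -u.\<close>

lemma dual_norm_differential_uminus: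
  assumes g: "C1_fun A g"
  shows "dual_norm A F x (differential A (\<lambda>x. - g x) x) = dual_norm A F x (differential A g x)"
proof -
  obtain c where c: "c \<in> A" "x \<in> chart_dom c" by (rule atlas_cover)
  have "C1_on (chart_map c ` chart_dom c) (g \<circ> chart_inv c)" using g atlas_charts[OF c(1)] by (simp add: C1_fun_def)
  then obtain D where D: "(g \<circ> chart_inv c has_derivative D) (at (chart_map c x))"
    using C1_on_frechet c(2) by blast
  have "((\<lambda>x. - g x) \<circ> chart_inv c has_derivative (\<lambda>v. - D v)) (at (chart_map c x))"
    using has_derivative_minus[OF D] by (simp add: comp_def)
  then have "differential A (\<lambda>x. - g x) x (tangent_vec A c x v) = - differential A g x (tangent_vec A c x v)" for v
    using differential_eq[OF g c D] differential_eq[OF C1_fun_uminus[OF g] c] by simp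
  then have "\<bar>differential A (\<lambda>x. - g x) x \<xi>\<bar> = \<bar>differential A g x \<xi>\<bar>" if "\<xi> \<in> tangent_space A x" for \<xi>
    using that unfolding tangent_space_eq[OF c] by auto
  then have "{\<bar>differential A (\<lambda>x. - g x) x \<xi>\<bar> |\<xi>. \<xi> \<in> tangent_space A x \<and> F x \<xi> = 1} =
      {\<bar>differential A g x \<xi>\<bar> |\<xi>. \<xi> \<in> tangent_space A x \<and> F x \<xi> = 1}"
    by (intro Collect_cong) metis
  then show ?thesis unfolding dual_norm_def by (simp only:)
qed

text \<open>p1 is almost -p2 when measured in the fixed norm N; going from N to the norms at x1 and
  x2 costs a factor 1 + s each. This relative error becomes absolute through the a priori bound T on
  both dual norms, to which s is adapted.\<close>

lemma dual_norm_diff_le: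
  fixes p1 p2 :: "'x \<Rightarrow>\<^sub>L real"
  assumes c: "c \<in> A" "x1 \<in> chart_dom c" "x2 \<in> chart_dom c"
    and \<Delta>1: "\<And>v. \<Delta>1 (tangent_vec A c x1 v) = p1 v" and \<Delta>2: "\<And>v. \<Delta>2 (tangent_vec A c x2 v) = p2 v"
    and s: "0 < s" "s \<le> 1/6" "3 * s * T \<le> e" and e: "e > 0"
    and close1: "\<And>v. N v \<le> (1 + s) * chart_norm c x1 v" "\<And>v. chart_norm c x1 v \<le> (1 + s) * N v"
    and close2: "\<And>v. N v \<le> (1 + s) * chart_norm c x2 v" "\<And>v. chart_norm c x2 v \<le> (1 + s) * N v"
    and p: "\<And>v. \<bar>p1 v\<bar> \<le> K * N v" "\<And>v. \<bar>p2 v\<bar> \<le> K * N v" "\<And>v. \<bar>p1 v + p2 v\<bar> \<le> 6 * e * N v"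
    and K: "K \<ge> 0" "2 * K \<le> T"
  shows "dual_norm A F x1 \<Delta>1 - dual_norm A F x2 \<Delta>2 \<le> 8 * e" "0 \<le> dual_norm A F x1 \<Delta>1" "dual_norm A F x1 \<Delta>1 \<le> T"
proof -
  let ?t1 = "dual_norm A F x1 \<Delta>1" and ?t2 = "dual_norm A F x2 \<Delta>2"
  have KN: "K * N v \<le> T * chart_norm c x v"
    if "x \<in> chart_dom c" "\<And>v. N v \<le> (1 + s) * chart_norm c x v" for x v
  proof -
    have "K * N v \<le> K * ((1 + s) * chart_norm c x v)" using that(2) K(1) by (intro mult_left_mono)
    also have "\<dots> \<le> K * (2 * chart_norm c x v)"
      using s K(1) is_normD(1)[OF chart_norm(1)[OF c(1) that(1)]] by (intro mult_left_mono mult_right_mono) auto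
    also have "\<dots> = (2 * K) * chart_norm c x v" by simp
    also have "\<dots> \<le> T * chart_norm c x v"
      using K is_normD(1)[OF chart_norm(1)[OF c(1) that(1)]] by (intro mult_right_mono) auto
    finally show ?thesis .
  qed
  have b1: "\<bar>p1 v\<bar> \<le> T * chart_norm c x1 v" and b2: "\<bar>p2 v\<bar> \<le> T * chart_norm c x2 v" for v
    using p KN[OF c(2) close1(1)] KN[OF c(3) close2(1)] order_trans by blast+
  have T: "T \<ge> 0" using K by simp
  note g1 = dual_norm_ge[where D = "blinfun_apply p1" and \<Delta> = \<Delta>1 and c = c and x = x1, OF c(1,2) \<Delta>1 blinfun.bounded_linear_right b1]
  note g2 = dual_norm_ge[where D = "blinfun_apply p2" and \<Delta> = \<Delta>2 and c = c and x = x2, OF c(1,3) \<Delta>2 blinfun.bounded_linear_right b2]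
  show "0 \<le> ?t1" by (rule g1(1))
  show "?t1 \<le> T" by (rule dual_norm_le[where D = "blinfun_apply p1" and \<Delta> = \<Delta>1 and c = c and x = x1, OF c(1,2) \<Delta>1 T b1])
  have t2: "?t2 \<le> T" by (rule dual_norm_le[where D = "blinfun_apply p2" and \<Delta> = \<Delta>2 and c = c and x = x2, OF c(1,3) \<Delta>2 T b2])
  have t2_0: "0 \<le> ?t2" by (rule g2(1))
  have "?t1 \<le> (?t2 * (1 + s) + 6 * e) * (1 + s)"
  proof (rule dual_norm_le[where D = "blinfun_apply p1" and \<Delta> = \<Delta>1 and c = c and x = x1, OF c(1,2) \<Delta>1])
    show "0 \<le> (?t2 * (1 + s) + 6 * e) * (1 + s)" using t2_0 s e by simp
    fix v
    have "\<bar>p1 v\<bar> \<le> \<bar>p2 v\<bar> + \<bar>p1 v + p2 v\<bar>" by linarith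
    also have "\<dots> \<le> ?t2 * ((1 + s) * N v) + 6 * e * N v"
      using g2(2)[of v] p(3)[of v] mult_left_mono[OF close2(2)[of v] t2_0] by linarith
    also have "\<dots> = (?t2 * (1 + s) + 6 * e) * N v" by (simp add: algebra_simps)
    also have "\<dots> \<le> (?t2 * (1 + s) + 6 * e) * ((1 + s) * chart_norm c x1 v)"
      using close1(1)[of v] t2_0 s e by (intro mult_left_mono) auto
    finally show "\<bar>p1 v\<bar> \<le> (?t2 * (1 + s) + 6 * e) * (1 + s) * chart_norm c x1 v" by (simp add: mult.assoc)
  qed
  \<comment> \<open>With s at most 1/6, s (2 + s) is at most 3 s and 6 e (1 + s) at most 7 e; as 3 s
    T is at most e, the total is 8 e.\<close>
  then have "?t1 - ?t2 \<le> ?t2 * (s * (2 + s)) + 6 * e * (1 + s)" by (simp add: algebra_simps)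
  also have "\<dots> \<le> T * (s * 3) + 6 * e * (1 + 1/6)"
    using t2 t2_0 T s e by (intro add_mono mult_mono mult_left_mono) auto
  also have "\<dots> \<le> 8 * e" using s(3) by (simp add: mult_ac)
  finally show "?t1 - ?t2 \<le> 8 * e" .
qed

lemma lower_semicontinuous_tendsto:
  fixes f :: "'m \<Rightarrow> real"
  assumes "lower_semicontinuous f" "(g \<longlongrightarrow> l) G" "G \<noteq> bot" "\<forall>\<^sub>F n in G. f (g n) \<le> a"
  shows "f l \<le> a"
proof (rule ccontr)
  assume "\<not> f l \<le> a"
  then have "\<forall>\<^sub>F n in G. g n \<in> {x. a < f x}"
    using assms(1,2) by (intro topological_tendstoD) (auto simp: lower_semicontinuous_def)
  with assms(4) have "\<forall>\<^sub>F n in G. False" by eventually_elim auto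
  then show False using assms(3) by simp
qed

text \<open>Stated for a locally Lipschitz f1 and a semicontinuous f2, so that it applies to (v, -u)
  as well as to (-u, v). The dual norms stay below a bound T fixed in advance, while x1 and x2 can
  be taken arbitrarily close; hence the product with \<open>d x1 x2\<close> is small too.\<close>

lemma viscosity_test_pair:
  fixes f1 f2 :: "'m \<Rightarrow> real"
  assumes bump: "\<exists>b :: 'x \<Rightarrow> real. C1_Lipschitz_bump b"
    and lsc: "lower_semicontinuous f2" and lip: "Lipschitz_near A F f1 x0"
    and bdd: "\<And>x. m \<le> f1 x" "\<And>x. m \<le> f2 x"
    and e: "e > 0" and \<eta>: "\<eta> > 0"
    and min: "\<And>z. f1 x0 + f2 x0 \<le> f1 z + f2 z + e * d z x0"
  obtains x1 x2 g1 g2 where "C1_fun A g1" "C1_fun A g2"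
    "\<forall>\<^sub>F y in nhds x1. f1 x1 - g1 x1 \<le> f1 y - g1 y" "\<forall>\<^sub>F y in nhds x2. f2 x2 - g2 x2 \<le> f2 y - g2 y"
    "f1 x1 + f2 x2 \<le> f1 x0 + f2 x0" "d x1 x2 \<le> \<eta>"
    "\<bar>dual_norm A F x1 (differential A g1 x1) - dual_norm A F x2 (differential A g2 x2)\<bar> \<le> 8 * e"
    "max \<bar>dual_norm A F x1 (differential A g1 x1)\<bar> \<bar>dual_norm A F x2 (differential A g2 x2)\<bar> * d x1 x2 \<le> \<eta>"
proof -
  obtain c where c: "c \<in> A" "x0 \<in> chart_dom c" by (rule atlas_cover)
  have ch: "is_chart c" using c atlas_is_chart by auto
  let ?a = "chart_map c x0" and ?N = "chart_norm c x0"
  note N = chart_norm[OF c]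
  obtain W1 L0 where W1: "open W1" "x0 \<in> W1" and L0: "\<And>y z. y \<in> W1 \<Longrightarrow> z \<in> W1 \<Longrightarrow> \<bar>f1 y - f1 z\<bar> \<le> L0 * d y z"
    using lip unfolding Lipschitz_near_def by blast
  \<comment> \<open>The factor 2 comes from bounding \<open>d\<close> by twice the norm at x0 in the
    chart; the maximum is taken because the constant in \<open>Lipschitz_near\<close> may be
    negative.\<close>
  define L where "L = 2 * max L0 0"
  \<comment> \<open>L + 6 e bounds both differentials in the norm at x0, and the factor 2 pays for
    the change to the norms at x1 and x2. T depends on L and e alone, so s, W2 and \<tau> can be
    adapted to it without circularity.\<close>
  define T where "T = 2 * (L + 6 * e)"
  define s where "s = min (1/6) (e / (3 * T))"
  have L: "L \<ge> 0" by (simp add: L_def)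
  then have T: "T > 0" using e by (simp add: T_def)
  have s: "0 < s" "s \<le> 1/6" "3 * s * T \<le> e"
  proof -
    show "0 < s" "s \<le> 1/6" using e T by (auto simp: s_def)
    have "s \<le> e / (3 * T)" by (simp add: s_def)
    then have "s * (3 * T) \<le> e" using T by (subst (asm) pos_le_divide_eq) auto
    then show "3 * s * T \<le> e" by (simp add: mult_ac)
  qed
  obtain W2 where W2: "open W2" "x0 \<in> W2"
    "\<And>x v. x \<in> W2 \<Longrightarrow> ?N v \<le> (1 + s) * chart_norm c x v" "\<And>x v. x \<in> W2 \<Longrightarrow> chart_norm c x v \<le> (1 + s) * ?N v"
    by (rule chart_norm_close[OF c s(1)]) blast
  obtain R0 where R0: "R0 > 0" "ball ?a R0 \<subseteq> chart_map c ` chart_dom c" "\<And>w. w \<in> ball ?a R0 \<Longrightarrow> chart_inv c w \<in> W1 \<inter> W2"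
    by (rule chart_ball[OF c, of "W1 \<inter> W2"]) (use W1 W2 in auto)
  have d_le: "d (chart_inv c y) (chart_inv c z) \<le> 2 * ?N (z - y)" if "y \<in> ball ?a R0" "z \<in> ball ?a R0" for y z
  proof (rule d_chart_le[OF c R0(2) _ that])
    fix w v assume "w \<in> ball ?a R0"
    then have "chart_norm c (chart_inv c w) v \<le> (1 + s) * ?N v" using R0(3) W2(4) by blast
    also have "\<dots> \<le> 2 * ?N v" using s is_normD(1)[OF N(1)] by (intro mult_right_mono) auto
    finally show "chart_norm c (chart_inv c w) v \<le> 2 * ?N v" .
  qed
  define r where "r = R0 / 2"
  have r: "r > 0" "cball ?a r \<subseteq> ball ?a R0" using R0(1) by (auto simp: r_def)
  obtain M where M: "M > 0" "\<And>v. ?N v \<le> M * norm v" using N(2) by (auto simp: equivalent_to_norm_def)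
  \<comment> \<open>Points x, y of the \<tau>-ball satisfy
    \<open>d x1 x2 \<le> 4 * M * \<tau>\<close>; dividing by T + 1 makes both \<open>d x1 x2\<close>
    and \<open>T * d x1 x2\<close> at most \<eta>.\<close>
  define \<tau> where "\<tau> = min r (\<eta> / (4 * M * (T + 1)))"
  have \<tau>: "\<tau> > 0" using r \<eta> M T by (simp add: \<tau>_def)
  have inv_a: "chart_inv c ?a = x0" using is_chartD(5)[OF ch c(2)] .
  obtain \<beta> :: "'x \<Rightarrow> real" and \<beta>' C r1 where "C1_gauge \<beta> \<beta>' C r1"
    using bump C1_gauge_exists by blast
  then interpret C1_gauge \<beta> \<beta>' C r1 .
  \<comment> \<open>The sum rule is applied with 2 e in place of e: minimality at x0 is known with
    the term \<open>e * d z x0\<close>, and \<open>d\<close> is bounded by twice the norm in the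
    chart. This is the source of the 6 e below.\<close>
  obtain x y h1 h2 p1 p2 where xy: "x \<in> ball ?a \<tau>" "y \<in> ball ?a \<tau>"
    and h: "C1_on UNIV h1" "C1_on UNIV h2"
    "(h1 has_derivative blinfun_apply p1) (at x)" "(h2 has_derivative blinfun_apply p2) (at y)"
    and hmin: "\<forall>\<^sub>F z in nhds x. f1 (chart_inv c x) - h1 x \<le> f1 (chart_inv c z) - h1 z"
    "\<forall>\<^sub>F z in nhds y. f2 (chart_inv c y) - h2 y \<le> f2 (chart_inv c z) - h2 z"
    and p: "\<And>v. \<bar>p1 v + p2 v\<bar> \<le> 3 * (2 * e) * ?N v" "\<And>v. \<bar>p1 v\<bar> \<le> L * ?N v"
    and le: "f1 (chart_inv c x) + f2 (chart_inv c y) \<le> f1 (chart_inv c ?a) + f2 (chart_inv c ?a)"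
  proof (rule fuzzy_sum_rule[OF N r(1) \<tau>, of "2 * e" L ?a m "\<lambda>z. f1 (chart_inv c z)" "\<lambda>z. f2 (chart_inv c z)"])
    show "\<bar>f1 (chart_inv c x) - f1 (chart_inv c y)\<bar> \<le> L * ?N (x - y)" if "x \<in> cball ?a r" "y \<in> cball ?a r" for x y
    proof -
      have xy: "x \<in> ball ?a R0" "y \<in> ball ?a R0" using that r(2) by auto
      then have "\<bar>f1 (chart_inv c x) - f1 (chart_inv c y)\<bar> \<le> L0 * d (chart_inv c x) (chart_inv c y)"
        using R0(3) by (intro L0) auto
      also have "\<dots> \<le> max L0 0 * (2 * ?N (y - x))"
        using d_le[OF xy] d_nonneg by (intro mult_mono) auto
      also have "\<dots> = L * ?N (x - y)" using is_normD(7)[OF N(1)] by (simp add: L_def)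
      finally show ?thesis .
    qed
    show "f1 (chart_inv c ?a) + f2 (chart_inv c ?a) \<le> f1 (chart_inv c x) + f2 (chart_inv c x) + 2 * e * ?N (x - ?a)"
      if "x \<in> cball ?a r" for x
    proof -
      have "x \<in> ball ?a R0" "?a \<in> ball ?a R0" using that r(2) R0(1) by auto
      from d_le[OF this] have "e * d (chart_inv c x) x0 \<le> e * (2 * ?N (x - ?a))"
        using e is_normD(7)[OF N(1)] unfolding inv_a by simp
      then show ?thesis using min[of "chart_inv c x"] unfolding inv_a by simp
    qed
    show "f2 (chart_inv c l) \<le> b" if "range \<sigma> \<subseteq> cball ?a r" "\<sigma> \<longlonglongrightarrow> l" "\<And>n::nat. f2 (chart_inv c (\<sigma> n)) \<le> b" for \<sigma> l b
    proof -
      have "l \<in> cball ?a r" using closed_sequentially[OF closed_cball _ that(2)] that(1) by blast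
      then have "isCont (chart_inv c) l"
        using r(2) R0(2) is_chartD(2,4)[OF ch] continuous_on_eq_continuous_at by blast
      then have "(\<lambda>n. chart_inv c (\<sigma> n)) \<longlonglongrightarrow> chart_inv c l" using that(2) by (rule isCont_tendsto_compose)
      then show ?thesis
        by (rule lower_semicontinuous_tendsto[OF lsc]) (use that(3) in auto)
    qed
  qed (use e L bdd in \<open>auto intro: that\<close>)
  have sub: "ball ?a \<tau> \<subseteq> ball ?a R0" using r by (auto simp: \<tau>_def r_def)
  then have xy0: "x \<in> ball ?a R0" "y \<in> ball ?a R0" using xy by auto
  then have img: "x \<in> chart_map c ` chart_dom c" "y \<in> chart_map c ` chart_dom c" using R0(2) by auto
  define x1 where "x1 = chart_inv c x"
  define x2 where "x2 = chart_inv c y"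
  have dom: "x1 \<in> chart_dom c" "x2 \<in> chart_dom c" using is_chartD(7)[OF ch] img by (auto simp: x1_def x2_def)
  have W: "x1 \<in> W2" "x2 \<in> W2" using R0(3) xy0 by (auto simp: x1_def x2_def)
  obtain g1 where g1: "C1_fun A g1" "\<forall>\<^sub>F y in nhds x1. f1 x1 - g1 x1 \<le> f1 y - g1 y"
    "\<And>v. differential A g1 x1 (tangent_vec A c x1 v) = p1 v"
    unfolding x1_def by (rule lift_test_function[OF bump c(1) img(1) h(1,3) hmin(1)]) blast
  obtain g2 where g2: "C1_fun A g2" "\<forall>\<^sub>F y in nhds x2. f2 x2 - g2 x2 \<le> f2 y - g2 y"
    "\<And>v. differential A g2 x2 (tangent_vec A c x2 v) = p2 v"
    unfolding x2_def by (rule lift_test_function[OF bump c(1) img(2) h(2,4) hmin(2)]) blast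
  have N0: "0 \<le> ?N v" for v by (rule is_normD(1)[OF N(1)])
  have q: "\<bar>p1 v\<bar> \<le> (L + 6 * e) * ?N v" "\<bar>p2 v\<bar> \<le> (L + 6 * e) * ?N v"
    "\<bar>p1 v + p2 v\<bar> \<le> 6 * e * ?N v" "\<bar>p2 v + p1 v\<bar> \<le> 6 * e * ?N v" for v
  proof -
    have "0 \<le> 6 * e * ?N v" using e N0 by simp
    then show "\<bar>p1 v\<bar> \<le> (L + 6 * e) * ?N v" "\<bar>p2 v\<bar> \<le> (L + 6 * e) * ?N v"
      "\<bar>p1 v + p2 v\<bar> \<le> 6 * e * ?N v" "\<bar>p2 v + p1 v\<bar> \<le> 6 * e * ?N v"
      using p(1)[of v] p(2)[of v] unfolding distrib_right by linarith+
  qed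
  let ?t1 = "dual_norm A F x1 (differential A g1 x1)" and ?t2 = "dual_norm A F x2 (differential A g2 x2)"
  have K: "0 \<le> L + 6 * e" "2 * (L + 6 * e) \<le> T" using L e by (auto simp: T_def)
  have t1: "?t1 - ?t2 \<le> 8 * e" "0 \<le> ?t1" "?t1 \<le> T"
    by (rule dual_norm_diff_le[OF c(1) dom g1(3) g2(3) s e W2(3,4)[OF W(1)] W2(3,4)[OF W(2)] q(1,2,3) K])+
  have t2: "?t2 - ?t1 \<le> 8 * e" "0 \<le> ?t2" "?t2 \<le> T"
    by (rule dual_norm_diff_le[OF c(1) dom(2,1) g2(3) g1(3) s e W2(3,4)[OF W(2)] W2(3,4)[OF W(1)] q(2,1,4) K])+
  have dT: "d x1 x2 * (T + 1) \<le> \<eta>"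
  proof -
    have "d x1 x2 \<le> 2 * ?N (y - x)" unfolding x1_def x2_def by (rule d_le[OF xy0])
    also have "\<dots> \<le> 2 * (M * (2 * \<tau>))"
    proof -
      have "norm (y - x) \<le> 2 * \<tau>"
        using norm_triangle_ineq4[of "y - ?a" "x - ?a"] xy by (simp add: dist_norm norm_minus_commute)
      then show ?thesis using M by (auto intro!: order_trans[OF M(2)])
    qed
    also have "\<dots> = 4 * M * \<tau>" by simp
    finally have "d x1 x2 * (T + 1) \<le> 4 * M * \<tau> * (T + 1)" using T by (intro mult_right_mono) auto
    also have "\<dots> = \<tau> * (4 * M * (T + 1))" by (simp add: mult_ac)
    also have "\<dots> \<le> \<eta>"
    proof -
      have "\<tau> \<le> \<eta> / (4 * M * (T + 1))" by (simp add: \<tau>_def)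
      moreover have "0 < 4 * M * (T + 1)" using M(1) T by simp
      ultimately show ?thesis using pos_le_divide_eq by blast
    qed
    finally show ?thesis .
  qed
  have d0: "0 \<le> d x1 x2" by (rule d_nonneg)
  show ?thesis
  proof (rule that[OF g1(1) g2(1) g1(2) g2(2)])
    show "f1 x1 + f2 x2 \<le> f1 x0 + f2 x0" using le inv_a by (simp add: x1_def x2_def)
    show "d x1 x2 \<le> \<eta>" using dT mult_nonneg_nonneg[OF d0 less_imp_le[OF T]] by (simp add: distrib_left)
    show "\<bar>?t1 - ?t2\<bar> \<le> 8 * e" using t1 t2 by (simp add: abs_le_iff)
    have "max \<bar>?t1\<bar> \<bar>?t2\<bar> * d x1 x2 \<le> T * d x1 x2" using t1 t2 d0 by (intro mult_right_mono) auto
    also have "\<dots> \<le> \<eta>" using dT d0 by (simp add: distrib_left mult.commute[of T])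
    finally show "max \<bar>?t1\<bar> \<bar>?t2\<bar> * d x1 x2 \<le> \<eta>" .
  qed
qed

end

theorem theorem4p4:
  fixes A :: "('m::t2_space, 'x::banach) chart set"
    and F :: "'m \<Rightarrow> ('m, 'x) tangent \<Rightarrow> real"
    and H :: "'m \<times> real \<Rightarrow> real"
    and u v :: "'m \<Rightarrow> real"
  assumes "C1_Finsler_manifold A F"
    and "Finsler_complete A F"
    and "\<exists>b :: 'x \<Rightarrow> real. C1_Lipschitz_bump b"
    and "continuous_on UNIV H"
    and "condition_A A F H"
    and "viscosity_subsolution A F H u"
    and "viscosity_supersolution A F H v"
    and "bounded (range u)"
    and "bounded (range v)"
    and "\<And>x. Lipschitz_near A F u x \<or> Lipschitz_near A F v x"
  shows "(INF x. v x - u x) \<ge> 0"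
proof (rule ccontr)
  interpret Finsler_manifold A F by unfold_locales (rule assms(1))
  interpret M: Metric_space UNIV d by (rule Metric_space_d)
  define I where "I = (INF x. v x - u x)"
  assume "\<not> 0 \<le> (INF x. v x - u x)"
  then have I: "I < 0" by (simp add: I_def)
  \<comment> \<open>At the end the value v x1 - u x2 is below I + \<kappa> = -3 \<kappa>, whereas
    \<omega> and the term with C account for at most \<kappa> each.\<close>
  define \<kappa> where "\<kappa> = - I / 4"
  have \<kappa>: "\<kappa> > 0" using I by (simp add: \<kappa>_def)
  obtain Bu where Bu: "\<And>x. \<bar>u x\<bar> \<le> Bu" using assms(8) by (auto simp: bounded_iff)
  obtain Bv where Bv: "\<And>x. \<bar>v x\<bar> \<le> Bv" using assms(9) by (auto simp: bounded_iff)
  define m where "m = - max Bu Bv"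
  have m: "m \<le> v x" "m \<le> - u x" for x using Bu[of x] Bv[of x] by (auto simp: m_def)
  have lsc_v: "lower_semicontinuous v" using assms(7) by (simp add: viscosity_supersolution_def)
  have lsc_u: "lower_semicontinuous (\<lambda>x. - u x)"
    unfolding lower_semicontinuous_def
  proof
    fix a
    have "open {x. u x < - a}"
      using assms(6) by (simp add: viscosity_subsolution_def upper_semicontinuous_def)
    moreover have "{x. u x < - a} = {x. a < - u x}" by auto
    ultimately show "open {x. a < - u x}" by simp
  qed
  have super: "0 \<le> v x + H (x, dual_norm A F x (differential A g x))"
    if "C1_fun A g" "\<forall>\<^sub>F y in nhds x. v x - g x \<le> v y - g y" for x g
    using assms(7) that unfolding viscosity_supersolution_def subdifferential_def by blast
  have sub: "u x + H (x, dual_norm A F x (differential A g x)) \<le> 0"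
    if g: "C1_fun A g" "\<forall>\<^sub>F y in nhds x. - u x - g x \<le> - u y - g y" for x g
  proof -
    have "\<forall>\<^sub>F y in nhds x. u y - (- g y) \<le> u x - (- g x)"
      using g(2) by eventually_elim simp
    then have "differential A (\<lambda>y. - g y) x \<in> superdifferential A u x"
      unfolding superdifferential_def using C1_fun_uminus[OF g(1)] by blast
    then have "u x + H (x, dual_norm A F x (differential A (\<lambda>y. - g y) x)) \<le> 0"
      using assms(6) unfolding viscosity_subsolution_def by blast
    then show ?thesis unfolding dual_norm_differential_uminus[OF g(1)] .
  qed
  obtain C \<omega> where C: "C \<ge> 0" and \<omega>: "continuous_on UNIV \<omega>" "\<omega> (0, 0) = (0 :: real)"
    and HA: "\<And>x1 x2 t1 t2. \<bar>H (x1, t1) - H (x2, t2)\<bar> \<le> \<omega> (d x1 x2, t1 - t2) + C * max \<bar>t1\<bar> \<bar>t2\<bar> * d x1 x2"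
    using assms(5) unfolding condition_A_def by blast
  obtain \<rho> where \<rho>: "\<rho> > 0" "\<And>s t. \<bar>s\<bar> < \<rho> \<Longrightarrow> \<bar>t\<bar> < \<rho> \<Longrightarrow> \<omega> (s, t) < \<kappa>"
  proof -
    have "open {p. \<omega> p < \<kappa>}" using \<omega>(1) by (intro open_Collect_less continuous_on_const)
    moreover have "(0, 0) \<in> {p. \<omega> p < \<kappa>}" using \<omega>(2) \<kappa> by simp
    ultimately obtain S T where ST: "open S" "open T" "(0, 0) \<in> S \<times> T" "S \<times> T \<subseteq> {p. \<omega> p < \<kappa>}"
      by (rule open_prod_elim)
    then obtain r1 r2 where "r1 > 0" "ball 0 r1 \<subseteq> S" "r2 > 0" "ball 0 r2 \<subseteq> T" by (meson mem_Sigma_iff openE)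
    then show ?thesis using ST(4) by (intro that[of "min r1 r2"]) (auto simp: subset_iff)
  qed
  \<comment> \<open>The slope in Ekeland's principle; the dual norms will differ by at most 8 e,
    which has to stay below \<rho> as second argument of \<omega>.\<close>
  define e where "e = min \<kappa> (\<rho> / 16)"
  have e: "e > 0" "8 * e < \<rho>" "e \<le> \<kappa>" using \<rho> \<kappa> by (auto simp: e_def)
  \<comment> \<open>Bounds the first argument of \<omega> and also the product of distance and dual
    norms; C + 1 serves as divisor because C may be 0.\<close>
  define \<eta> where "\<eta> = min (\<rho> / 2) (\<kappa> / (C + 1))"
  have \<eta>: "\<eta> > 0" "\<eta> < \<rho>" "C * \<eta> \<le> \<kappa>"
  proof -
    show "\<eta> > 0" "\<eta> < \<rho>" using \<rho> \<kappa> C by (auto simp: \<eta>_def)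
    have "C * \<eta> \<le> (C + 1) * (\<kappa> / (C + 1))" using C \<kappa> \<open>\<eta> > 0\<close> by (intro mult_mono) (auto simp: \<eta>_def)
    then show "C * \<eta> \<le> \<kappa>" using C by simp
  qed
  have bdd: "bdd_below (range (\<lambda>x. v x - u x))"
  proof (rule bdd_belowI)
    fix y assume "y \<in> range (\<lambda>x. v x - u x)"
    then obtain x where "y = v x - u x" by blast
    then show "2 * m \<le> y" using m[of x] by simp
  qed
  have "\<exists>y\<in>range (\<lambda>x. v x - u x). y < I + \<kappa>"
    using cInf_less_iff[OF _ bdd, of "I + \<kappa>"] \<kappa> by (simp add: I_def)
  then obtain y0 where y0: "v y0 - u y0 < I + \<kappa>" by blast
  obtain x0 where x0: "v x0 - u x0 \<le> v y0 - u y0" "\<And>z. v x0 - u x0 \<le> v z - u z + e * d z x0"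
  proof (rule M.Ekeland[of "2 * m" "\<lambda>x. v x - u x" y0 e])
    show "M.mcomplete" using assms(2) by (simp add: Finsler_complete_def)
    show "2 * m \<le> v x - u x" for x using m[of x] by simp
    \<comment> \<open>Each of v and -u drops by less than half of the excess h on a manifold
      neighbourhood of l. This contains a ball of \<open>d\<close>, hence some term of the
      sequence.\<close>
    show "v l - u l \<le> a" if "(\<lambda>n. d (\<sigma> n) l) \<longlonglongrightarrow> 0" "\<And>n::nat. v (\<sigma> n) - u (\<sigma> n) \<le> a" for \<sigma> l a
    proof (rule ccontr)
      assume "\<not> v l - u l \<le> a"
      define h where "h = (v l - u l - a) / 2"
      have h: "h > 0" using \<open>\<not> v l - u l \<le> a\<close> by (simp add: h_def)
      have "open ({x. v l - h < v x} \<inter> {x. - u l - h < - u x})"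
        using lsc_u lsc_v by (intro open_Int) (auto simp: lower_semicontinuous_def)
      moreover have "l \<in> {x. v l - h < v x} \<inter> {x. - u l - h < - u x}" using h by simp
      ultimately obtain r where r: "r > 0" "\<And>y. d l y < r \<Longrightarrow> y \<in> {x. v l - h < v x} \<inter> {x. - u l - h < - u x}"
        by (rule d_neighbourhood) blast
      have "\<forall>\<^sub>F n in sequentially. d (\<sigma> n) l < r" using that(1) r(1) by (rule order_tendstoD)
      then obtain n where "d (\<sigma> n) l < r" by (auto simp: eventually_sequentially)
      then have "v l - h < v (\<sigma> n)" "- u l - h < - u (\<sigma> n)" using r(2)[of "\<sigma> n"] d_commute by auto
      then show False using that(2)[of n] by (simp add: h_def field_simps)
    qed
  qed (use e in auto)
  \<comment> \<open>The roles are fixed, v tested at x1 and u at x2, so that both cases below end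
    here; when u is the Lipschitz function the two points are exchanged.\<close>
  have "False"
    if g: "C1_fun A g1" "C1_fun A g2"
      "\<forall>\<^sub>F y in nhds x1. v x1 - g1 x1 \<le> v y - g1 y" "\<forall>\<^sub>F y in nhds x2. - u x2 - g2 x2 \<le> - u y - g2 y"
      and le: "v x1 + - u x2 \<le> v x0 + - u x0"
      and d12: "d x1 x2 \<le> \<eta>"
      and t: "t1 = dual_norm A F x1 (differential A g1 x1)" "t2 = dual_norm A F x2 (differential A g2 x2)"
        "\<bar>t1 - t2\<bar> \<le> 8 * e" "max \<bar>t1\<bar> \<bar>t2\<bar> * d x1 x2 \<le> \<eta>"
    for x1 x2 g1 g2 t1 t2
  proof -
    have "H (x2, t2) - H (x1, t1) \<le> v x1 - u x2" using super[OF g(1,3)] sub[OF g(2,4)] t by simp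
    moreover have "\<bar>H (x1, t1) - H (x2, t2)\<bar> \<le> \<omega> (d x1 x2, t1 - t2) + C * (max \<bar>t1\<bar> \<bar>t2\<bar> * d x1 x2)"
      using HA by (simp add: mult.assoc)
    moreover have "\<omega> (d x1 x2, t1 - t2) < \<kappa>" using d12 \<eta> t(3) e(2) d_nonneg[of x1 x2] by (intro \<rho>(2)) auto
    moreover have "C * (max \<bar>t1\<bar> \<bar>t2\<bar> * d x1 x2) \<le> \<kappa>"
      using mult_left_mono[OF t(4) C] \<eta>(3) by linarith
    moreover have "v x1 - u x2 < I + \<kappa>" using le x0(1) y0 by simp
    ultimately show False using \<kappa>_def by linarith
  qed
  note contradiction = this
  show False
  proof (cases "Lipschitz_near A F v x0")
    case True
    have min: "v x0 + - u x0 \<le> v z + - u z + e * d z x0" for z using x0(2)[of z] by simp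
    obtain x1 x2 g1 g2 where "C1_fun A g1" "C1_fun A g2"
      "\<forall>\<^sub>F y in nhds x1. v x1 - g1 x1 \<le> v y - g1 y" "\<forall>\<^sub>F y in nhds x2. - u x2 - g2 x2 \<le> - u y - g2 y"
      "v x1 + - u x2 \<le> v x0 + - u x0" "d x1 x2 \<le> \<eta>"
      "\<bar>dual_norm A F x1 (differential A g1 x1) - dual_norm A F x2 (differential A g2 x2)\<bar> \<le> 8 * e"
      "max \<bar>dual_norm A F x1 (differential A g1 x1)\<bar> \<bar>dual_norm A F x2 (differential A g2 x2)\<bar> * d x1 x2 \<le> \<eta>"
      by (rule viscosity_test_pair[OF assms(3) lsc_u True m e(1) \<eta>(1) min]) blast
    then show False by (intro contradiction[OF _ _ _ _ _ _ refl refl])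
  next
    case False
    then have "Lipschitz_near A F u x0" using assms(10) by blast
    then have lip: "Lipschitz_near A F (\<lambda>x. - u x) x0"
      unfolding Lipschitz_near_def by (simp add: abs_minus_commute)
    have min: "- u x0 + v x0 \<le> - u z + v z + e * d z x0" for z using x0(2)[of z] by simp
    obtain x1 x2 g1 g2 where "C1_fun A g1" "C1_fun A g2"
      "\<forall>\<^sub>F y in nhds x1. - u x1 - g1 x1 \<le> - u y - g1 y" "\<forall>\<^sub>F y in nhds x2. v x2 - g2 x2 \<le> v y - g2 y"
      "- u x1 + v x2 \<le> - u x0 + v x0" "d x1 x2 \<le> \<eta>"
      "\<bar>dual_norm A F x1 (differential A g1 x1) - dual_norm A F x2 (differential A g2 x2)\<bar> \<le> 8 * e"
      "max \<bar>dual_norm A F x1 (differential A g1 x1)\<bar> \<bar>dual_norm A F x2 (differential A g2 x2)\<bar> * d x1 x2 \<le> \<eta>"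
      by (rule viscosity_test_pair[OF assms(3) lsc_v lip m(2,1) e(1) \<eta>(1) min]) blast
    then show False
      by (intro contradiction[OF _ _ _ _ _ _ refl refl, of g2 g1 x2 x1])
        (simp_all add: d_commute[of x2 x1] abs_minus_commute max.commute)
  qed
qed

end
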